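(* Let $\mathcal{V}=\{\phi_\Lambda\}_{\Lambda\in\mathcal{C}}$ be a positive, continuous, $T$-invariant specification on $X=S^{\mathbb{Z}}$ with specification sequence $\{[0,n],f_n\}_{n=0}^\infty$. If, for some $0<\alpha\leq1$ and $K>0$, $$\limsup_{n\to\infty}\,n^{\alpha-1}\prod_{i=0}^n\sup_{j\geq0}r_{(-\infty,i+j]}(f_j)\leq K$$ and $$\limsup_{n\to\infty}\,n^{1/2}\Bigl(\log\sup_{j\geq0}r_{[-n,\infty)}(f_j)\Bigr)^\alpha<K^{-1}\Gamma(\alpha),$$ then $\mathcal{V}$ has a unique $T$-invariant Gibbs state.
   Context: $\Gamma$ is the Gamma function. $S$ is a finite set with the discrete topology, $X=S^{\mathbb{Z}}$ has the product topology, and $\mathcal{B}$ is its Borel $\sigma$-algebra; $B(X)$ is the set of bounded Borel functions on $X$. $\mathcal{C}$ is the set of finite non-empty subsets of $\mathbb{Z}$. Intervals denote sets of integers. For $\Lambda\subseteq\mathbb{Z}$, $x_\Lambda$ is the projection of $x$ onto $S^\Lambda$, $[x]_\Lambda=\{y\in X:y_\Lambda=x_\Lambda\}$, $\Lambda^c=\mathbb{Z}\setminus\Lambda$, and $\mathcal{B}_\Lambda$ is the sub-$\sigma$-algebra of $\mathcal{B}$ generated by the coordinates in $\Lambda$. $T$ is the shift, $(Tx)_j=x_{j+1}$. A specification on $X$ is a collection $\mathcal{V}=\{\phi_\Lambda\}_{\Lambda\in\mathcal{C}}$ of non-negative Borel functions on $X$ such that for all $\Lambda\in\mathcal{C}$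 and $x\in X$, $\sum_{y\in[x]_{\Lambda^c}}\phi_\Lambda(y)=1$, and for all non-empty $K'\subseteq\Lambda$, $\phi_\Lambda(x)=\phi_{K'}(x)\sum_{y\in[x]_{K'^c}}\phi_\Lambda(y)$. It is continuous if every $\phi_\Lambda$ is continuous, positive if every $\phi_\Lambda>0$, and $T$-invariant if $\phi_{i+\Lambda}(x)=\phi_\Lambda(T^ix)$ for all $i\in\mathbb{Z}$, $\Lambda\in\mathcal{C}$, $x\in X$. A Gibbs state for $\mathcal{V}$ is a probability measure $\mu$ on $(X,\mathcal{B})$ such that for all $\Lambda\in\mathcal{C}$, $\mu([x]_\Lambda\,|\,\mathcal{B}_{\Lambda^c})(x)=\phi_\Lambda(x)$ for $\mu$-a.e. $x$ (the left side is the value at $x$ of the conditional probability of the cylinder $\{y:y_\Lambda=\xi\}$ with $\xi=x_\Lambda$). A specification sequence $\{[0,n],f_n\}_{n=0}^\infty$ consists of positive functions $f_n\in B(X)$ with $f_n$ being $\mathcal{B}_{\mathbb{Z}\setminus[0,n-1]}$-measurable ($f_0$ is just Borel). It is a specification sequence for $\mathcal{V}$ if $\phi_{[0,n]}(x)=\bigl(\prod_{j=0}^nf_j(x)\bigr)\bigl(\sum_{y\in[x]_{[0,n]^c}}\prod_{j=0}^nf_j(y)\bigr)^{-1}$ for all $n\ge0$, $x\in X$. For a positive function $h$ on $X$ and $\Lambda\subseteq\mathbb{Z}$, $r_\Lambda(h)=\sup\{h(x)/h(y):x,y\in X,\ x_\Lambda=y_\Lambda\}$. *)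

theory Defs
  imports "HOL-Probability.Probability"
begin

text \<open>
  The configuration space \<open>X = S\<^sup>\<int>\<close> is the type \<^typ>\<open>int \<Rightarrow> 's\<close> with
  \<open>'s :: {finite, discrete_topology}\<close>. Its topology is the product topology of the function-space
  instance, and its Borel \<open>\<sigma>\<close>-algebra is \<^term>\<open>borel\<close>. The projection of \<open>x\<close> onto \<open>S\<^sup>\<Lambda>\<close> is
  \<^term>\<open>restrict x \<Lambda>\<close>.
\<close>

definition cyl :: "int set \<Rightarrow> (int \<Rightarrow> 's) \<Rightarrow> (int \<Rightarrow> 's) set" where
  "cyl \<Lambda> x = {y. restrict y \<Lambda> = restrict x \<Lambda>}"

definition coord_algebra :: "int set \<Rightarrow> (int \<Rightarrow> 's) measure" where
  "coord_algebra \<Lambda> = sigma UNIV {(\<lambda>x. x i) -` A | i A. i \<in> \<Lambda>}"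

definition shift :: "(int \<Rightarrow> 's) \<Rightarrow> (int \<Rightarrow> 's)" where
  "shift x = (\<lambda>j. x (j + 1))"

text \<open>Since iteration \<open>(^^)\<close> only takes natural exponents, the integer powers of the
  bijection \<^const>\<open>shift\<close> are given by the explicit formula; the two lemmas show that it is the right one.\<close>

definition shift_pow :: "int \<Rightarrow> (int \<Rightarrow> 's) \<Rightarrow> (int \<Rightarrow> 's)" where
  "shift_pow i x = (\<lambda>j. x (j + i))"

lemma shift_pow_of_nat: "shift_pow (int n) = shift ^^ n"
proof (induction n)
  case 0
  show ?case by (simp add: shift_pow_def fun_eq_iff)
next
  case (Suc n)
  have "shift_pow (int (Suc n)) x = shift (shift_pow (int n) x)" for x :: "int \<Rightarrow> 'a"
    by (simp add: shift_pow_def shift_def fun_eq_iff algebra_simps)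
  then show ?case using Suc by (simp add: fun_eq_iff)
qed

lemma shift_pow_uminus: "shift_pow (- i) (shift_pow i x) = x"
  by (simp add: shift_pow_def)

definition is_specification :: "(int set \<Rightarrow> (int \<Rightarrow> 's::{finite, discrete_topology}) \<Rightarrow> real) \<Rightarrow> bool" where
  "is_specification \<phi> \<longleftrightarrow>
     (\<forall>\<Lambda>. finite \<Lambda> \<and> \<Lambda> \<noteq> {} \<longrightarrow>
        \<phi> \<Lambda> \<in> borel_measurable borel \<and>
        (\<forall>x. 0 \<le> \<phi> \<Lambda> x) \<and>
        (\<forall>x. (\<Sum>y\<in>cyl (- \<Lambda>) x. \<phi> \<Lambda> y) = 1) \<and>
        (\<forall>K'. K' \<noteq> {} \<and> K' \<subseteq> \<Lambda> \<longrightarrow>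
           (\<forall>x. \<phi> \<Lambda> x = \<phi> K' x * (\<Sum>y\<in>cyl (- K') x. \<phi> \<Lambda> y))))"

definition continuous_spec :: "(int set \<Rightarrow> (int \<Rightarrow> 's::{finite, discrete_topology}) \<Rightarrow> real) \<Rightarrow> bool" where
  "continuous_spec \<phi> \<longleftrightarrow> (\<forall>\<Lambda>. finite \<Lambda> \<and> \<Lambda> \<noteq> {} \<longrightarrow> continuous_on UNIV (\<phi> \<Lambda>))"

definition positive_spec :: "(int set \<Rightarrow> (int \<Rightarrow> 's) \<Rightarrow> real) \<Rightarrow> bool" where
  "positive_spec \<phi> \<longleftrightarrow> (\<forall>\<Lambda>. finite \<Lambda> \<and> \<Lambda> \<noteq> {} \<longrightarrow> (\<forall>x. 0 < \<phi> \<Lambda> x))"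

definition shift_invariant_spec :: "(int set \<Rightarrow> (int \<Rightarrow> 's) \<Rightarrow> real) \<Rightarrow> bool" where
  "shift_invariant_spec \<phi> \<longleftrightarrow>
     (\<forall>i \<Lambda> x. finite \<Lambda> \<and> \<Lambda> \<noteq> {} \<longrightarrow> \<phi> ((+) i ` \<Lambda>) x = \<phi> \<Lambda> (shift_pow i x))"

text \<open>
  The function conditioned on below depends on \<open>x\<close> only through \<open>cyl \<Lambda> x\<close>, hence takes only finitely
  many values; so the choice of a version of each conditional probability is immaterial.
\<close>

definition gibbs_state ::
    "(int set \<Rightarrow> (int \<Rightarrow> 's::{finite, discrete_topology}) \<Rightarrow> real) \<Rightarrow> (int \<Rightarrow> 's) measure \<Rightarrow> bool" where
  "gibbs_state \<phi> \<mu> \<longleftrightarrow>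
     prob_space \<mu> \<and> sets \<mu> = sets borel \<and>
     (\<forall>\<Lambda>. finite \<Lambda> \<and> \<Lambda> \<noteq> {} \<longrightarrow>
        (AE x in \<mu>. real_cond_exp \<mu> (coord_algebra (- \<Lambda>)) (indicator (cyl \<Lambda> x)) x = \<phi> \<Lambda> x))"

definition shift_invariant_measure ::
    "(int \<Rightarrow> 's::{finite, discrete_topology}) measure \<Rightarrow> bool" where
  "shift_invariant_measure \<mu> \<longleftrightarrow> distr \<mu> borel shift = \<mu>"

text \<open>For \<open>n = 0\<close> the interval \<^term>\<open>{0..int n - 1}\<close> is empty, so \<open>f 0\<close> is only required to be Borel.\<close>

definition specification_sequence ::
    "(nat \<Rightarrow> (int \<Rightarrow> 's::{finite, discrete_topology}) \<Rightarrow> real) \<Rightarrow> bool" where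
  "specification_sequence f \<longleftrightarrow>
     (\<forall>n. (\<forall>x. 0 < f n x) \<and> bounded (range (f n)) \<and> f n \<in> borel_measurable borel \<and>
          f n \<in> borel_measurable (coord_algebra (- {0..int n - 1})))"

definition specification_sequence_for ::
    "(nat \<Rightarrow> (int \<Rightarrow> 's::{finite, discrete_topology}) \<Rightarrow> real) \<Rightarrow>
     (int set \<Rightarrow> (int \<Rightarrow> 's) \<Rightarrow> real) \<Rightarrow> bool" where
  "specification_sequence_for f \<phi> \<longleftrightarrow>
     specification_sequence f \<and>
     (\<forall>n x. \<phi> {0..int n} x =
        (\<Prod>j\<le>n. f j x) * inverse (\<Sum>y\<in>cyl (- {0..int n}) x. \<Prod>j\<le>n. f j y))"

text \<open>The supremum may be infinite, so it is taken in the extended reals.\<close>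

definition ratio_osc :: "int set \<Rightarrow> ((int \<Rightarrow> 's) \<Rightarrow> real) \<Rightarrow> ereal" where
  "ratio_osc \<Lambda> h = (SUP (x, y) \<in> {(x, y). restrict x \<Lambda> = restrict y \<Lambda>}. ereal (h x / h y))"

text \<open>
  Logarithm on \<open>[0, \<infinity>]\<close>, and powers on \<open>[0, \<infinity>]\<close> with a positive real exponent.
  They are only applied to arguments at least \<open>1\<close> and at least \<open>0\<close>, respectively.
\<close>

definition ereal_ln :: "ereal \<Rightarrow> ereal" where
  "ereal_ln x = (if x = \<infinity> then \<infinity> else if x \<le> 0 then - \<infinity> else ereal (ln (real_of_ereal x)))"

definition ereal_powr :: "ereal \<Rightarrow> real \<Rightarrow> ereal" where
  "ereal_powr x a = (if x = \<infinity> then \<infinity> else ereal (real_of_ereal x powr a))"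

end

theory Submission
  imports Defs "HOL-Real_Asymp.Real_Asymp"
begin

text \<open>
  Let \<open>R i\<close> be the supremum over \<open>j\<close> of \<open>r(f j)\<close> for agreement on \<open>(-\<infinity>, i + j]\<close>. The products
  \<open>v n = 1 / (R 0 \<cdots> R (n - 1))\<close> are log-convex (\<open>R\<close> decreases), so by Kaluza they are the renewal sequence of a
  distribution \<open>p\<close> on \<open>{1, 2, \<dots>}\<close>. Take two boundary conditions that agree on \<open>[-n, 0)\<close>; changing
  one into the other on the left costs a factor \<open>exp (-l)\<close> at each site. A superharmonicity argument
  along the renewals bounds the odds of the symbols at the origin in both directions, and by
  Cauchy--Schwarz the product of the two bounds is at least \<open>(\<Sum>t. p t * exp (-l * t))\<^sup>2\<close>. The first
  hypothesis bounds \<open>v n\<close> below by about \<open>n powr (\<alpha> - 1) / K\<close>, so that its generating function at \<open>exp (-l)\<close>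
  is at least about \<open>Gamma \<alpha> / (K * l powr \<alpha>)\<close>, and the second hypothesis bounds \<open>l\<close> so that the sum is at
  least \<open>1 - c / sqrt n\<close> for some \<open>c < 1\<close>.

  Letting the right end of \<open>[0, N]\<close> tend to infinity, one finds that the invariant Gibbs states are
  stationary laws of one chain with infinite memory, whose transition probabilities for two pasts
  with \<open>n\<close> common symbols have ratios at least \<open>(1 - c / sqrt n)\<^sup>2\<close>. The resulting Hellinger estimate
  shows that two trajectories with \<open>n\<close> common symbols can be coupled to agree up to time \<open>b * n\<close> with
  probability at least \<open>q\<close>, where \<open>q * b \<ge> 1\<close> because \<open>c < 1\<close>. Hence the oscillation in the past of
  long time averages contracts, and there is at most one stationary law. Existence is compactness.
\<close>

section \<open>Renewal sequences\<close>

text \<open>The transition ratios differ from 1 by order \<open>1 / sqrt n\<close>, which is not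
  summable, so adding up total variation distances step by step gives nothing. Squared Hellinger
  distances are of order \<open>c\<^sup>2 / n\<close>. Each common symbol lengthens the agreement by
  one, so they add up to a logarithm: for c^2 < c' < 1, two trajectories stay together from
  agreement n to agreement b * n with probability at least a constant times b powr (- c'). A success
  multiplies the length of agreement by b, and b * b powr (- c') can be made large because c' < 1;
  this is where c < 1 is needed. The constant c comes from the strict inequality in the second
  hypothesis. If l powr \<alpha> = c1 / sqrt n and v is eventually at least \<open>\<theta>\<close>
  times the coefficients of (1 - s) powr (- \<alpha>), the generating function at exp (- l) is about
  (\<open>\<theta>\<close> / c1) * sqrt n or more, and any \<open>\<theta>\<close> < Gamma \<alpha>
  / K is admissible; c is any number between c1 / \<open>\<theta>\<close> and 1. A finite volume
  also has a right boundary. Changing it costs further factors, whose product v k / v (k - t) tends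
  to 1 for fixed t.\<close>

fun renewal_prob :: "(nat \<Rightarrow> real) \<Rightarrow> nat \<Rightarrow> real" where
  "renewal_prob v n = v n - (\<Sum>t\<in>{1..<n}. renewal_prob v t * v (n - t))"

declare renewal_prob.simps [simp del]

text \<open>The recursion for \<open>renewal_prob\<close> is this equation solved for its last term
  t = n, where v 0 = 1. The value at 0 has no meaning; all sums start at t = 1.\<close>

lemma renewal_equation:
  assumes "v 0 = 1" "1 \<le> n"
  shows "v n = (\<Sum>t=1..n. renewal_prob v t * v (n - t))"
proof -
  have "{1..n} = insert n {1..<n}" using assms by auto
  then show ?thesis using assms renewal_prob.simps[of v n] by simp
qed

text \<open>Kaluza: a log-convex sequence is a renewal sequence.\<close>

lemma renewal_prob_nonneg:
  assumes "v 0 = 1" and pos: "\<And>n. 0 < v n"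
    and ratio: "\<And>m n. m \<le> n \<Longrightarrow> v (Suc m) / v m \<le> v (Suc n) / v n"
    and "1 \<le> n"
  shows "0 \<le> renewal_prob v n"
  using \<open>1 \<le> n\<close>
proof (induction n rule: less_induct)
  case (less n)
  show ?case
  proof (cases "n = 1")
    case True
    then show ?thesis using pos[of 1] renewal_prob.simps[of v 1] by simp
  next
    case False
    then obtain m where m: "n = Suc m" "1 \<le> m" using less.prems by (cases n) auto
    have "(\<Sum>t\<in>{1..<n}. renewal_prob v t * v (n - t))
        = (\<Sum>t=1..m. renewal_prob v t * v (Suc m - t))"
      using m by (simp add: atLeastLessThanSuc_atLeastAtMost)
    \<comment> \<open>Log-convexity bounds v (Suc m - t) by v (Suc m) / v m * v (m - t), and then
      the renewal equation at m evaluates the sum.\<close>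
    also have "\<dots> \<le> (\<Sum>t=1..m. v (Suc m) / v m * (renewal_prob v t * v (m - t)))"
    proof (rule sum_mono)
      fix t assume t: "t \<in> {1..m}"
      have "v (Suc m - t) / v (m - t) \<le> v (Suc m) / v m"
        using ratio[of "m - t" m] t by (simp add: Suc_diff_le)
      then have "v (Suc m - t) \<le> v (Suc m) / v m * v (m - t)"
        using pos[of "m - t"] by (simp add: pos_divide_le_eq)
      moreover have "0 \<le> renewal_prob v t" using less.IH[of t] t m by simp
      ultimately have "renewal_prob v t * v (Suc m - t)
          \<le> renewal_prob v t * (v (Suc m) / v m * v (m - t))"
        by (rule mult_left_mono)
      then show "renewal_prob v t * v (Suc m - t)
          \<le> v (Suc m) / v m * (renewal_prob v t * v (m - t))"
        by (simp add: mult_ac)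
    qed
    also have "\<dots> = v (Suc m) / v m * v m"
      using renewal_equation[of v m] assms(1) m by (simp add: sum_distrib_left)
    also have "\<dots> = v n" using pos[of m] m by simp
    finally show ?thesis using renewal_prob.simps[of v n] by simp
  qed
qed

section \<open>Convolution with the renewal probabilities\<close>

lemma triangle_sum_reindex:
  fixes a :: "nat \<Rightarrow> nat \<Rightarrow> real"
  shows "(\<Sum>m\<le>D. \<Sum>t=1..D-m. a m t) = (\<Sum>n=1..D. \<Sum>t=1..n. a (n - t) t)"
  unfolding sum.Sigma[OF finite_atMost ballI[OF finite_atLeastAtMost]]
    sum.Sigma[OF finite_atLeastAtMost ballI[OF finite_atLeastAtMost]]
  by (rule sum.reindex_bij_witness[of _ "\<lambda>(n, t). (n - t, t)" "\<lambda>(m, t). (m + t, t)"]) auto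

text \<open>\<open>v\<close> is the potential kernel of the renewal process: regrouped by n = m + t,
  the coefficient of h n is v n minus its convolution with the renewal probabilities, which vanishes
  for n \<ge> 1. Cutting the inner sums at D treats h as 0 beyond D.\<close>

lemma renewal_inversion:
  fixes h :: "nat \<Rightarrow> real"
  assumes "v 0 = 1"
  shows "(\<Sum>m\<le>D. v m * (h m - (\<Sum>t=1..D-m. renewal_prob v t * h (m + t)))) = h 0"
proof -
  have "(\<Sum>m\<le>D. v m * (\<Sum>t=1..D-m. renewal_prob v t * h (m + t)))
      = (\<Sum>n=1..D. \<Sum>t=1..n. v (n - t) * (renewal_prob v t * h (n - t + t)))"
    by (simp only: sum_distrib_left triangle_sum_reindex)
  also have "\<dots> = (\<Sum>n=1..D. h n * v n)"
  proof (rule sum.cong[OF refl])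
    fix n assume n: "n \<in> {1..D}"
    have "(\<Sum>t=1..n. v (n - t) * (renewal_prob v t * h (n - t + t)))
        = h n * (\<Sum>t=1..n. renewal_prob v t * v (n - t))"
      unfolding sum_distrib_left by (rule sum.cong) auto
    then show "(\<Sum>t=1..n. v (n - t) * (renewal_prob v t * h (n - t + t))) = h n * v n"
      using renewal_equation[of v n] assms n by simp
  qed
  finally have "(\<Sum>m\<le>D. v m * (h m - (\<Sum>t=1..D-m. renewal_prob v t * h (m + t))))
      = (\<Sum>m\<le>D. v m * h m) - (\<Sum>n=1..D. h n * v n)"
    by (simp add: right_diff_distrib sum_subtractf)
  also have "(\<Sum>m\<le>D. v m * h m) = v 0 * h 0 + (\<Sum>m=1..D. v m * h m)"
    by (simp add: sum.atMost_shift sum.atLeast1_atMost_eq)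
  finally show ?thesis using assms by (simp add: mult.commute)
qed

text \<open>The full generating functions satisfy V = 1 + V * Q. Truncated at T, the convolution
  contains only the pairs with m + t \<le> T; adding the missing nonnegative pairs gives V \<le> 1 +
  V * Q.\<close>

lemma renewal_prob_partial_gf:
  assumes "v 0 = 1" and pos: "\<And>n. 0 < v n"
    and nonneg: "\<And>t. 1 \<le> t \<Longrightarrow> 0 \<le> renewal_prob v t" and "0 \<le> s"
  shows "1 - 1 / (\<Sum>n\<le>T. v n * s ^ n) \<le> (\<Sum>t=1..T. renewal_prob v t * s ^ t)"
proof -
  define V where "V = (\<Sum>n\<le>T. v n * s ^ n)"
  define Q where "Q = (\<Sum>t=1..T. renewal_prob v t * s ^ t)"
  have V_eq: "V = 1 + (\<Sum>n=1..T. v n * s ^ n)"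
    using assms(1) by (simp add: V_def sum.atMost_shift sum.atLeast1_atMost_eq)
  have "0 \<le> (\<Sum>n=1..T. v n * s ^ n)"
    using pos \<open>0 \<le> s\<close> by (intro sum_nonneg) (simp add: less_imp_le)
  then have V1: "1 \<le> V" using V_eq by simp
  have "(\<Sum>n=1..T. v n * s ^ n)
      = (\<Sum>n=1..T. \<Sum>t=1..n. v (n - t) * s ^ (n - t) * (renewal_prob v t * s ^ t))"
  proof (rule sum.cong[OF refl])
    fix n assume n: "n \<in> {1..T}"
    have "v n * s ^ n = (\<Sum>t=1..n. renewal_prob v t * v (n - t) * s ^ n)"
      using renewal_equation[of v n] assms(1) n by (simp add: sum_distrib_right)
    also have "\<dots> = (\<Sum>t=1..n. v (n - t) * s ^ (n - t) * (renewal_prob v t * s ^ t))"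
    proof (rule sum.cong[OF refl])
      fix t assume "t \<in> {1..n}"
      then have "s ^ n = s ^ (n - t) * s ^ t" by (simp flip: power_add)
      then show "renewal_prob v t * v (n - t) * s ^ n
        = v (n - t) * s ^ (n - t) * (renewal_prob v t * s ^ t)" by simp
    qed
    finally show "v n * s ^ n
      = (\<Sum>t=1..n. v (n - t) * s ^ (n - t) * (renewal_prob v t * s ^ t))" .
  qed
  also have "\<dots> = (\<Sum>m\<le>T. \<Sum>t=1..T-m. v m * s ^ m * (renewal_prob v t * s ^ t))"
    by (simp only: triangle_sum_reindex)
  also have "\<dots> = (\<Sum>m\<le>T. v m * s ^ m * (\<Sum>t=1..T-m. renewal_prob v t * s ^ t))"
    by (simp add: sum_distrib_left)
  also have "\<dots> \<le> (\<Sum>m\<le>T. v m * s ^ m * Q)"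
    unfolding Q_def using pos nonneg \<open>0 \<le> s\<close>
    by (intro sum_mono mult_left_mono sum_mono2) (auto simp: less_imp_le)
  also have "\<dots> = V * Q" by (simp add: V_def sum_distrib_right)
  finally have "V - 1 \<le> V * Q" using V_eq by simp
  then have "1 - 1 / V \<le> Q" using V1 by (simp add: field_simps)
  then show ?thesis by (simp add: V_def Q_def)
qed

section \<open>Partition functions with two boundary conditions\<close>

text \<open>A recursion from left to right, rather than a sum over a cylinder, lets the inductions
  below fix one site at a time; \<open>sum_cyl_eq_site_sum\<close> relates the two.\<close>

primrec site_sum :: "nat \<Rightarrow> nat \<Rightarrow> ((int \<Rightarrow> 's::finite) \<Rightarrow> real) \<Rightarrow> (int \<Rightarrow> 's) \<Rightarrow> real" where
  "site_sum 0 q F s = F s"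
| "site_sum (Suc m) q F s = (\<Sum>a\<in>UNIV. site_sum m (Suc q) F (s(int q := a)))"

lemma site_sum_mono: "(\<And>u. F u \<le> G u) \<Longrightarrow> site_sum m q F s \<le> site_sum m q G s"
  by (induction m arbitrary: q s) (auto intro!: sum_mono)

lemma site_sum_pos: "(\<And>u. 0 < F u) \<Longrightarrow> 0 < site_sum m q F s"
  by (induction m arbitrary: q s) (auto intro!: sum_pos)

lemma site_sum_add: "site_sum m q (\<lambda>u. F u + G u) s = site_sum m q F s + site_sum m q G s"
  by (induction m arbitrary: q s) (auto simp: sum.distrib)

lemma site_sum_mult_left:
  assumes "\<And>u j a. q \<le> j \<Longrightarrow> c (u(int j := a)) = c u"
  shows "site_sum m q (\<lambda>u. c u * F u) s = c s * site_sum m q F s"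
  using assms by (induction m arbitrary: q s) (auto simp: sum_distrib_left)

lemma site_sum_cmult: "site_sum m q (\<lambda>u. c * F u) s = c * site_sum m q F s"
  by (rule site_sum_mult_left) simp

lemma site_sum_cong_outside:
  assumes "\<And>u j a. j < p \<Longrightarrow> F (u(int j := a)) = F u" "p \<le> q" "j < p"
  shows "site_sum m q F (s(int j := a)) = site_sum m q F s"
  using assms(2,3)
proof (induction m arbitrary: q s)
  case 0
  then show ?case using assms(1)[OF \<open>j < p\<close>] by (simp only: site_sum.simps)
next
  case (Suc m)
  have "(s(int j := a))(int q := b) = (s(int q := b))(int j := a)" for b
    using Suc.prems by (simp add: fun_upd_twist)
  moreover have "site_sum m (Suc q) F ((s(int q := b))(int j := a))
      = site_sum m (Suc q) F (s(int q := b))" for b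
    using Suc.prems by (intro Suc.IH) auto
  ultimately show ?case by (simp only: site_sum.simps)
qed

text \<open>For nonnegative F this is the largest minorant of F that depends only on the sites up to
  r.\<close>

definition inf_beyond :: "int \<Rightarrow> ((int \<Rightarrow> 's) \<Rightarrow> real) \<Rightarrow> (int \<Rightarrow> 's) \<Rightarrow> real" where
  "inf_beyond r F u = Inf (F ` {u'. \<forall>i\<le>r. u' i = u i})"

lemma inf_beyond_le: "(\<And>u. 0 \<le> F u) \<Longrightarrow> inf_beyond r F u \<le> F u"
  unfolding inf_beyond_def by (rule cInf_lower) (auto intro!: bdd_belowI[of _ 0])

lemma inf_beyond_ge: "(\<And>u'. \<forall>i\<le>r. u' i = u i \<Longrightarrow> c \<le> F u') \<Longrightarrow> c \<le> inf_beyond r F u"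
  unfolding inf_beyond_def by (rule cInf_greatest) auto

lemma inf_beyond_mono: "(\<And>u. 0 \<le> F u) \<Longrightarrow> r \<le> r' \<Longrightarrow> inf_beyond r F u \<le> inf_beyond r' F u"
  unfolding inf_beyond_def
  by (rule cInf_superset_mono) (auto intro!: bdd_belowI[of _ 0])

lemma inf_beyond_cong: "(\<And>i. i \<le> r \<Longrightarrow> u i = u' i) \<Longrightarrow> inf_beyond r F u = inf_beyond r F u'"
  unfolding inf_beyond_def by (rule arg_cong[where f=Inf]) auto

text \<open>The factors \<open>F j\<close> and \<open>F' j\<close>, \<open>j < k\<close>, belong to the same inner configuration with two
  different boundary conditions; \<open>R i\<close> bounds the dependence of the \<open>j\<close>-th factor beyond
  \<open>j + i\<close>, and \<open>lam j\<close> the dependence on the boundary condition.\<close>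

locale two_boundaries =
  fixes k :: nat and F F' :: "nat \<Rightarrow> (int \<Rightarrow> 's::finite) \<Rightarrow> real" and R lam :: "nat \<Rightarrow> real"
    and x :: "int \<Rightarrow> 's" and v p :: "nat \<Rightarrow> real"
  assumes F_pos: "\<And>j u. 0 < F j u" and F'_pos: "\<And>j u. 0 < F' j u"
    and F_local: "\<And>j u i a. i < j \<Longrightarrow> F j (u(int i := a)) = F j u"
    and F'_local: "\<And>j u i a. i < j \<Longrightarrow> F' j (u(int i := a)) = F' j u"
    and F_osc: "\<And>j i u u'. (\<forall>l\<le>int (j + i). u' l = u l) \<Longrightarrow> F j u \<le> R i * F j u'"
    and F'_osc: "\<And>j i u u'. (\<forall>l\<le>int (j + i). u' l = u l) \<Longrightarrow> F' j u \<le> R i * F' j u'"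
    and R_ge: "\<And>i. 1 \<le> R i"
    and lam_pos: "\<And>j. 0 < lam j"
    and F'_ge: "\<And>j u. j < k \<Longrightarrow> lam j * F j u \<le> F' j u"
    and F_ge: "\<And>j u. j < k \<Longrightarrow> lam j * F' j u \<le> F j u"
    and v_def: "v = (\<lambda>n. \<Prod>i<n. 1 / R i)"
    and p_def: "p = renewal_prob v"
    and p_nonneg: "\<And>t. 1 \<le> t \<Longrightarrow> 0 \<le> p t"
begin

lemma swap: "two_boundaries k F' F R lam v p"
  by (unfold_locales; (rule F_pos F'_pos F_local F'_local F_osc F'_osc R_ge lam_pos F'_ge F_ge
      v_def p_def p_nonneg; assumption))

definition tail_prod :: "nat \<Rightarrow> (int \<Rightarrow> 's) \<Rightarrow> real" where
  "tail_prod q u = (\<Prod>j\<in>{q..<k}. F j u)"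
definition tail_prod' :: "nat \<Rightarrow> (int \<Rightarrow> 's) \<Rightarrow> real" where
  "tail_prod' q u = (\<Prod>j\<in>{q..<k}. F' j u)"
definition Z :: "nat \<Rightarrow> real" where "Z q = site_sum (k - q) q (tail_prod q) x"
definition Z' :: "nat \<Rightarrow> real" where "Z' q = site_sum (k - q) q (tail_prod' q) x"
definition Lam :: "nat \<Rightarrow> real" where "Lam q = (\<Prod>j<q. lam j)"
text \<open>The factor \<open>Lam q\<close>, the price of changing the boundary condition in the
  first q factors, is what makes this ratio superharmonic for the renewal probabilities.\<close>

definition N :: "nat \<Rightarrow> real" where "N q = Lam q * (Z' q / Z q)"

text \<open>The defect of superharmonicity of \<open>N\<close> for the renewal probabilities.\<close>
definition g :: "nat \<Rightarrow> real" where
  "g r = N r - (\<Sum>t=1..k-r. p t * N (r + t))"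

lemma v_Suc: "v (Suc n) = v n / R n"
  by (simp add: v_def)

lemma v_0: "v 0 = 1"
  by (simp add: v_def)

lemma v_pos: "0 < v n"
  unfolding v_def by (intro prod_pos ballI divide_pos_pos less_le_trans[OF zero_less_one R_ge]) simp

lemma N_eq: "q \<le> k \<Longrightarrow> N q = (\<Sum>m\<le>k-q. v m * g (q + m))"
proof -
  assume q: "q \<le> k"
  have "g (q + m) = N (q + m) - (\<Sum>t=1..k-q-m. p t * N (q + (m + t)))" for m
    by (simp add: g_def add.assoc diff_diff_left)
  then show ?thesis
    using renewal_inversion[where v=v and D="k - q" and h="\<lambda>m. N (q + m)"] v_0 by (simp add: p_def)
qed

lemma tail_prod_pos: "0 < tail_prod q u" and tail_prod'_pos: "0 < tail_prod' q u"
  using F_pos F'_pos by (auto simp: tail_prod_def tail_prod'_def intro!: prod_pos)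

lemma tail_prod_Suc: "q < k \<Longrightarrow> tail_prod q u = F q u * tail_prod (Suc q) u"
  and tail_prod'_Suc: "q < k \<Longrightarrow> tail_prod' q u = F' q u * tail_prod' (Suc q) u"
  by (auto simp: tail_prod_def tail_prod'_def prod.atLeast_Suc_lessThan)

lemma tail_prod_local: "i < q \<Longrightarrow> tail_prod q (u(int i := a)) = tail_prod q u"
  and tail_prod'_local: "i < q \<Longrightarrow> tail_prod' q (u(int i := a)) = tail_prod' q u"
  using F_local F'_local by (auto simp: tail_prod_def tail_prod'_def intro!: prod.cong)

lemma Z_pos: "0 < Z q" and Z'_pos: "0 < Z' q"
  by (auto simp: Z_def Z'_def intro!: site_sum_pos tail_prod_pos tail_prod'_pos)

lemma Lam_pos: "0 < Lam q"
  using lam_pos by (auto simp: Lam_def intro!: prod_pos)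

lemma Lam_Suc: "Lam (Suc q) = Lam q * lam q"
  by (simp add: Lam_def)

definition adm :: "nat \<Rightarrow> (int \<Rightarrow> 's) \<Rightarrow> bool" where
  "adm q s \<longleftrightarrow> (\<forall>i. (i < 0 \<or> int q \<le> i) \<longrightarrow> s i = x i)"

lemma adm_x: "adm q x" by (simp add: adm_def)

lemma adm_upd: "adm q s \<Longrightarrow> adm (Suc q) (s(int q := a))"
  by (auto simp: adm_def)

lemma site_sum_adm:
  assumes local: "\<And>i u a. i < q \<Longrightarrow> G (u(int i := a)) = G u" and "adm q s"
  shows "site_sum m q G s = site_sum m q G x"
proof -
  have "\<forall>s. adm r s \<longrightarrow> site_sum m q G s = site_sum m q G x" if "r \<le> q" for r
    using that
  proof (induction r)
    case 0
    have "s = x" if "adm 0 s" for s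
    proof
      show "s i = x i" for i using that by (cases "i < 0") (auto simp: adm_def)
    qed
    then show ?case by auto
  next
    case (Suc r)
    show ?case
    proof (intro allI impI)
      fix s assume s: "adm (Suc r) s"
      have "adm r (s(int r := x (int r)))" using s by (auto simp: adm_def)
      then have "site_sum m q G (s(int r := x (int r))) = site_sum m q G x" using Suc by simp
      then show "site_sum m q G s = site_sum m q G x"
        using site_sum_cong_outside[of q G q r m s "x (int r)"] local Suc.prems by simp
    qed
  qed
  then show ?thesis using assms(2) by blast
qed

text \<open>The factors from q on do not look at the sites 0, ..., q - 1, so filling these sites
  does not change the remaining partition functions; \<open>Z q\<close> and \<open>Z' q\<close> are
  therefore numbers.\<close>

lemma Z_adm: "adm q s \<Longrightarrow> site_sum (k - q) q (tail_prod q) s = Z q"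
  and Z'_adm: "adm q s \<Longrightarrow> site_sum (k - q) q (tail_prod' q) s = Z' q"
  unfolding Z_def Z'_def by (rule site_sum_adm; simp add: tail_prod_local tail_prod'_local)+

section \<open>Downward induction along the sites\<close>

definition minorants :: "nat \<Rightarrow> (nat \<Rightarrow> (int \<Rightarrow> 's) \<Rightarrow> real) \<Rightarrow> ((int \<Rightarrow> 's) \<Rightarrow> real) \<Rightarrow> bool" where
  "minorants q M \<Psi> \<longleftrightarrow> (\<forall>m u. 0 \<le> M m u \<and> M m u \<le> M (Suc m) u \<and> M m u \<le> \<Psi> u) \<and>
     (\<forall>m u u'. (\<forall>i<int (q + m). u i = u' i) \<longrightarrow> M m u = M m u')"

text \<open>Each \<open>M m\<close> is a minorant of \<open>\<Psi>\<close> that does not look at the sites from \<open>q + m\<close> on; for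
  \<open>M m = \<Psi> = 1\<close> the bound is the identity \<open>N q = (\<Sum>m\<le>k-q. v m * g (q + m))\<close>, multiplied by \<open>Z q\<close>.\<close>

definition cut_bound :: "nat \<Rightarrow> bool" where
  "cut_bound q \<longleftrightarrow> (\<forall>\<Psi> M s. adm q s \<longrightarrow> minorants q M \<Psi> \<longrightarrow>
     (\<Sum>m\<le>k-q. v m * g (q + m) * site_sum (k - q) q (\<lambda>u. M m u * tail_prod q u) s)
     \<le> Lam q * site_sum (k - q) q (\<lambda>u. \<Psi> u * tail_prod' q u) s)"

lemma inf_beyond_F_ge: "F j u / R m \<le> inf_beyond (int (j + m)) (F j) u"
proof (rule inf_beyond_ge)
  fix u' assume "\<forall>i\<le>int (j + m). u' i = u i"
  then have "F j u \<le> R m * F j u'" by (rule F_osc)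
  then show "F j u / R m \<le> F j u'"
    using R_ge[of m] by (simp add: divide_le_eq mult.commute)
qed

text \<open>The weights \<open>v\<close> are made for this: cutting the factor j off at j + m costs
  R m, which is the passage from v m to v (Suc m).\<close>

lemma v_mult_inf_beyond_F: "v (Suc m) * F j u \<le> v m * inf_beyond (int (j + m)) (F j) u"
  using mult_left_mono[OF inf_beyond_F_ge[of j u m] less_imp_le[OF v_pos[of m]]]
  by (simp add: v_Suc)

lemma minorants_mono:
  assumes "minorants q M \<Psi>" "m \<le> m'" shows "M m u \<le> M m' u"
  using assms(2,1) by (induction rule: dec_induct) (auto simp: minorants_def intro: order_trans)

lemma cut_bound_k: "cut_bound k"
proof -
  have "g k = Lam k"
    by (simp add: g_def N_def Z_def Z'_def tail_prod_def tail_prod'_def)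
  then show ?thesis
    using Lam_pos[of k] by (auto simp: cut_bound_def tail_prod_def tail_prod'_def v_0 minorants_def)
qed

text \<open>Site q is already filled in \<open>t\<close>. The factor F q is moved into the
  minorants, cut off at q + m so that they still ignore the sites from Suc q + m on. The cut is paid
  for by \<open>v\<close>, and the exchange of F q for F' q by \<open>lam q\<close>.\<close>

lemma cut_bound_next:
  assumes q: "q < k" and IH: "cut_bound (Suc q)" and g_nonneg: "\<And>r. q < r \<Longrightarrow> r \<le> k \<Longrightarrow> 0 \<le> g r"
    and mino: "minorants (Suc q) M \<Psi>" and t: "adm (Suc q) t"
  shows "(\<Sum>m\<le>k - Suc q. v (Suc m) * g (q + Suc m) *
        site_sum (k - Suc q) (Suc q) (\<lambda>u. M m u * tail_prod q u) t)
      \<le> Lam q * site_sum (k - Suc q) (Suc q) (\<lambda>u. \<Psi> u * tail_prod' q u) t"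
proof -
  define M2 where "M2 m u = M m u * inf_beyond (int (q + m)) (F q) u" for m u
  have M: "0 \<le> M m u" "M m u \<le> M (Suc m) u" "M m u \<le> \<Psi> u" for m u
    using mino by (auto simp: minorants_def)
  have \<Psi>_nonneg: "0 \<le> \<Psi> u" for u
    using M(1,3) order_trans by blast
  have inf_nonneg: "0 \<le> inf_beyond r (F q) u" for r u
    by (rule inf_beyond_ge) (simp add: F_pos less_imp_le)
  have mino2: "minorants (Suc q) M2 (\<lambda>u. \<Psi> u * F q u)"
    unfolding minorants_def
  proof (intro conjI allI impI)
    fix m u
    show "0 \<le> M2 m u" using M(1) inf_nonneg by (simp add: M2_def)
    show "M2 m u \<le> M2 (Suc m) u" unfolding M2_def
      using M inf_nonneg by (intro mult_mono inf_beyond_mono) (auto simp: F_pos less_imp_le)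
    show "M2 m u \<le> \<Psi> u * F q u" unfolding M2_def
      using M \<Psi>_nonneg inf_nonneg by (intro mult_mono inf_beyond_le) (auto simp: F_pos less_imp_le)
  next
    fix m and u u' :: "int \<Rightarrow> 's" assume eq: "\<forall>i<int (Suc q + m). u i = u' i"
    have "M m u = M m u'"
      using mino eq unfolding minorants_def by blast
    moreover have "inf_beyond (int (q + m)) (F q) u = inf_beyond (int (q + m)) (F q) u'"
      using eq by (intro inf_beyond_cong) auto
    ultimately show "M2 m u = M2 m u'" by (simp add: M2_def)
  qed
  let ?S = "\<lambda>G. site_sum (k - Suc q) (Suc q) G t"
  have "(\<Sum>m\<le>k - Suc q. g (Suc q + m) * (v (Suc m) * ?S (\<lambda>u. M m u * tail_prod q u)))
    \<le> (\<Sum>m\<le>k - Suc q. g (Suc q + m) * (v m * ?S (\<lambda>u. M2 m u * tail_prod (Suc q) u)))"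
  proof (intro sum_mono mult_left_mono g_nonneg)
    fix m
    have "v (Suc m) * (M m u * (F q u * tail_prod (Suc q) u))
      \<le> v m * (M2 m u * tail_prod (Suc q) u)" for u
      using mult_right_mono[OF v_mult_inf_beyond_F[of m q u]
          mult_nonneg_nonneg[OF M(1)[of m u] less_imp_le[OF tail_prod_pos[of "Suc q" u]]]]
      by (simp add: M2_def mult_ac)
    then show "v (Suc m) * ?S (\<lambda>u. M m u * tail_prod q u)
      \<le> v m * ?S (\<lambda>u. M2 m u * tail_prod (Suc q) u)"
      unfolding site_sum_cmult[symmetric] using q
      by (intro site_sum_mono) (simp add: tail_prod_Suc)
  qed (use q in auto)
  also have "\<dots> \<le> Lam (Suc q) * ?S (\<lambda>u. \<Psi> u * F q u * tail_prod' (Suc q) u)"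
    using IH[unfolded cut_bound_def, rule_format, OF t mino2] by (simp add: mult_ac)
  also have "\<dots> = Lam q * ?S (\<lambda>u. lam q * (\<Psi> u * F q u * tail_prod' (Suc q) u))"
    by (simp add: Lam_Suc mult.assoc site_sum_cmult)
  also have "\<dots> \<le> Lam q * ?S (\<lambda>u. \<Psi> u * tail_prod' q u)"
  proof (intro mult_left_mono site_sum_mono)
    fix u
    have "\<Psi> u * tail_prod' (Suc q) u * (lam q * F q u) \<le> \<Psi> u * tail_prod' (Suc q) u * F' q u"
      using F'_ge[OF q] \<Psi>_nonneg[of u] tail_prod'_pos[of "Suc q" u] by (intro mult_left_mono) auto
    then show "lam q * (\<Psi> u * F q u * tail_prod' (Suc q) u) \<le> \<Psi> u * tail_prod' q u"
      using q by (simp add: tail_prod'_Suc mult_ac)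
  qed (use Lam_pos[of q] in simp)
  finally show ?thesis by (simp add: mult_ac)
qed

lemma minorants_1: "minorants q (\<lambda>m u. 1) (\<lambda>u. 1)"
  by (simp add: minorants_def)

lemma N_eq_Suc: "q < k \<Longrightarrow> N q = g q + (\<Sum>m\<le>k - Suc q. v (Suc m) * g (q + Suc m))"
  using N_eq[of q] v_0
  by (simp add: sum.atMost_Suc_shift Suc_diff_Suc[symmetric] del: sum.atMost_Suc)

text \<open>With constant minorants 1, summing \<open>cut_bound_next\<close> over the symbol at q
  bounds the renewal sum N q - g q by N q.\<close>

lemma cut_bound_step_nonneg:
  assumes q: "q < k" and IH: "cut_bound (Suc q)" and g_nonneg: "\<And>r. q < r \<Longrightarrow> r \<le> k \<Longrightarrow> 0 \<le> g r"
  shows "0 \<le> g q"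
proof -
  have kq: "k - q = Suc (k - Suc q)" using q by simp
  let ?w = "\<Sum>m\<le>k - Suc q. v (Suc m) * g (q + Suc m)"
  have "?w * Z q = (\<Sum>a\<in>UNIV. ?w * site_sum (k - Suc q) (Suc q) (tail_prod q) (x(int q := a)))"
    unfolding Z_def kq by (simp add: sum_distrib_left)
  also have "\<dots> \<le> (\<Sum>a\<in>UNIV. Lam q * site_sum (k - Suc q) (Suc q) (tail_prod' q) (x(int q := a)))"
    using cut_bound_next[OF q IH g_nonneg minorants_1 adm_upd[OF adm_x]]
    by (intro sum_mono) (simp add: sum_distrib_right)
  also have "\<dots> = N q * Z q"
    unfolding N_def Z'_def kq using Z_pos[of q] by (simp add: sum_distrib_left)
  finally have "?w \<le> N q"
    using Z_pos[of q] by (simp add: mult_le_cancel_right)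
  then show ?thesis using N_eq_Suc[OF q] by simp
qed

text \<open>Split M m into M 0 and M m - M 0. The function M 0 does not see the sites summed over,
  so its share reduces to the identity for constant minorants; the increments are minorants of
  \<open>\<Psi>\<close> - M 0 for the next site.\<close>

lemma cut_bound_step:
  assumes q: "q < k" and IH: "cut_bound (Suc q)" and g_nonneg: "\<And>r. q < r \<Longrightarrow> r \<le> k \<Longrightarrow> 0 \<le> g r"
  shows "cut_bound q"
  unfolding cut_bound_def
proof (intro allI impI)
  fix \<Psi> M s assume adm: "adm q s" and mino: "minorants q M \<Psi>"
  define d where "d = k - Suc q"
  have kq: "k - q = Suc d" using q by (simp add: d_def)
  define \<Psi>1 where "\<Psi>1 u = \<Psi> u - M 0 u" for u
  \<comment> \<open>The index shift matches the sites: M (Suc m) ignores those from q + Suc m = Suc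
    q + m on.\<close>
  define M1 where "M1 m u = M (Suc m) u - M 0 u" for m u
  have mino1: "minorants (Suc q) M1 \<Psi>1"
    unfolding minorants_def
  proof (intro conjI allI impI)
    fix m u
    show "0 \<le> M1 m u"
      using minorants_mono[OF mino, of 0 "Suc m" u] by (simp add: M1_def)
    show "M1 m u \<le> M1 (Suc m) u" "M1 m u \<le> \<Psi>1 u"
      using mino by (auto simp: minorants_def M1_def \<Psi>1_def)
  next
    fix m and u u' :: "int \<Rightarrow> 's" assume "\<forall>i<int (Suc q + m). u i = u' i"
    then have "M (Suc m) u = M (Suc m) u'" "M 0 u = M 0 u'"
      using mino unfolding minorants_def by auto
    then show "M1 m u = M1 m u'" by (simp add: M1_def)
  qed
  have M0_local: "M 0 (u(int j := a)) = M 0 u" if "q \<le> j" for u j a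
    using mino that unfolding minorants_def by auto
  define S where "S G = (\<Sum>a\<in>UNIV. site_sum d (Suc q) G (s(int q := a)))" for G
  have S_eq: "site_sum (k - q) q G s = S G" for G unfolding kq by (simp add: S_def)
  have S_M0: "S (\<lambda>u. M 0 u * G u) = M 0 s * S G" for G
    unfolding S_eq[symmetric] by (rule site_sum_mult_left) (rule M0_local)
  have M1_part: "(\<Sum>m\<le>d. v (Suc m) * g (q + Suc m) * S (\<lambda>u. M1 m u * tail_prod q u))
      \<le> Lam q * S (\<lambda>u. \<Psi>1 u * tail_prod' q u)"
    unfolding S_def sum_distrib_left sum.swap[of _ UNIV] d_def
    by (intro sum_mono cut_bound_next[OF q IH g_nonneg mino1 adm_upd[OF adm], unfolded sum_distrib_left])
  have Zs: "S (tail_prod q) = Z q" "S (tail_prod' q) = Z' q"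
    unfolding S_eq[symmetric] using Z_adm Z'_adm adm by auto
  have gq: "N q = g q + (\<Sum>m\<le>d. v (Suc m) * g (q + Suc m))"
    unfolding d_def by (rule N_eq_Suc[OF q])
  have "(\<Sum>m\<le>Suc d. v m * g (q + m) * S (\<lambda>u. M m u * tail_prod q u))
      = g q * (M 0 s * Z q) + (\<Sum>m\<le>d. v (Suc m) * g (q + Suc m) * S (\<lambda>u. M (Suc m) u * tail_prod q u))"
    by (simp add: sum.atMost_Suc_shift v_0 S_M0 Zs del: sum.atMost_Suc)
  also have "(\<Sum>m\<le>d. v (Suc m) * g (q + Suc m) * S (\<lambda>u. M (Suc m) u * tail_prod q u))
     = (\<Sum>m\<le>d. v (Suc m) * g (q + Suc m) * (M 0 s * Z q + S (\<lambda>u. M1 m u * tail_prod q u)))"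
  proof (rule sum.cong[OF refl])
    fix m
    have "S (\<lambda>u. M (Suc m) u * tail_prod q u)
        = S (\<lambda>u. M 0 u * tail_prod q u + M1 m u * tail_prod q u)"
      by (simp add: M1_def algebra_simps)
    also have "\<dots> = S (\<lambda>u. M 0 u * tail_prod q u) + S (\<lambda>u. M1 m u * tail_prod q u)"
      unfolding S_def by (simp add: site_sum_add sum.distrib)
    finally show "v (Suc m) * g (q + Suc m) * S (\<lambda>u. M (Suc m) u * tail_prod q u)
       = v (Suc m) * g (q + Suc m) * (M 0 s * Z q + S (\<lambda>u. M1 m u * tail_prod q u))"
      by (simp add: S_M0 Zs)
  qed
  also have "g q * (M 0 s * Z q) + \<dots>
     = (g q + (\<Sum>m\<le>d. v (Suc m) * g (q + Suc m))) * (M 0 s * Z q)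
       + (\<Sum>m\<le>d. v (Suc m) * g (q + Suc m) * S (\<lambda>u. M1 m u * tail_prod q u))"
    by (simp add: distrib_left distrib_right sum.distrib sum_distrib_right)
  also have "\<dots> \<le> N q * (M 0 s * Z q) + Lam q * S (\<lambda>u. \<Psi>1 u * tail_prod' q u)"
    using M1_part by (simp add: gq)
  also have "N q * (M 0 s * Z q) = Lam q * S (\<lambda>u. M 0 u * tail_prod' q u)"
    using Z_pos[of q] by (simp add: N_def S_M0 Zs)
  also have "\<dots> + Lam q * S (\<lambda>u. \<Psi>1 u * tail_prod' q u)
      = Lam q * (S (\<lambda>u. M 0 u * tail_prod' q u) + S (\<lambda>u. \<Psi>1 u * tail_prod' q u))"
    by (simp add: distrib_left)
  also have "S (\<lambda>u. M 0 u * tail_prod' q u) + S (\<lambda>u. \<Psi>1 u * tail_prod' q u)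
     = S (\<lambda>u. \<Psi> u * tail_prod' q u)"
    by (simp add: S_def \<Psi>1_def flip: site_sum_add sum.distrib) (simp add: algebra_simps)
  finally show "(\<Sum>m\<le>k - q. v m * g (q + m) * site_sum (k - q) q (\<lambda>u. M m u * tail_prod q u) s)
     \<le> Lam q * site_sum (k - q) q (\<lambda>u. \<Psi> u * tail_prod' q u) s"
    unfolding S_eq unfolding kq .
qed

text \<open>Both claims go downward together, since either of them at q uses
  \<open>cut_bound (Suc q)\<close> and the nonnegativity of g beyond q.\<close>

lemma cut_bound_all: "q \<le> k \<Longrightarrow> cut_bound q \<and> (\<forall>r. q \<le> r \<and> r \<le> k \<longrightarrow> 0 \<le> g r)"
proof (induction q rule: inc_induct)
  case base
  have "g k = Lam k"
    by (simp add: g_def N_def Z_def Z'_def tail_prod_def tail_prod'_def)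
  then show ?case using cut_bound_k Lam_pos[of k] by (auto simp: le_antisym)
next
  case (step q)
  have "0 \<le> g q" using cut_bound_step_nonneg[of q] step by auto
  moreover have "cut_bound q" using cut_bound_step[of q] step by auto
  moreover have "r = q \<or> Suc q \<le> r" if "q \<le> r" for r using that by linarith
  ultimately show ?case using step by blast
qed

definition H :: "'s \<Rightarrow> real" where "H a = site_sum (k - 1) 1 (tail_prod 0) (x(0 := a))"
definition H' :: "'s \<Rightarrow> real" where "H' a = site_sum (k - 1) 1 (tail_prod' 0) (x(0 := a))"

text \<open>This is the comparison behind 0 \<le> g 0 before the symbol at the origin is summed out.
  The constant does not depend on that symbol, which is why odds can be bounded.\<close>

lemma H_lower_bound:
  assumes "1 \<le> k"
  shows "(\<Sum>t=1..k. p t * (Lam t * (Z' t / Z t))) * H a \<le> H' a"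
proof -
  have k: "0 < k" using assms by simp
  have cb: "cut_bound (Suc 0)" and g_nonneg: "\<And>r. r \<le> k \<Longrightarrow> 0 \<le> g r"
    using cut_bound_all[of "Suc 0"] cut_bound_all[of 0] assms by auto
  have "(\<Sum>t=1..k. p t * (Lam t * (Z' t / Z t))) * H a
      = (\<Sum>m\<le>k - Suc 0. v (Suc m) * g (0 + Suc m)) * H a"
    using N_eq_Suc[OF k] g_def[of 0] by (simp add: N_def)
  also have "\<dots> \<le> H' a"
    using cut_bound_next[OF k cb g_nonneg minorants_1 adm_upd[OF adm_x, of 0 a]]
    by (simp add: sum_distrib_right H_def H'_def Lam_def)
  finally show ?thesis .
qed

end

text \<open>The weights \<open>w t\<close> will be the ratios Z' t / Z t, about which nothing is
  known. Interchanging the boundary conditions produces their inverses, and Cauchy-Schwarz removes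
  both.\<close>

lemma sum_mult_inverse_ge:
  fixes c w :: "nat \<Rightarrow> real"
  assumes c: "\<And>t. t \<in> A \<Longrightarrow> 0 \<le> c t" and w: "\<And>t. t \<in> A \<Longrightarrow> 0 < w t"
  shows "(\<Sum>t\<in>A. c t)\<^sup>2 \<le> (\<Sum>t\<in>A. c t * w t) * (\<Sum>t\<in>A. c t * (1 / w t))"
proof -
  have "(\<Sum>t\<in>A. sqrt (c t * w t) * sqrt (c t * (1 / w t)))\<^sup>2
      \<le> (\<Sum>t\<in>A. (sqrt (c t * w t))\<^sup>2) * (\<Sum>t\<in>A. (sqrt (c t * (1 / w t)))\<^sup>2)"
    by (rule Cauchy_Schwarz_ineq_sum)
  moreover have "(\<Sum>t\<in>A. sqrt (c t * w t) * sqrt (c t * (1 / w t))) = (\<Sum>t\<in>A. c t)"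
  proof (rule sum.cong[OF refl])
    fix t assume t: "t \<in> A"
    have "sqrt (c t * w t) * sqrt (c t * (1 / w t)) = sqrt ((c t)\<^sup>2)"
      unfolding real_sqrt_mult[symmetric] using w[OF t] by (simp add: power2_eq_square)
    then show "sqrt (c t * w t) * sqrt (c t * (1 / w t)) = c t" using c[OF t] by simp
  qed
  moreover have "(\<Sum>t\<in>A. (sqrt (c t * w t))\<^sup>2) = (\<Sum>t\<in>A. c t * w t)"
    "(\<Sum>t\<in>A. (sqrt (c t * (1 / w t)))\<^sup>2) = (\<Sum>t\<in>A. c t * (1 / w t))"
    using assms by (auto intro!: sum.cong simp: less_imp_le)
  ultimately show ?thesis by simp
qed

context two_boundaries
begin

text \<open>One direction of \<open>H_lower_bound\<close> is used for the symbol b and the other for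
  a, so that the product compares odds.\<close>

theorem odds_ratio_bound:
  assumes "1 \<le> k"
  shows "(\<Sum>t=1..k. p t * Lam t)\<^sup>2 * (H' a * H b) \<le> H' b * H a"
proof -
  interpret sw: two_boundaries k F' F R lam x v p by (rule swap)
  have eqs: "sw.Z = Z'" "sw.Z' = Z" "sw.H = H'" "sw.H' = H"
    by (auto simp: fun_eq_iff sw.Z_def Z'_def sw.Z'_def Z_def sw.tail_prod_def[abs_def] tail_prod'_def[abs_def]
        sw.tail_prod'_def[abs_def] tail_prod_def[abs_def] sw.H_def H'_def sw.H'_def H_def)
  have Hpos: "0 < H c" "0 < H' c" for c
    by (auto simp: H_def H'_def intro!: site_sum_pos tail_prod_pos tail_prod'_pos)
  have c_nonneg: "0 \<le> p t * Lam t" if "t \<in> {1..k}" for t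
    using that p_nonneg[of t] Lam_pos[of t] by simp
  let ?A = "\<Sum>t=1..k. p t * (Lam t * (Z' t / Z t))"
  let ?B = "\<Sum>t=1..k. p t * (Lam t * (Z t / Z' t))"
  have A: "?A * H b \<le> H' b" by (rule H_lower_bound[OF assms])
  have B: "?B * H' a \<le> H a" using sw.H_lower_bound[OF assms, of a] unfolding eqs .
  have "(\<Sum>t=1..k. p t * Lam t)\<^sup>2 \<le> ?A * ?B"
    using sum_mult_inverse_ge[of "{1..k}" "\<lambda>t. p t * Lam t" "\<lambda>t. Z' t / Z t"] c_nonneg Z_pos Z'_pos
    by (simp add: mult.assoc divide_pos_pos)
  then have "(\<Sum>t=1..k. p t * Lam t)\<^sup>2 * (H' a * H b) \<le> ?A * ?B * (H' a * H b)"
    using Hpos by (intro mult_right_mono) (auto simp: less_imp_le)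
  also have "\<dots> = (?A * H b) * (?B * H' a)" by (simp add: mult_ac)
  also have "\<dots> \<le> H' b * H a"
  proof (intro mult_mono A B)
    show "0 \<le> ?B * H' a"
      using Hpos(2)[of a] Z_pos Z'_pos p_nonneg Lam_pos
      by (intro mult_nonneg_nonneg sum_nonneg divide_nonneg_nonneg) (auto simp: less_imp_le)
  qed (use Hpos in \<open>simp add: less_imp_le\<close>)
  finally show ?thesis .
qed

end

section \<open>Renewal asymptotics\<close>

lemma neg_binomial_series:
  fixes s :: real
  assumes "0 \<le> s" "s < 1"
  shows "(\<lambda>m. pochhammer \<alpha> m / fact m * s ^ m) sums (1 - s) powr (- \<alpha>)"
proof -
  have "(\<lambda>n. ((- \<alpha>) gchoose n) * (- s) ^ n) sums (1 + - s) powr (- \<alpha>)"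
    by (rule gen_binomial_real) (use assms in auto)
  moreover have "((- \<alpha>) gchoose n) * (- s) ^ n = pochhammer \<alpha> n / fact n * s ^ n" for n
  proof -
    have "((- \<alpha>) gchoose n) * (- s) ^ n
        = ((- 1) ^ n * (- 1) ^ n) * (pochhammer \<alpha> n / fact n * s ^ n)"
      by (simp add: gbinomial_pochhammer power_minus[of s])
    also have "(- 1) ^ n * (- 1) ^ n = (1::real)" by (simp flip: power_mult_distrib)
    finally show ?thesis by simp
  qed
  ultimately show ?thesis by simp
qed

text \<open>By Euler's limit formula, pochhammer \<alpha> m / m! is asymptotic to m powr (\<alpha> -
  1) / Gamma \<alpha>. This is how the Gamma function enters.\<close>

lemma eventually_pochhammer_le:
  fixes \<alpha> \<theta> :: real
  assumes "0 < \<alpha>" "\<theta> < Gamma \<alpha>"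
  shows "\<forall>\<^sub>F m in sequentially. \<theta> * (pochhammer \<alpha> m / fact m) \<le> real m powr (\<alpha> - 1)"
proof -
  have "\<forall>\<^sub>F m in sequentially. \<theta> < Gamma_series' \<alpha> m"
    using Gamma_series'_LIMSEQ assms(2) by (rule order_tendstoD)
  with eventually_gt_at_top[of 0] show ?thesis
  proof eventually_elim
    case (elim m)
    have pos: "0 < pochhammer \<alpha> m" using assms by (intro pochhammer_pos)
    have "fact m = real m * fact (m - 1)" using elim by (simp add: fact_reduce)
    moreover have "real m powr (\<alpha> - 1) = exp (\<alpha> * ln (real m)) / real m"
      using elim by (simp add: powr_def left_diff_distrib exp_diff)
    ultimately have "Gamma_series' \<alpha> m = real m powr (\<alpha> - 1) / (pochhammer \<alpha> m / fact m)"
      using elim by (simp add: Gamma_series'_def field_simps)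
    then have less: "\<theta> < real m powr (\<alpha> - 1) / (pochhammer \<alpha> m / fact m)" using elim by simp
    have "0 < pochhammer \<alpha> m / fact m" using pos by simp
    from pos_less_divide_eq[OF this] less show ?case by (simp only: less_imp_le)
  qed
qed

lemma one_minus_exp_powr_ge:
  fixes l :: real
  assumes "0 < l" "0 < \<alpha>"
  shows "l powr (- \<alpha>) \<le> (1 - exp (- l)) powr (- \<alpha>)"
proof -
  have "1 - exp (- l) \<le> l" using exp_ge_add_one_self[of "- l"] by simp
  moreover have "0 < 1 - exp (- l)" using assms by simp
  ultimately show ?thesis using assms by (intro powr_mono2') auto
qed

text \<open>Comparison with the binomial series of (1 - s) powr (- \<alpha>) at s = exp (- l), where
  l powr \<alpha> = c1 / sqrt n: up to an additive constant the sum is at least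
  (\<open>\<theta>\<close> / c1) * sqrt n, and \<open>\<theta>\<close> > c1 leaves room for some c <
  1.\<close>

lemma truncated_gf_lower_bound:
  fixes v :: "nat \<Rightarrow> real" and \<alpha> K c1 :: real
  assumes \<alpha>: "0 < \<alpha>" and K: "0 < K" and c1: "0 < c1" "K * c1 < Gamma \<alpha>"
    and v_nonneg: "\<And>n. 0 \<le> v n"
    and v_ge: "\<forall>\<^sub>F m in sequentially. real m powr (\<alpha> - 1) / K \<le> v m"
  obtains c where "0 < c" "c < 1"
    "\<forall>\<^sub>F n in sequentially. \<exists>T. sqrt (real n) / c
       < (\<Sum>m\<le>T. v m * exp (- ((c1 / sqrt (real n)) powr (1 / \<alpha>))) ^ m)"
proof -
  have "c1 < Gamma \<alpha> / K" using c1 K by (simp add: less_divide_eq mult.commute)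
  then obtain \<theta> where \<theta>: "c1 < \<theta>" "\<theta> < Gamma \<alpha> / K"
    using dense by blast
  have "c1 / \<theta> < 1" "0 < c1 / \<theta>" using \<theta> c1 by (auto simp: pos_divide_less_eq)
  then obtain c where c: "0 < c" "c < 1" "c1 / \<theta> < c"
    using dense order_less_trans by metis
  have gap: "0 < \<theta> / c1 - 1 / c"
  proof -
    have "c1 < c * \<theta>" using c(3) \<theta> c1 by (simp add: pos_divide_less_eq)
    then show ?thesis using c c1 by (simp add: field_simps)
  qed
  define a where "a m = pochhammer \<alpha> m / fact m" for m :: nat
  have a_nonneg: "0 \<le> a m" for m
    using \<alpha> by (simp add: a_def pochhammer_pos less_imp_le)
  have "K * \<theta> < Gamma \<alpha>" using \<theta> K by (simp add: less_divide_eq mult.commute)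
  from eventually_pochhammer_le[OF \<alpha> this] v_ge
  have "\<forall>\<^sub>F m in sequentially. \<theta> * a m \<le> v m"
  proof eventually_elim
    case (elim m)
    then have "K * (\<theta> * a m) \<le> real m powr (\<alpha> - 1)" by (simp add: a_def mult.assoc)
    then have "\<theta> * a m \<le> real m powr (\<alpha> - 1) / K" using K by (simp add: le_divide_eq mult.commute)
    then show ?case using elim by simp
  qed
  then obtain m0 where m0: "\<And>m. m0 \<le> m \<Longrightarrow> \<theta> * a m \<le> v m"
    by (auto simp: eventually_sequentially)
  define C where "C = (\<Sum>m<m0. a m)"
  \<comment> \<open>The constant C accounts for the indices below m0, where v is not compared, and
    the 1 for the truncation at T.\<close>
  have main: "\<exists>T. \<theta> * ((1 - s) powr (- \<alpha>) - C - 1) \<le> (\<Sum>m\<le>T. v m * s ^ m)"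
    if s: "0 \<le> s" "s < 1" for s
  proof -
    have "(\<lambda>T. \<Sum>m\<le>T. a m * s ^ m) \<longlonglongrightarrow> (1 - s) powr (- \<alpha>)"
      using neg_binomial_series[OF s, of \<alpha>] unfolding a_def sums_def_le .
    then have "\<forall>\<^sub>F T in sequentially. (1 - s) powr (- \<alpha>) - 1 < (\<Sum>m\<le>T. a m * s ^ m)"
      by (rule order_tendstoD) simp
    then obtain T where T: "(1 - s) powr (- \<alpha>) - 1 < (\<Sum>m\<le>T. a m * s ^ m)"
      by (auto simp: eventually_sequentially)
    have "(\<Sum>m\<le>T. a m * s ^ m) - C \<le> (\<Sum>m\<in>{..T} - {..<m0}. a m * s ^ m)"
    proof -
      have "(\<Sum>m\<le>T. a m * s ^ m) = (\<Sum>m\<in>{..T} \<inter> {..<m0}. a m * s ^ m)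
          + (\<Sum>m\<in>{..T} - {..<m0}. a m * s ^ m)"
        by (rule sum.Int_Diff) simp
      moreover have "(\<Sum>m\<in>{..T} \<inter> {..<m0}. a m * s ^ m) \<le> (\<Sum>m\<in>{..T} \<inter> {..<m0}. a m)"
        using s a_nonneg by (intro sum_mono) (simp add: mult_left_le power_le_one)
      moreover have "(\<Sum>m\<in>{..T} \<inter> {..<m0}. a m) \<le> C"
        unfolding C_def using a_nonneg by (intro sum_mono2) auto
      ultimately show ?thesis by simp
    qed
    then have "\<theta> * ((1 - s) powr (- \<alpha>) - C - 1) \<le> \<theta> * (\<Sum>m\<in>{..T} - {..<m0}. a m * s ^ m)"
      using T \<theta> c1 by (intro mult_left_mono) auto
    also have "\<dots> \<le> (\<Sum>m\<in>{..T} - {..<m0}. v m * s ^ m)"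
      unfolding sum_distrib_left mult.assoc[symmetric] using m0 s
      by (intro sum_mono mult_right_mono) auto
    also have "\<dots> \<le> (\<Sum>m\<le>T. v m * s ^ m)"
      using v_nonneg s by (intro sum_mono2) auto
    finally show ?thesis by blast
  qed
  have "filterlim (\<lambda>n. sqrt (real n)) at_top sequentially"
    by (rule filterlim_compose[OF sqrt_at_top filterlim_real_sequentially])
  then have "\<forall>\<^sub>F n in sequentially. \<theta> * (C + 1) / (\<theta> / c1 - 1 / c) < sqrt (real n)"
    by (simp add: filterlim_at_top_dense)
  with eventually_gt_at_top[of 0]
  have "\<forall>\<^sub>F n in sequentially. \<exists>T. sqrt (real n) / c
       < (\<Sum>m\<le>T. v m * exp (- ((c1 / sqrt (real n)) powr (1 / \<alpha>))) ^ m)"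
  proof eventually_elim
    case (elim n)
    define l where "l = (c1 / sqrt (real n)) powr (1 / \<alpha>)"
    have "0 < l" using c1 elim by (simp add: l_def)
    obtain T where T: "\<theta> * ((1 - exp (- l)) powr (- \<alpha>) - C - 1) \<le> (\<Sum>m\<le>T. v m * exp (- l) ^ m)"
      using main[of "exp (- l)"] \<open>0 < l\<close> by auto
    have "l powr (- \<alpha>) = sqrt (real n) / c1"
      using c1 elim \<alpha> by (simp add: l_def powr_powr powr_minus)
    then have "sqrt (real n) / c1 \<le> (1 - exp (- l)) powr (- \<alpha>)"
      using one_minus_exp_powr_ge[OF \<open>0 < l\<close> \<alpha>] by simp
    then have "\<theta> * (sqrt (real n) / c1 - C - 1) \<le> (\<Sum>m\<le>T. v m * exp (- l) ^ m)"
      using \<theta> c1 by (intro order_trans[OF mult_left_mono T]) auto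
    moreover have "sqrt (real n) / c < \<theta> * (sqrt (real n) / c1 - C - 1)"
    proof -
      have "\<theta> * (C + 1) < sqrt (real n) * (\<theta> / c1 - 1 / c)"
        using elim(2) gap by (simp add: pos_divide_less_eq)
      then show ?thesis by (simp add: algebra_simps)
    qed
    ultimately show ?case unfolding l_def by (meson less_le_trans)
  qed
  then show thesis using that c by blast
qed

text \<open>The quantity in the conclusion bounds odds ratios; the sum over \<open>t\<close> is the generating function
  of the renewal distribution, up to the boundary correction \<open>v k / v (k - t)\<close>.\<close>

lemma renewal_asymptotics:
  fixes R v p :: "nat \<Rightarrow> real" and \<alpha> K c1 :: real
  assumes \<alpha>: "0 < \<alpha>" "\<alpha> \<le> 1" and K: "0 < K" and c1: "0 < c1" "K * c1 < Gamma \<alpha>"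
    and R_ge: "\<And>i. 1 \<le> R i" and R_dec: "decseq R"
    and R_prod: "\<forall>\<^sub>F n in sequentially. real n powr (\<alpha> - 1) * (\<Prod>i\<le>n. R i) \<le> K"
    and v_def: "v = (\<lambda>n. \<Prod>i<n. 1 / R i)"
    and p_def: "p = renewal_prob v"
  shows "\<And>t. 1 \<le> t \<Longrightarrow> 0 \<le> p t"
    and "\<exists>c. 0 < c \<and> c < 1 \<and> (\<forall>\<^sub>F n in sequentially. \<forall>\<^sub>F k in sequentially.
      1 - c / sqrt (real n) < (\<Sum>t=1..k. p t * (exp (- ((c1 / sqrt (real n)) powr (1 / \<alpha>))) ^ t * (v k / v (k - t)))))"
proof -
  have R_pos: "0 < R i" for i by (rule less_le_trans[OF zero_less_one R_ge])
  have v_0: "v 0 = 1" and v_Suc: "v (Suc n) = v n / R n" for n by (simp_all add: v_def)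
  have v_pos: "0 < v n" for n
    unfolding v_def using R_pos by (intro prod_pos) simp
  show p_nonneg: "0 \<le> p t" if "1 \<le> t" for t
    unfolding p_def
  proof (rule renewal_prob_nonneg[where v=v, OF v_0 v_pos _ that])
    fix m n :: nat assume "m \<le> n"
    then have "R n \<le> R m" using R_dec by (simp add: decseq_def)
    then show "v (Suc m) / v m \<le> v (Suc n) / v n"
      using R_pos[of m] R_pos[of n] v_pos[of m] v_pos[of n] by (simp add: v_Suc field_simps)
  qed
  \<comment> \<open>v (Suc n) inverts the product over i \<le> n, hence a shift of the index, which
    is harmless because n powr (\<alpha> - 1) does not increase.\<close>
  have v_ge: "\<forall>\<^sub>F m in sequentially. real m powr (\<alpha> - 1) / K \<le> v m"
  proof -
    have "\<forall>\<^sub>F n in sequentially. real (Suc n) powr (\<alpha> - 1) / K \<le> v (Suc n)"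
      using R_prod eventually_gt_at_top[of 0]
    proof eventually_elim
      case (elim n)
      have vP: "v (Suc n) * (\<Prod>i\<le>n. R i) = 1"
        unfolding v_def lessThan_Suc_atMost prod.distrib[symmetric]
        using R_pos by (simp add: less_imp_neq[THEN not_sym])
      have "real (Suc n) powr (\<alpha> - 1) \<le> real n powr (\<alpha> - 1)"
        using elim \<alpha> by (intro powr_mono2') auto
      also have "\<dots> = real n powr (\<alpha> - 1) * (\<Prod>i\<le>n. R i) * v (Suc n)"
        using vP by (simp add: mult.assoc mult.commute[of _ "v (Suc n)"])
      also have "\<dots> \<le> K * v (Suc n)"
        using elim v_pos[of "Suc n"] by (intro mult_right_mono) auto
      finally show ?case using K by (simp add: pos_divide_le_eq mult.commute)
    qed
    then show ?thesis unfolding eventually_sequentially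
      by (metis Suc_le_D Suc_le_mono)
  qed
  \<comment> \<open>With a limit r > 1 the products would be at least r ^ n, but they are at most K
    * n powr (1 - \<alpha>) for large n.\<close>
  have R_lim: "R \<longlonglongrightarrow> 1"
  proof -
    have "convergent R" using R_dec R_ge by (metis decseq_convergent convergentI)
    then obtain r where r: "R \<longlonglongrightarrow> r" by (auto simp: convergent_def)
    have r1: "1 \<le> r" using r R_ge by (intro LIMSEQ_le_const) auto
    have r_le: "r \<le> R i" for i using R_dec r by (rule decseq_ge)
    have "\<not> 1 < r"
    proof
      assume "1 < r"
      have "\<forall>\<^sub>F n in sequentially. r ^ n \<le> K * real n"
        using R_prod eventually_gt_at_top[of 0]
      proof eventually_elim
        case (elim n)
        have "r ^ n \<le> r ^ Suc n" using r1 by (intro power_increasing) auto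
        also have "\<dots> = (\<Prod>i\<le>n. r)" by simp
        also have "\<dots> \<le> (\<Prod>i\<le>n. R i)" using r_le r1 by (intro prod_mono) auto
        also have "\<dots> = real n powr (1 - \<alpha>) * (real n powr (\<alpha> - 1) * (\<Prod>i\<le>n. R i))"
          using elim by (simp add: powr_add[symmetric] mult.assoc[symmetric])
        also have "\<dots> \<le> real n powr (1 - \<alpha>) * K" using elim by (intro mult_left_mono) auto
        also have "\<dots> \<le> real n powr 1 * K"
          using elim \<alpha> K by (intro mult_right_mono powr_mono) auto
        finally show ?case using elim by (simp add: mult.commute)
      qed
      moreover have "(\<lambda>n. real n / r ^ n) \<longlonglongrightarrow> 0"
        using powser_times_n_limit_0[of "1 / r"] \<open>1 < r\<close> by (simp add: power_divide)
      then have "\<forall>\<^sub>F n in sequentially. real n / r ^ n < 1 / K"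
        using K by (intro order_tendstoD) auto
      ultimately have "\<forall>\<^sub>F n in sequentially. False"
      proof eventually_elim
        case (elim n)
        have "0 < r ^ n" using \<open>1 < r\<close> by simp
        then show ?case using elim K by (simp add: field_simps)
      qed
      then show False by simp
    qed
    then show ?thesis using r r1 by simp
  qed
  have v_step: "v m * (1 / R m) ^ t \<le> v (m + t)" for m t
  proof (induction t)
    case (Suc t)
    have "R (m + t) \<le> R m" using R_dec by (simp add: decseq_def)
    then have "1 / R m \<le> 1 / R (m + t)" using R_pos by (simp add: frac_le)
    then have "v m * (1 / R m) ^ t * (1 / R m) \<le> v (m + t) * (1 / R (m + t))"
      using Suc v_pos[of "m + t"] R_pos[of m] by (intro mult_mono) (simp_all add: less_imp_le)
    then show ?case by (simp add: v_Suc mult.assoc)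
  qed simp
  obtain c where c: "0 < c" "c < 1" and ev: "\<forall>\<^sub>F n in sequentially. \<exists>T. sqrt (real n) / c
       < (\<Sum>m\<le>T. v m * exp (- ((c1 / sqrt (real n)) powr (1 / \<alpha>))) ^ m)"
    by (rule truncated_gf_lower_bound[where v=v, OF \<alpha>(1) K c1 less_imp_le[OF v_pos] v_ge])
  have "\<forall>\<^sub>F n in sequentially. \<forall>\<^sub>F k in sequentially.
      1 - c / sqrt (real n) < (\<Sum>t=1..k. p t * (exp (- ((c1 / sqrt (real n)) powr (1 / \<alpha>))) ^ t * (v k / v (k - t))))"
    using ev eventually_gt_at_top[of 0]
  proof eventually_elim
    case (elim n)
    define s where "s = exp (- ((c1 / sqrt (real n)) powr (1 / \<alpha>)))"
    have s: "0 \<le> s" by (simp add: s_def)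
    obtain T where T: "sqrt (real n) / c < (\<Sum>m\<le>T. v m * s ^ m)"
      using elim by (auto simp: s_def)
    define Q where "Q = (\<Sum>t=1..T. p t * s ^ t)"
    have pos: "0 < sqrt (real n) / c" using elim c by simp
    have "1 / (\<Sum>m\<le>T. v m * s ^ m) < 1 / (sqrt (real n) / c)"
      using T pos by (intro divide_strict_left_mono mult_pos_pos) auto
    then have "1 - c / sqrt (real n) < 1 - 1 / (\<Sum>m\<le>T. v m * s ^ m)" by simp
    also have "\<dots> \<le> Q"
      unfolding Q_def p_def
      by (rule renewal_prob_partial_gf[where v=v, OF v_0 v_pos _ s]) (use p_nonneg p_def in auto)
    finally have Q: "1 - c / sqrt (real n) < Q" .
    \<comment> \<open>T stays fixed while k grows: v k / v (k - t) with t \<le> T is a product of at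
      most T factors 1 / R i with i \<ge> k - T, and these tend to 1.\<close>
    have "(\<lambda>k. (1 / R (k - T)) ^ T * Q) \<longlonglongrightarrow> (1 / 1) ^ T * Q"
      by (intro tendsto_intros filterlim_compose[OF R_lim] filterlim_minus_const_nat_at_top) auto
    then have "\<forall>\<^sub>F k in sequentially. 1 - c / sqrt (real n) < (1 / R (k - T)) ^ T * Q"
      using Q by (intro order_tendstoD) auto
    with eventually_ge_at_top[of T]
    have "\<forall>\<^sub>F k in sequentially. 1 - c / sqrt (real n) < (\<Sum>t=1..k. p t * (s ^ t * (v k / v (k - t))))"
    proof eventually_elim
      case (elim k)
      have le: "(1 / R (k - T)) ^ T \<le> v k / v (k - t)" if t: "t \<in> {1..T}" for t
      proof -
        have "R (k - t) \<le> R (k - T)"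
          using R_dec t diff_le_mono2[of t T k] by (simp add: decseq_def)
        then have "1 / R (k - T) \<le> 1 / R (k - t)" using R_pos by (simp add: frac_le)
        moreover have "(1 / R (k - T)) ^ T \<le> (1 / R (k - T)) ^ t"
          using t R_pos[of "k - T"] R_ge[of "k - T"] by (intro power_decreasing) auto
        ultimately have "(1 / R (k - T)) ^ T \<le> (1 / R (k - t)) ^ t"
          using R_pos[of "k - T"] power_mono[of "1 / R (k - T)" "1 / R (k - t)" t] by simp
        also have "\<dots> \<le> v k / v (k - t)"
          using v_step[of "k - t" t] v_pos[of "k - t"] t elim by (simp add: le_divide_eq mult.commute)
        finally show ?thesis .
      qed
      have "(1 / R (k - T)) ^ T * Q \<le> (\<Sum>t=1..T. p t * (s ^ t * (v k / v (k - t))))"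
        unfolding Q_def sum_distrib_left
      proof (rule sum_mono)
        fix t assume t: "t \<in> {1..T}"
        have "p t * s ^ t * (1 / R (k - T)) ^ T \<le> p t * s ^ t * (v k / v (k - t))"
          using le[OF t] p_nonneg[of t] t s by (intro mult_left_mono) auto
        then show "(1 / R (k - T)) ^ T * (p t * s ^ t) \<le> p t * (s ^ t * (v k / v (k - t)))"
          by (simp add: mult_ac)
      qed
      also have "\<dots> \<le> (\<Sum>t=1..k. p t * (s ^ t * (v k / v (k - t))))"
        using elim p_nonneg s v_pos
        by (intro sum_mono2 mult_nonneg_nonneg divide_nonneg_nonneg) (auto simp: less_imp_le)
      finally show ?case using elim by linarith
    qed
    then show ?case by (simp add: s_def)
  qed
  then show "\<exists>c. 0 < c \<and> c < 1 \<and> (\<forall>\<^sub>F n in sequentially. \<forall>\<^sub>F k in sequentially.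
      1 - c / sqrt (real n) < (\<Sum>t=1..k. p t * (exp (- ((c1 / sqrt (real n)) powr (1 / \<alpha>))) ^ t * (v k / v (k - t)))))"
    using c by blast
qed

section \<open>Specifications with decaying dependence\<close>

lemma cyl_iff: "y \<in> cyl \<Lambda> x \<longleftrightarrow> (\<forall>i\<in>\<Lambda>. y i = x i)"
  by (auto simp: cyl_def restrict_def fun_eq_iff)

lemma cyl_insert_UN:
  "cyl (- insert i \<Lambda>) x = (\<Union>a. cyl (- \<Lambda>) (x(i := a)))" if "i \<notin> \<Lambda>"
proof (intro set_eqI iffI)
  fix y assume "y \<in> cyl (- insert i \<Lambda>) x"
  then have "y \<in> cyl (- \<Lambda>) (x(i := y i))" by (auto simp: cyl_iff)
  then show "y \<in> (\<Union>a. cyl (- \<Lambda>) (x(i := a)))" by blast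
next
  fix y assume "y \<in> (\<Union>a. cyl (- \<Lambda>) (x(i := a)))"
  then obtain a where "y \<in> cyl (- \<Lambda>) (x(i := a))" by blast
  then show "y \<in> cyl (- insert i \<Lambda>) x" using that by (auto simp: cyl_iff split: if_splits)
qed

lemma cyl_empty_compl: "cyl (- {}) x = {x}"
  by (auto simp: cyl_iff)

lemma finite_cyl:
  fixes x :: "int \<Rightarrow> 's::finite"
  assumes "finite \<Lambda>"
  shows "finite (cyl (- \<Lambda>) x)"
  using assms
proof (induction arbitrary: x)
  case (insert i \<Lambda>)
  then show ?case by (simp add: cyl_insert_UN del: Compl_insert)
qed (simp only: cyl_empty_compl finite.intros)

lemma sum_cyl_insert:
  fixes x :: "int \<Rightarrow> 's::finite" and H :: "(int \<Rightarrow> 's) \<Rightarrow> real"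
  assumes "finite \<Lambda>" "i \<notin> \<Lambda>"
  shows "(\<Sum>y\<in>cyl (- insert i \<Lambda>) x. H y) = (\<Sum>a\<in>UNIV. \<Sum>y\<in>cyl (- \<Lambda>) (x(i := a)). H y)"
  unfolding cyl_insert_UN[OF assms(2)]
proof (rule sum.UNION_disjoint)
  show "\<forall>a\<in>UNIV. finite (cyl (- \<Lambda>) (x(i := a)))" using finite_cyl[OF assms(1)] by blast
  show "\<forall>a\<in>UNIV. \<forall>b\<in>UNIV. a \<noteq> b \<longrightarrow>
      cyl (- \<Lambda>) (x(i := a)) \<inter> cyl (- \<Lambda>) (x(i := b)) = {}"
  proof (intro ballI impI equals0I)
    fix a b y assume "a \<noteq> b" "y \<in> cyl (- \<Lambda>) (x(i := a)) \<inter> cyl (- \<Lambda>) (x(i := b))"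
    then have "y i = (x(i := a)) i" "y i = (x(i := b)) i" using assms(2) unfolding Int_iff cyl_iff by blast+
    then show False using \<open>a \<noteq> b\<close> by simp
  qed
qed simp

lemma sum_cyl_eq_site_sum:
  fixes x :: "int \<Rightarrow> 's::finite"
  shows "(\<Sum>y\<in>cyl (- {int q..<int (q + m)}) x. H y) = site_sum m q H x"
proof (induction m arbitrary: q x)
  case 0
  then show ?case by (simp add: cyl_empty_compl[simplified])
next
  case (Suc m)
  have "{int q..<int (q + Suc m)} = insert (int q) {int (Suc q)..<int (Suc q + m)}" by auto
  then have "(\<Sum>y\<in>cyl (- {int q..<int (q + Suc m)}) x. H y)
    = (\<Sum>a\<in>UNIV. \<Sum>y\<in>cyl (- {int (Suc q)..<int (Suc q + m)}) (x(int q := a)). H y)"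
    by (simp only:) (rule sum_cyl_insert; simp)
  then show ?case by (simp only: Suc.IH site_sum.simps)
qed

lemma site_sum_cong_boundary:
  assumes "\<And>i. i < int q \<or> int (q + m) \<le> i \<Longrightarrow> s i = s' i"
  shows "site_sum m q H s = site_sum m q H s'"
  using assms
proof (induction m arbitrary: q s s')
  case 0
  then have "s = s'" by (intro ext) (simp add: linorder_not_less[symmetric])
  then show ?case by simp
next
  case (Suc m)
  have "site_sum m (Suc q) H (s(int q := a)) = site_sum m (Suc q) H (s'(int q := a))" for a
  proof (rule Suc.IH)
    fix i assume "i < int (Suc q) \<or> int (Suc q + m) \<le> i"
    then show "(s(int q := a)) i = (s'(int q := a)) i"
      using Suc.prems[of i] by (cases "i = int q") auto
  qed
  then show ?case by simp
qed

text \<open>Two boundary conditions are compared by overlaying the same inner configuration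
  \<open>u\<close> on each of them.\<close>

definition overlay :: "nat \<Rightarrow> (int \<Rightarrow> 's) \<Rightarrow> (int \<Rightarrow> 's) \<Rightarrow> (int \<Rightarrow> 's)" where
  "overlay k x u = (\<lambda>i. if 0 \<le> i \<and> i < int k then u i else x i)"

lemma site_sum_overlay:
  "q + m \<le> k \<Longrightarrow> site_sum m q (\<lambda>u. H (overlay k x u)) s = site_sum m q H (overlay k x s)"
proof (induction m arbitrary: q s)
  case (Suc m)
  have "overlay k x (s(int q := a)) = (overlay k x s)(int q := a)" for a
    using Suc.prems by (auto simp: overlay_def)
  moreover have "site_sum m (Suc q) (\<lambda>u. H (overlay k x u)) (s(int q := a))
      = site_sum m (Suc q) H (overlay k x (s(int q := a)))" for a
    using Suc.prems by (intro Suc.IH) simp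
  ultimately show ?case by (simp only: site_sum.simps)
qed simp

text \<open>The sets that do not separate x from y include the generators and are closed under
  complements and countable unions; the fibre of h through x is one of them.\<close>

lemma coord_algebra_depends:
  fixes h :: "(int \<Rightarrow> 's) \<Rightarrow> real"
  assumes "h \<in> borel_measurable (coord_algebra \<Lambda>)" "\<And>i. i \<in> \<Lambda> \<Longrightarrow> x i = y i"
  shows "h x = h y"
proof -
  have sat: "A \<in> sigma_sets UNIV {(\<lambda>x. x i) -` A | i A. i \<in> \<Lambda>} \<Longrightarrow> x \<in> A \<longleftrightarrow> y \<in> A" for A
    by (induction rule: sigma_sets.induct) (use assms(2) in auto)
  have "h -` {h x} \<inter> space (coord_algebra \<Lambda>) \<in> sets (coord_algebra \<Lambda>)"
    by (rule measurable_sets[OF assms(1)]) simp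
  then have "h -` {h x} \<in> sigma_sets UNIV {(\<lambda>x. x i) -` A | i A. i \<in> \<Lambda>}"
    by (simp add: coord_algebra_def)
  from sat[OF this] show ?thesis by auto
qed

lemma ratio_osc_le:
  assumes "ratio_osc \<Lambda> h \<le> ereal r" "0 < h y" "\<And>i. i \<in> \<Lambda> \<Longrightarrow> x i = y i"
  shows "h x \<le> r * h y"
proof -
  have "restrict x \<Lambda> = restrict y \<Lambda>" using assms(3) by (auto simp: restrict_def)
  then have "ereal (h x / h y) \<le> ratio_osc \<Lambda> h"
    unfolding ratio_osc_def by (intro SUP_upper2[of "(x, y)"]) auto
  then have "ereal (h x / h y) \<le> ereal r" using assms(1) by (rule order_trans)
  then show ?thesis using assms(2) by (simp add: pos_divide_le_eq)
qed

lemma ratio_osc_ge_1: "(\<And>x. 0 < h x) \<Longrightarrow> 1 \<le> ratio_osc \<Lambda> h"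
  unfolding ratio_osc_def by (rule SUP_upper2[of "(x, x)" for x]) (auto simp: less_imp_neq[THEN not_sym] one_ereal_def)

lemma ratio_osc_antimono:
  fixes h :: "(int \<Rightarrow> 's) \<Rightarrow> real"
  assumes sub: "\<Lambda> \<subseteq> \<Lambda>'"
  shows "ratio_osc \<Lambda>' h \<le> ratio_osc \<Lambda> h"
  unfolding ratio_osc_def
proof (rule SUP_subset_mono)
  show "{(x :: int \<Rightarrow> 's, y). restrict x \<Lambda>' = restrict y \<Lambda>'} \<subseteq> {(x, y). restrict x \<Lambda> = restrict y \<Lambda>}"
  proof clarify
    fix x y :: "int \<Rightarrow> 's" assume "restrict x \<Lambda>' = restrict y \<Lambda>'"
    then have "restrict (restrict x \<Lambda>') \<Lambda> = restrict (restrict y \<Lambda>') \<Lambda>" by simp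
    then show "restrict x \<Lambda> = restrict y \<Lambda>" using sub by (simp add: Int_absorb1)
  qed
qed simp

lemma one_le_ereal_iff: "1 \<le> ereal r \<longleftrightarrow> 1 \<le> r"
  by (simp only: one_ereal_def ereal_less_eq)

lemma prod_ereal_finite_factor:
  fixes g :: "nat \<Rightarrow> ereal"
  assumes "\<And>i. 1 \<le> g i" "(\<Prod>i\<le>n. g i) < \<infinity>" "i \<le> n"
  shows "g i < \<infinity>"
proof -
  have "0 \<le> g i" "g i \<noteq> 0" for i
    using assms(1)[of i] by (auto intro: order_trans[of 0 1])
  then have "\<not> (\<exists>i\<in>{..n}. g i = \<infinity>)"
    using assms(2) prod_PInf[of "{..n}" g] by auto
  then show ?thesis using assms(3) by auto
qed

locale decaying_specification =
  fixes \<phi> :: "int set \<Rightarrow> (int \<Rightarrow> 's::{finite, discrete_topology}) \<Rightarrow> real"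
    and f :: "nat \<Rightarrow> (int \<Rightarrow> 's) \<Rightarrow> real"
    and \<alpha> K :: real
  assumes spec: "is_specification \<phi>"
    and pos: "positive_spec \<phi>"
    and cont: "continuous_spec \<phi>"
    and inv: "shift_invariant_spec \<phi>"
    and seq_for: "specification_sequence_for f \<phi>"
    and \<alpha>: "0 < \<alpha>" "\<alpha> \<le> 1" and K: "0 < K"
    and right_decay: "limsup (\<lambda>n. ereal (real n powr (\<alpha> - 1)) *
           (\<Prod>i\<le>n. SUP j. ratio_osc {..int i + int j} (f j))) \<le> ereal K"
    and left_decay: "limsup (\<lambda>n. ereal (real n powr (1 / 2)) *
           ereal_powr (ereal_ln (SUP j. ratio_osc {- int n..} (f j))) \<alpha>) < ereal (inverse K * Gamma \<alpha>)"
begin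

lemma f_pos: "0 < f j x"
  using seq_for by (auto simp: specification_sequence_for_def specification_sequence_def)

lemma f_local:
  assumes "\<And>i. i < 0 \<or> int j \<le> i \<Longrightarrow> x i = y i"
  shows "f j x = f j y"
proof (rule coord_algebra_depends[where h="f j"])
  show "f j \<in> borel_measurable (coord_algebra (- {0..int j - 1}))"
    using seq_for by (auto simp: specification_sequence_for_def specification_sequence_def)
qed (use assms in auto)

definition R :: "nat \<Rightarrow> real" where
  "R i = real_of_ereal (SUP j. ratio_osc {..int i + int j} (f j))"

lemma RE_ge_1: "1 \<le> (SUP j. ratio_osc {..int i + int j} (f j))"
  by (rule SUP_upper2[of 0]) (auto intro: ratio_osc_ge_1 f_pos)

text \<open>Some product reaching beyond i is finite because the limsup is, and all its factors are
  at least 1, so an infinite factor could not be cancelled by a zero.\<close>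

lemma R_finite: "ereal (R i) = (SUP j. ratio_osc {..int i + int j} (f j))"
proof -
  have "\<forall>\<^sub>F n in sequentially. ereal (real n powr (\<alpha> - 1)) *
      (\<Prod>i\<le>n. SUP j. ratio_osc {..int i + int j} (f j)) < ereal (K + 1)"
    using right_decay by (intro Limsup_lessD) (simp add: le_less_trans)
  with eventually_gt_at_top[of i] have "\<forall>\<^sub>F n in sequentially. i < n \<and> ereal (real n powr (\<alpha> - 1)) *
      (\<Prod>i\<le>n. SUP j. ratio_osc {..int i + int j} (f j)) < ereal (K + 1)"
    by (rule eventually_conj)
  then obtain n where n: "i < n" "ereal (real n powr (\<alpha> - 1)) *
      (\<Prod>i\<le>n. SUP j. ratio_osc {..int i + int j} (f j)) < ereal (K + 1)"
    by (auto simp: eventually_sequentially)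
  have "(\<Prod>i\<le>n. SUP j. ratio_osc {..int i + int j} (f j)) < \<infinity>"
    using n by (cases "\<Prod>i\<le>n. SUP j. ratio_osc {..int i + int j} (f j)") auto
  then have "(SUP j. ratio_osc {..int i + int j} (f j)) < \<infinity>"
    using n(1) by (intro prod_ereal_finite_factor[where n=n and i=i
          and g="\<lambda>i. SUP j. ratio_osc {..int i + int j} (f j)"] RE_ge_1) simp_all
  then show ?thesis unfolding R_def
    using RE_ge_1[of i] by (cases "SUP j. ratio_osc {..int i + int j} (f j)") auto
qed

lemma R_ge: "1 \<le> R i"
  using RE_ge_1[of i] unfolding R_finite[symmetric] one_le_ereal_iff .

lemma R_dec: "decseq R"
  unfolding decseq_def
proof (intro allI impI)
  fix m n :: nat assume "m \<le> n"
  then have "ereal (R n) \<le> ereal (R m)"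
    unfolding R_finite by (intro SUP_mono) (auto intro!: ratio_osc_antimono exI)
  then show "R n \<le> R m" by simp
qed

lemma f_osc:
  assumes "\<And>l. l \<le> int (j + i) \<Longrightarrow> x l = y l"
  shows "f j x \<le> R i * f j y"
proof (rule ratio_osc_le[where h="f j"])
  show "ratio_osc {..int i + int j} (f j) \<le> ereal (R i)"
    unfolding R_finite by (rule SUP_upper) simp
qed (use assms f_pos in auto)

lemma R_prod:
  assumes "K < K1"
  shows "\<forall>\<^sub>F n in sequentially. real n powr (\<alpha> - 1) * (\<Prod>i\<le>n. R i) \<le> K1"
proof -
  have "\<forall>\<^sub>F n in sequentially. ereal (real n powr (\<alpha> - 1)) *
      (\<Prod>i\<le>n. SUP j. ratio_osc {..int i + int j} (f j)) < ereal K1"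
    using right_decay assms by (intro Limsup_lessD) (simp add: le_less_trans)
  then show ?thesis
    unfolding R_finite[symmetric] by eventually_elim (simp add: prod_ereal)
qed

definition v :: "nat \<Rightarrow> real" where "v n = (\<Prod>i<n. 1 / R i)"
definition p :: "nat \<Rightarrow> real" where "p = renewal_prob v"

text \<open>The strict inequality in the second hypothesis leaves room to take c1 above its limsup
  and K1 above K with K1 * c1 still below Gamma \<alpha>; both limsup conditions then become bounds
  for all large n.\<close>

lemma constants:
  obtains K1 c1 where "0 < K1" "0 < c1" "K1 * c1 < Gamma \<alpha>"
    "\<forall>\<^sub>F n in sequentially. real n powr (\<alpha> - 1) * (\<Prod>i\<le>n. R i) \<le> K1"
    "\<forall>\<^sub>F n in sequentially. \<forall>j x y. (\<forall>i\<ge>- int n. x i = y i) \<longrightarrow>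
       f j x \<le> exp ((c1 / sqrt (real n)) powr (1 / \<alpha>)) * f j y"
proof -
  have G: "0 < Gamma \<alpha>" using \<alpha> by (simp add: Gamma_real_pos)
  let ?ls = "limsup (\<lambda>n. ereal (real n powr (1 / 2)) *
           ereal_powr (ereal_ln (SUP j. ratio_osc {- int n..} (f j))) \<alpha>)"
  \<comment> \<open>The maximum with 0 guarantees that c1 is positive.\<close>
  have "max 0 ?ls < ereal (inverse K * Gamma \<alpha>)" using left_decay G K by simp
  then obtain c1 where c1: "max 0 ?ls < ereal c1" "ereal c1 < ereal (inverse K * Gamma \<alpha>)"
    using ereal_dense2 by blast
  then have c1_pos: "0 < c1" by simp
  have "K < Gamma \<alpha> / c1" using c1 c1_pos K by (simp add: field_simps)
  then obtain K1 where K1: "K < K1" "K1 < Gamma \<alpha> / c1" using dense by blast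
  have "?ls < ereal c1" using c1 by simp
  then have ev: "\<forall>\<^sub>F n in sequentially. ereal (real n powr (1 / 2)) *
           ereal_powr (ereal_ln (SUP j. ratio_osc {- int n..} (f j))) \<alpha> < ereal c1"
    by (rule Limsup_lessD)
  have L: "\<forall>\<^sub>F n in sequentially. \<forall>j x y. (\<forall>i\<ge>- int n. x i = y i) \<longrightarrow>
       f j x \<le> exp ((c1 / sqrt (real n)) powr (1 / \<alpha>)) * f j y"
    using ev eventually_gt_at_top[of 0]
  proof eventually_elim
    case (elim n)
    define LE where "LE = (SUP j. ratio_osc {- int n..} (f j))"
    have n: "0 < real n powr (1 / 2)" using elim by simp
    have "1 \<le> LE" unfolding LE_def by (rule SUP_upper2[of 0]) (auto intro: ratio_osc_ge_1 f_pos)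
    moreover have "LE \<noteq> \<infinity>"
      using elim(1) n unfolding LE_def[symmetric] by (auto simp: ereal_ln_def ereal_powr_def)
    ultimately obtain l where l: "LE = ereal l" "1 \<le> l" by (cases LE) (auto simp: one_le_ereal_iff)
    have "real n powr (1 / 2) * ln l powr \<alpha> < c1"
      using elim(1) l unfolding LE_def[symmetric] by (simp add: ereal_ln_def ereal_powr_def)
    then have "ln l powr \<alpha> < c1 / sqrt (real n)"
      using n elim(2) by (simp add: powr_half_sqrt pos_less_divide_eq mult.commute)
    then have "(ln l powr \<alpha>) powr (1 / \<alpha>) \<le> (c1 / sqrt (real n)) powr (1 / \<alpha>)"
      using \<alpha> by (intro powr_mono2) auto
    then have "ln l \<le> (c1 / sqrt (real n)) powr (1 / \<alpha>)"
      using \<alpha> l by (simp add: powr_powr)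
    then have l_le: "l \<le> exp ((c1 / sqrt (real n)) powr (1 / \<alpha>))"
      using l by (simp add: ln_le_cancel_iff[symmetric] del: ln_le_cancel_iff)
    show ?case
    proof (intro allI impI)
      fix j and x y :: "int \<Rightarrow> 's" assume eq: "\<forall>i\<ge>- int n. x i = y i"
      have "f j x \<le> l * f j y"
      proof (rule ratio_osc_le[where h="f j"])
        show "ratio_osc {- int n..} (f j) \<le> ereal l"
          unfolding l(1)[symmetric] LE_def by (rule SUP_upper) simp
      qed (use eq f_pos in auto)
      also have "\<dots> \<le> exp ((c1 / sqrt (real n)) powr (1 / \<alpha>)) * f j y"
        using l_le f_pos[of j y] by (intro mult_right_mono) auto
      finally show "f j x \<le> exp ((c1 / sqrt (real n)) powr (1 / \<alpha>)) * f j y" .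
    qed
  qed
  have "K1 * c1 < Gamma \<alpha>" using K1(2) c1_pos by (simp add: pos_less_divide_eq)
  then show thesis using that[OF _ c1_pos _ R_prod[OF K1(1)] L] K K1 by simp
qed

section \<open>The symbol at the origin in a finite volume\<close>

definition weight :: "nat \<Rightarrow> 's \<Rightarrow> (int \<Rightarrow> 's) \<Rightarrow> real" where
  "weight n a x = site_sum n 1 (\<lambda>u. \<Prod>j\<le>n. f j u) (x(0 := a))"

text \<open>The marginal at the origin of the finite-volume law on [0, n] with boundary condition x.
  Its limit in n is the transition probability \<open>g\<close> of the chain.\<close>

definition kernel :: "nat \<Rightarrow> 's \<Rightarrow> (int \<Rightarrow> 's) \<Rightarrow> real" where
  "kernel n a x = (\<Sum>y\<in>cyl (- {1..int n}) (x(0 := a)). \<phi> {0..int n} y)"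

lemma weight_pos: "0 < weight n a x"
  unfolding weight_def by (intro site_sum_pos prod_pos) (simp add: f_pos)

lemma kernel_eq: "kernel n a x = weight n a x / (\<Sum>b\<in>UNIV. weight n b x)"
proof -
  define P where "P u = (\<Prod>j\<le>n. f j u)" for u
  have set1: "{1..int n} = {int 1..<int (1 + n)}" and set0: "{0..int n} = {int 0..<int (0 + Suc n)}" by auto
  have Z: "(\<Sum>y\<in>cyl (- {0..int n}) x. P y) = (\<Sum>b\<in>UNIV. weight n b x)" for x
    unfolding set0 sum_cyl_eq_site_sum weight_def P_def[symmetric] by simp
  have "kernel n a x = (\<Sum>y\<in>cyl (- {1..int n}) (x(0 := a)). P y / (\<Sum>b\<in>UNIV. weight n b x))"
    unfolding kernel_def
  proof (rule sum.cong[OF refl])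
    fix y assume "y \<in> cyl (- {1..int n}) (x(0 := a))"
    then have upd: "y i = (x(0 := a)) i" if "i \<notin> {1..int n}" for i
      using that unfolding cyl_iff by blast
    have out: "y i = x i" if "i \<notin> {0..int n}" for i
      using upd[of i] that by auto
    have "cyl (- {0..int n}) y = cyl (- {0..int n}) x"
      unfolding set_eq_iff cyl_iff using out by (metis ComplD)
    then show "\<phi> {0..int n} y = P y / (\<Sum>b\<in>UNIV. weight n b x)"
      using seq_for Z[of x] by (simp add: specification_sequence_for_def P_def divide_inverse)
  qed
  also have "\<dots> = (\<Sum>y\<in>cyl (- {1..int n}) (x(0 := a)). P y) / (\<Sum>b\<in>UNIV. weight n b x)"
    by (simp add: sum_divide_distrib)
  also have "(\<Sum>y\<in>cyl (- {1..int n}) (x(0 := a)). P y) = weight n a x"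
    unfolding set1 sum_cyl_eq_site_sum weight_def P_def ..
  finally show ?thesis .
qed

lemma weight_odds:
  assumes L: "1 \<le> L" "\<And>j x y. (\<forall>i\<ge>- int n. x i = y i) \<Longrightarrow> f j x \<le> L * f j y"
    and eq: "\<And>i. - int n \<le> i \<Longrightarrow> i < 0 \<Longrightarrow> x i = x' i"
    and p_nonneg: "\<And>t. 1 \<le> t \<Longrightarrow> 0 \<le> p t"
  shows "(\<Sum>t=1..Suc N. p t * ((1 / L) ^ t * (v (Suc N) / v (Suc N - t))))\<^sup>2 * (weight N a x' * weight N b x)
    \<le> weight N b x' * weight N a x"
proof -
  define k where "k = Suc N"
  \<comment> \<open>Changing the left boundary costs L. Changing the right one costs R (k - 1 - j),
    since it affects factor j only beyond k - 1 = j + (k - 1 - j). The latter factors telescope to v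
    k / v (k - t).\<close>
  define lam where "lam j = 1 / (L * R (k - 1 - j))" for j
  have R_pos: "0 < R i" for i by (rule less_le_trans[OF zero_less_one R_ge])
  have L_pos: "0 < L" using L by simp
  have lam_le: "lam j * f j (overlay k y u) \<le> f j (overlay k y' u)"
    if eq: "\<And>i. - int n \<le> i \<Longrightarrow> i < 0 \<Longrightarrow> y i = y' i" and j: "j < k" for j y y' u
  proof -
    \<comment> \<open>An intermediate configuration with the new left boundary and the old right
      one.\<close>
    define w where "w = (\<lambda>i. if i < 0 then y' i else overlay k y u i)"
    have "f j (overlay k y u) \<le> L * f j w"
      by (rule L) (auto simp: w_def overlay_def eq)
    also have "f j w \<le> R (k - 1 - j) * f j (overlay k y' u)"
      using j by (intro f_osc) (auto simp: w_def overlay_def)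
    finally have "f j (overlay k y u) \<le> (L * R (k - 1 - j)) * f j (overlay k y' u)"
      using L_pos by (simp add: mult.assoc)
    then show ?thesis using L_pos R_pos by (simp add: lam_def pos_divide_le_eq mult.commute)
  qed
  interpret tb: two_boundaries k "\<lambda>j u. f j (overlay k x u)" "\<lambda>j u. f j (overlay k x' u)" R lam x v p
  proof
    show "v = (\<lambda>n. \<Prod>i<n. 1 / R i)" by (simp add: v_def fun_eq_iff)
    show "lam j * f j (overlay k x u) \<le> f j (overlay k x' u)" if "j < k" for j u
      using lam_le[of x x'] eq that by blast
    show "lam j * f j (overlay k x' u) \<le> f j (overlay k x u)" if "j < k" for j u
      using lam_le[of x' x] eq that by metis
    show "f j (overlay k x (u(int i := a))) = f j (overlay k x u)"
      "f j (overlay k x' (u(int i := a))) = f j (overlay k x' u)" if "i < j" for i j u a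
      using that by (auto intro!: f_local simp: overlay_def)
    show "f j (overlay k x u) \<le> R i * f j (overlay k x u')"
      "f j (overlay k x' u) \<le> R i * f j (overlay k x' u')"
      if "\<forall>l\<le>int (j + i). u' l = u l" for j i u u'
      using that by (auto intro!: f_osc simp: overlay_def)
  qed (use f_pos R_ge R_pos L_pos p_nonneg in \<open>auto simp: lam_def p_def intro!: divide_pos_pos mult_pos_pos\<close>)
  have v_pos: "0 < v m" for m by (rule tb.v_pos)
  have Lam: "tb.Lam t = (1 / L) ^ t * (v k / v (k - t))" if "t \<le> k" for t
    using that
  proof (induction t)
    case 0
    then show ?case using v_pos[of k] by (simp add: tb.Lam_def)
  next
    case (Suc t)
    define m where "m = k - 1 - t"
    have m: "k - t = Suc m" "k - Suc t = m" using Suc.prems by (simp_all add: m_def)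
    have "tb.Lam t = (1 / L) ^ t * (v k / (v m / R m))"
      using Suc by (simp add: m tb.v_Suc)
    moreover have "lam t = 1 / L * (1 / R m)" by (simp add: lam_def m_def)
    moreover have "R m \<noteq> 0" using R_pos[of m] by simp
    ultimately show ?case by (simp add: tb.Lam_Suc m(2))
  qed
  have tp: "tb.tail_prod 0 = (\<lambda>u. \<Prod>j\<le>N. f j (overlay k x u))"
    "tb.tail_prod' 0 = (\<lambda>u. \<Prod>j\<le>N. f j (overlay k x' u))"
    unfolding fun_eq_iff tb.tail_prod_def tb.tail_prod'_def
    by (simp_all add: k_def atLeast0LessThan lessThan_Suc_atMost)
  have W: "site_sum N 1 (\<lambda>u. \<Prod>j\<le>N. f j (overlay k y u)) (x(0 := c)) = weight N c y" for y c
  proof -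
    have "site_sum N 1 (\<lambda>u. \<Prod>j\<le>N. f j (overlay k y u)) (x(0 := c))
      = site_sum N 1 (\<lambda>u. \<Prod>j\<le>N. f j u) (overlay k y (x(0 := c)))"
      by (rule site_sum_overlay) (simp add: k_def)
    also have "\<dots> = weight N c y"
      unfolding weight_def by (rule site_sum_cong_boundary) (auto simp: overlay_def k_def)
    finally show ?thesis .
  qed
  have "tb.H c = weight N c x" "tb.H' c = weight N c x'" for c
    using W[of x c] W[of x' c] unfolding tb.H_def tb.H'_def tp by (simp_all add: k_def)
  moreover have "(\<Sum>t=1..k. p t * tb.Lam t) = (\<Sum>t=1..k. p t * ((1 / L) ^ t * (v k / v (k - t))))"
    by (intro sum.cong) (auto simp: Lam)
  ultimately show ?thesis using tb.odds_ratio_bound[of a b] by (simp add: k_def)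
qed

text \<open>The bound on the odds of a against b has the same constant for every b; summing over b
  turns it into a bound on probabilities.\<close>

theorem kernel_ratio:
  "\<exists>c. 0 < c \<and> c < 1 \<and> (\<forall>\<^sub>F n in sequentially. \<forall>\<^sub>F N in sequentially. \<forall>x x' a.
     (\<forall>i. - int n \<le> i \<and> i < 0 \<longrightarrow> x i = x' i) \<longrightarrow> (1 - c / sqrt (real n))\<^sup>2 * kernel N a x' \<le> kernel N a x)"
proof -
  obtain K1 c1 where K1: "0 < K1" and c1: "0 < c1" "K1 * c1 < Gamma \<alpha>"
    and RP: "\<forall>\<^sub>F n in sequentially. real n powr (\<alpha> - 1) * (\<Prod>i\<le>n. R i) \<le> K1"
    and L: "\<forall>\<^sub>F n in sequentially. \<forall>j x y. (\<forall>i\<ge>- int n. x i = y i) \<longrightarrow>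
       f j x \<le> exp ((c1 / sqrt (real n)) powr (1 / \<alpha>)) * f j y"
    by (rule constants)
  have v_eq: "v = (\<lambda>n. \<Prod>i<n. 1 / R i)" by (simp add: v_def fun_eq_iff)
  note asym = renewal_asymptotics[OF \<alpha> K1 c1 R_ge R_dec RP v_eq p_def]
  obtain c where c: "0 < c" "c < 1" and ev: "\<forall>\<^sub>F n in sequentially. \<forall>\<^sub>F k in sequentially.
      1 - c / sqrt (real n) < (\<Sum>t=1..k. p t * (exp (- ((c1 / sqrt (real n)) powr (1 / \<alpha>))) ^ t * (v k / v (k - t))))"
    using asym(2) by blast
  have "\<forall>\<^sub>F n in sequentially. \<forall>\<^sub>F N in sequentially. \<forall>x x' a.
     (\<forall>i. - int n \<le> i \<and> i < 0 \<longrightarrow> x i = x' i) \<longrightarrow> (1 - c / sqrt (real n))\<^sup>2 * kernel N a x' \<le> kernel N a x"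
    using ev L eventually_gt_at_top[of 0]
  proof eventually_elim
    case (elim n)
    note Lbound = elim(2)
    define e where "e = exp ((c1 / sqrt (real n)) powr (1 / \<alpha>))"
    have e1: "1 \<le> e" by (simp add: e_def)
    have e_inv: "exp (- ((c1 / sqrt (real n)) powr (1 / \<alpha>))) = 1 / e"
      by (simp add: e_def exp_minus divide_inverse)
    have "1 \<le> sqrt (real n)" using elim(3) by simp
    then have "c \<le> sqrt (real n)" using c by linarith
    then have c_le: "0 \<le> 1 - c / sqrt (real n)" using c by (simp add: divide_le_eq)
    have "\<forall>\<^sub>F N in sequentially. 1 - c / sqrt (real n)
        < (\<Sum>t=1..Suc N. p t * ((1 / e) ^ t * (v (Suc N) / v (Suc N - t))))"
      using elim(1) unfolding e_inv by (subst eventually_sequentially_Suc)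
    then show ?case
    proof eventually_elim
      case (elim N)
      show ?case
      proof (intro allI impI)
        fix x x' :: "int \<Rightarrow> 's" and a
        assume eq: "\<forall>i. - int n \<le> i \<and> i < 0 \<longrightarrow> x i = x' i"
        define \<kappa> where "\<kappa> = (1 - c / sqrt (real n))\<^sup>2"
        define S where "S = (\<Sum>b\<in>UNIV. weight N b x)"
        define S' where "S' = (\<Sum>b\<in>UNIV. weight N b x')"
        have S: "0 < S" "0 < S'"
          unfolding S_def S'_def by (intro sum_pos weight_pos; simp)+
        have "\<kappa> * (weight N a x' * weight N b x) \<le> weight N b x' * weight N a x" for b
        proof -
          have "\<kappa> \<le> (\<Sum>t=1..Suc N. p t * ((1 / e) ^ t * (v (Suc N) / v (Suc N - t))))\<^sup>2"
            unfolding \<kappa>_def using elim c_le by (intro power_mono) auto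
          then have "\<kappa> * (weight N a x' * weight N b x)
            \<le> (\<Sum>t=1..Suc N. p t * ((1 / e) ^ t * (v (Suc N) / v (Suc N - t))))\<^sup>2 * (weight N a x' * weight N b x)"
            using weight_pos[of N a x'] weight_pos[of N b x] by (intro mult_right_mono) auto
          also have "\<dots> \<le> weight N b x' * weight N a x"
            by (rule weight_odds[where n=n, OF e1]) (use Lbound eq asym(1) in \<open>auto simp: e_def\<close>)
          finally show ?thesis .
        qed
        then have "(\<Sum>b\<in>UNIV. \<kappa> * (weight N a x' * weight N b x)) \<le> (\<Sum>b\<in>UNIV. weight N b x' * weight N a x)"
          by (rule sum_mono)
        then have "\<kappa> * (weight N a x' * S) \<le> S' * weight N a x"
          by (simp add: S_def S'_def sum_distrib_left sum_distrib_right)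
        then have "\<kappa> * (weight N a x' / S') \<le> weight N a x / S"
          using S by (simp add: field_simps)
        then show "(1 - c / sqrt (real n))\<^sup>2 * kernel N a x' \<le> kernel N a x"
          by (simp add: kernel_eq \<kappa>_def S_def S'_def)
      qed
    qed
  qed
  then show ?thesis using c by blast
qed

end

section \<open>The one-sided kernel\<close>

lemma compact_configurations: "compact (UNIV :: (int \<Rightarrow> 's::{finite, discrete_topology}) set)"
proof -
  have "compact_space (euclidean :: 's topology)"
    by (simp add: compact_space_def compactin_euclidean_iff finite_imp_compact)
  then have "compact_space (product_topology (\<lambda>_. euclidean :: 's topology) (UNIV :: int set))"
    by (simp add: compact_space_product_topology del: euclidean_product_topology)
  then show ?thesis
    by (simp add: euclidean_product_topology compact_space_def compactin_euclidean_iff)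
qed

text \<open>The expectation of F, given the coordinates outside \<Lambda>, that the specification
  prescribes.\<close>

definition spec_avg ::
  "(int set \<Rightarrow> (int \<Rightarrow> 's) \<Rightarrow> real) \<Rightarrow> int set \<Rightarrow> ((int \<Rightarrow> 's) \<Rightarrow> real) \<Rightarrow> (int \<Rightarrow> 's) \<Rightarrow> real" where
  "spec_avg \<phi> \<Lambda> F x = (\<Sum>y\<in>cyl (- \<Lambda>) x. \<phi> \<Lambda> y * F y)"

lemma spec_avg_mono:
  assumes "is_specification \<phi>" "finite \<Lambda>" "\<Lambda> \<noteq> {}" "\<And>y. y \<in> cyl (- \<Lambda>) x \<Longrightarrow> F y \<le> G y"
  shows "spec_avg \<phi> \<Lambda> F x \<le> spec_avg \<phi> \<Lambda> G x"
  unfolding spec_avg_def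
  using assms by (intro sum_mono mult_left_mono) (auto simp: is_specification_def)

lemma spec_avg_const:
  assumes "is_specification \<phi>" "finite \<Lambda>" "\<Lambda> \<noteq> {}"
  shows "spec_avg \<phi> \<Lambda> (\<lambda>_. c) x = c"
  unfolding spec_avg_def sum_distrib_right[symmetric]
  using assms by (simp add: is_specification_def)

lemma spec_avg_cmult: "spec_avg \<phi> \<Lambda> (\<lambda>y. c * F y) x = c * spec_avg \<phi> \<Lambda> F x"
  by (simp add: spec_avg_def sum_distrib_left mult_ac)

lemma spec_avg_bounds:
  assumes "is_specification \<phi>" "finite \<Lambda>" "\<Lambda> \<noteq> {}" "\<And>y. y \<in> cyl (- \<Lambda>) x \<Longrightarrow> l \<le> F y \<and> F y \<le> u"
  shows "l \<le> spec_avg \<phi> \<Lambda> F x \<and> spec_avg \<phi> \<Lambda> F x \<le> u"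
  using spec_avg_mono[OF assms(1-3), of x "\<lambda>_. l" F] spec_avg_mono[OF assms(1-3), of x F "\<lambda>_. u"]
    spec_avg_const[OF assms(1-3)] assms(4) by auto

text \<open>After exchanging the sums, \<phi> \<Lambda> y enters only through its sum over the y
  that agree with u off K, and the consistency condition turns \<phi> K u times this sum into \<phi>
  \<Lambda> u.\<close>

lemma spec_avg_tower:
  assumes spec: "is_specification \<phi>" and \<Lambda>: "finite \<Lambda>" and K: "K \<noteq> {}" "K \<subseteq> \<Lambda>"
  shows "spec_avg \<phi> \<Lambda> (spec_avg \<phi> K F) x = spec_avg \<phi> \<Lambda> F x"
proof -
  define C where "C = cyl (- \<Lambda>) x"
  have fin: "finite C" unfolding C_def by (rule finite_cyl[OF \<Lambda>])
  have eq1: "cyl (- K) y = {u \<in> C. u \<in> cyl (- K) y}" if "y \<in> C" for y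
    using that K(2) unfolding C_def by (auto simp: cyl_iff) (metis ComplI subsetD)
  have eq2: "cyl (- K) u = {y \<in> C. u \<in> cyl (- K) y}" if "u \<in> C" for u
    using that K(2) unfolding C_def by (auto simp: cyl_iff) (metis ComplI subsetD)
  have "spec_avg \<phi> \<Lambda> (spec_avg \<phi> K F) x = (\<Sum>y\<in>C. \<Sum>u\<in>{u \<in> C. u \<in> cyl (- K) y}. \<phi> \<Lambda> y * (\<phi> K u * F u))"
    unfolding spec_avg_def C_def[symmetric] sum_distrib_left
    by (intro sum.cong refl) (simp add: eq1[symmetric])
  also have "\<dots> = (\<Sum>u\<in>C. \<Sum>y\<in>{y \<in> C. u \<in> cyl (- K) y}. \<phi> \<Lambda> y * (\<phi> K u * F u))"
    by (rule sum.swap_restrict[OF fin fin])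
  also have "\<dots> = (\<Sum>u\<in>C. \<phi> \<Lambda> u * F u)"
  proof (rule sum.cong[OF refl])
    fix u assume "u \<in> C"
    then have "(\<Sum>y\<in>{y \<in> C. u \<in> cyl (- K) y}. \<phi> \<Lambda> y * (\<phi> K u * F u))
        = (\<phi> K u * (\<Sum>y\<in>cyl (- K) u. \<phi> \<Lambda> y)) * F u"
      by (simp add: eq2[symmetric] sum_distrib_right sum_distrib_left mult_ac)
    also have "\<phi> K u * (\<Sum>y\<in>cyl (- K) u. \<phi> \<Lambda> y) = \<phi> \<Lambda> u"
    proof -
      have "\<Lambda> \<noteq> {}" using K by auto
      then show ?thesis using spec \<Lambda> K unfolding is_specification_def by metis
    qed
    finally show "(\<Sum>y\<in>{y \<in> C. u \<in> cyl (- K) y}. \<phi> \<Lambda> y * (\<phi> K u * F u)) = \<phi> \<Lambda> u * F u" .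
  qed
  finally show ?thesis by (simp add: spec_avg_def C_def)
qed

context decaying_specification
begin

lemma spec_avg_insert_0:
  "spec_avg \<phi> {0..int N} F x = (\<Sum>a\<in>UNIV. \<Sum>y\<in>cyl (- {1..int N}) (x(0 := a)). \<phi> {0..int N} y * F y)"
proof -
  have "{0..int N} = insert 0 {1..int N}" by auto
  then have "spec_avg \<phi> {0..int N} F x
    = (\<Sum>y\<in>cyl (- insert 0 {1..int N}) x. \<phi> {0..int N} y * F y)"
    by (simp add: spec_avg_def)
  also have "\<dots> = (\<Sum>a\<in>UNIV. \<Sum>y\<in>cyl (- {1..int N}) (x(0 := a)). \<phi> {0..int N} y * F y)"
    by (rule sum_cyl_insert) auto
  finally show ?thesis .
qed

lemma spec_avg_past:
  assumes "\<And>y y'. (\<And>i. i \<le> 0 \<Longrightarrow> y i = y' i) \<Longrightarrow> F y = F y'"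
  shows "spec_avg \<phi> {0..int N} F x = (\<Sum>a\<in>UNIV. kernel N a x * F (x(0 := a)))"
  unfolding spec_avg_insert_0
proof (rule sum.cong[OF refl])
  fix a
  have "F y = F (x(0 := a))" if "y \<in> cyl (- {1..int N}) (x(0 := a))" for y
  proof (rule assms)
    fix i :: int assume "i \<le> 0"
    then have "i \<in> - {1..int N}" by simp
    then show "y i = (x(0 := a)) i" using that unfolding cyl_iff by blast
  qed
  then show "(\<Sum>y\<in>cyl (- {1..int N}) (x(0 := a)). \<phi> {0..int N} y * F y) = kernel N a x * F (x(0 := a))"
    unfolding kernel_def sum_distrib_right by (intro sum.cong) auto
qed

lemma kernel_eq_spec_avg: "kernel N a x = spec_avg \<phi> {0..int N} (\<lambda>y. if y 0 = a then 1 else 0) x"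
  by (subst spec_avg_past) (auto simp: if_distrib cong: if_cong)

lemma kernel_sum: "(\<Sum>a\<in>UNIV. kernel N a x) = 1"
  using spec_avg_past[of "\<lambda>_. 1" N x] spec_avg_const[OF spec, of "{0..int N}" 1 x] by simp

lemma kernel_bounds: "0 \<le> kernel N a x" "kernel N a x \<le> 1"
proof -
  show nonneg: "0 \<le> kernel N a x" for a
    using spec unfolding kernel_def is_specification_def by (intro sum_nonneg) auto
  have "kernel N a x \<le> (\<Sum>b\<in>UNIV. kernel N b x)"
    using nonneg by (intro member_le_sum) simp_all
  then show "kernel N a x \<le> 1" by (simp add: kernel_sum)
qed

lemma kernel_tower:
  assumes "N \<le> N'"
  shows "kernel N' a x = spec_avg \<phi> {0..int N'} (kernel N a) x"
  using spec_avg_tower[OF spec, of "{0..int N'}" "{0..int N}"] assms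
  by (simp add: kernel_eq_spec_avg[abs_def])

text \<open>By consistency \<open>kernel N a\<close> is an average of \<open>kernel 0 a\<close>,
  whose values are values of \<phi> {0}, a positive continuous function on a compact space.\<close>

lemma kernel_lower_bound: "\<exists>\<delta>>0. \<forall>N a x. \<delta> \<le> kernel N a x"
proof -
  have "continuous_on UNIV (\<phi> {0})" using cont by (simp add: continuous_spec_def)
  then obtain x0 where x0: "\<And>y. \<phi> {0} x0 \<le> \<phi> {0} y"
    using continuous_attains_inf[OF compact_configurations] by blast
  have "0 < \<phi> {0} x0" using pos by (simp add: positive_spec_def)
  moreover have "\<phi> {0} x0 \<le> kernel N a x" for N a x
  proof -
    have "kernel 0 a y = \<phi> {0} (y(0 := a))" for y
      using cyl_empty_compl[of "y(0 := a)"] by (simp add: kernel_def)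
    then have "\<phi> {0} x0 \<le> kernel 0 a y \<and> kernel 0 a y \<le> 1" for y
      using x0 kernel_bounds[of 0 a y] by simp
    then have "\<phi> {0} x0 \<le> spec_avg \<phi> {0..int N} (kernel 0 a) x"
      using spec_avg_bounds[OF spec, of "{0..int N}" x "\<phi> {0} x0" "kernel 0 a" 1] by simp
    then show ?thesis using kernel_tower[of 0 N a x] by simp
  qed
  ultimately show ?thesis by blast
qed

definition g :: "'s \<Rightarrow> (int \<Rightarrow> 's) \<Rightarrow> real" where
  "g a x = lim (\<lambda>N. kernel N a x)"

text \<open>For N' \<ge> N, kernel N' averages kernel N over configurations that share the whole
  past of x. So \<open>kernel_ratio\<close> applies with any large n, and n is chosen to bring the
  ratio close to 1.\<close>

lemma kernel_tendsto: "(\<lambda>N. kernel N a x) \<longlonglongrightarrow> g a x"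
proof -
  obtain c where c: "0 < c" "c < 1" and ev: "\<forall>\<^sub>F n in sequentially. \<forall>\<^sub>F N in sequentially. \<forall>x x' a.
     (\<forall>i. - int n \<le> i \<and> i < 0 \<longrightarrow> x i = x' i) \<longrightarrow> (1 - c / sqrt (real n))\<^sup>2 * kernel N a x' \<le> kernel N a x"
    using kernel_ratio by blast
  have "Cauchy (\<lambda>N. kernel N a x)"
    unfolding Cauchy_altdef2
  proof (intro allI impI)
    fix e :: real assume e: "0 < e"
    have "(\<lambda>n. (1 - c / sqrt (real n))\<^sup>2) \<longlonglongrightarrow> (1 - 0)\<^sup>2"
      by (intro tendsto_intros real_tendsto_divide_at_top[where c=c]
          filterlim_compose[OF sqrt_at_top filterlim_real_sequentially])
    then have "\<forall>\<^sub>F n in sequentially. max (1 / 2) (1 - e / 2) < (1 - c / sqrt (real n))\<^sup>2"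
      using e by (intro order_tendstoD) auto
    with ev have "\<forall>\<^sub>F n in sequentially. max (1 / 2) (1 - e / 2) < (1 - c / sqrt (real n))\<^sup>2 \<and>
      (\<forall>\<^sub>F N in sequentially. \<forall>x x' a.
     (\<forall>i. - int n \<le> i \<and> i < 0 \<longrightarrow> x i = x' i) \<longrightarrow> (1 - c / sqrt (real n))\<^sup>2 * kernel N a x' \<le> kernel N a x)"
      by eventually_elim blast
    then obtain n where n: "max (1 / 2) (1 - e / 2) < (1 - c / sqrt (real n))\<^sup>2"
      and evN: "\<forall>\<^sub>F N in sequentially. \<forall>x x' a.
     (\<forall>i. - int n \<le> i \<and> i < 0 \<longrightarrow> x i = x' i) \<longrightarrow> (1 - c / sqrt (real n))\<^sup>2 * kernel N a x' \<le> kernel N a x"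
      using eventually_happens'[OF sequentially_bot] by blast
    define r where "r = (1 - c / sqrt (real n))\<^sup>2"
    have r: "1 / 2 < r" "1 - e / 2 < r" using n by (simp_all add: r_def)
    obtain N where N: "\<And>x x' a.
     (\<forall>i. - int n \<le> i \<and> i < 0 \<longrightarrow> x i = x' i) \<Longrightarrow> r * kernel N a x' \<le> kernel N a x"
      using eventually_happens'[OF sequentially_bot evN] unfolding r_def by blast
    have "\<bar>kernel N' a x - kernel N a x\<bar> < e" if N': "N \<le> N'" for N'
    proof -
      have "r * kernel N a x \<le> kernel N a y \<and> kernel N a y \<le> 1 / r * kernel N a x"
        if "y \<in> cyl (- {0..int N'}) x" for y
      proof -
        have "\<forall>i. - int n \<le> i \<and> i < 0 \<longrightarrow> x i = y i" "\<forall>i. - int n \<le> i \<and> i < 0 \<longrightarrow> y i = x i"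
          using that by (auto simp: cyl_iff)
        then have "r * kernel N a x \<le> kernel N a y" "r * kernel N a y \<le> kernel N a x"
          using N by blast+
        then show ?thesis using r by (simp add: field_simps)
      qed
      then have "r * kernel N a x \<le> kernel N' a x \<and> kernel N' a x \<le> 1 / r * kernel N a x"
        unfolding kernel_tower[OF N'] by (intro spec_avg_bounds[OF spec]) auto
      then have lo: "r * kernel N a x \<le> kernel N' a x" and hi: "r * kernel N' a x \<le> kernel N a x"
        using r by (auto simp: field_simps)
      obtain \<delta> where "0 < \<delta>" "\<delta> \<le> kernel N a x" using kernel_lower_bound by blast
      then have "0 < kernel N a x" by linarith
      then have r1: "r \<le> 1" using N[of x x a] by simp
      have "kernel N' a x - kernel N a x \<le> (1 - r) * kernel N' a x" using hi by (simp add: left_diff_distrib)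
      also have "\<dots> \<le> (1 - r) * 1" using r1 kernel_bounds by (intro mult_left_mono) auto
      finally have 1: "kernel N' a x - kernel N a x \<le> 1 - r" by simp
      have "kernel N a x - kernel N' a x \<le> (1 - r) * kernel N a x" using lo by (simp add: left_diff_distrib)
      also have "\<dots> \<le> (1 - r) * 1" using r1 kernel_bounds by (intro mult_left_mono) auto
      finally have "kernel N a x - kernel N' a x \<le> 1 - r" by simp
      then show ?thesis using 1 r(2) e by linarith
    qed
    then show "\<exists>N. \<forall>n\<ge>N. dist (kernel n a x) (kernel N a x) < e"
      by (auto simp: dist_real_def)
  qed
  then have "convergent (\<lambda>N. kernel N a x)" by (rule Cauchy_convergent)
  then show ?thesis unfolding g_def by (simp add: convergent_LIMSEQ_iff)
qed

lemma g_sum: "(\<Sum>a\<in>UNIV. g a x) = 1"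
proof -
  have "(\<lambda>N. \<Sum>a\<in>UNIV. kernel N a x) \<longlonglongrightarrow> (\<Sum>a\<in>UNIV. g a x)"
    by (intro tendsto_sum kernel_tendsto)
  then show ?thesis by (simp add: kernel_sum LIMSEQ_const_iff)
qed

lemma g_lower_bound: "\<exists>\<delta>>0. \<forall>a x. \<delta> \<le> g a x"
proof -
  obtain \<delta> where "0 < \<delta>" "\<And>N a x. \<delta> \<le> kernel N a x" using kernel_lower_bound by blast
  then show ?thesis using LIMSEQ_le_const[OF kernel_tendsto] by blast
qed

lemma g_ratio:
  "\<exists>c n0. 0 < c \<and> c < 1 \<and> (\<forall>n\<ge>n0. \<forall>x x' a.
     (\<forall>i. - int n \<le> i \<and> i < 0 \<longrightarrow> x i = x' i) \<longrightarrow> (1 - c / sqrt (real n))\<^sup>2 * g a x' \<le> g a x)"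
proof -
  obtain c where c: "0 < c" "c < 1" and ev: "\<forall>\<^sub>F n in sequentially. \<forall>\<^sub>F N in sequentially. \<forall>x x' a.
     (\<forall>i. - int n \<le> i \<and> i < 0 \<longrightarrow> x i = x' i) \<longrightarrow> (1 - c / sqrt (real n))\<^sup>2 * kernel N a x' \<le> kernel N a x"
    using kernel_ratio by blast
  from ev have "\<forall>\<^sub>F n in sequentially. \<forall>x x' a.
     (\<forall>i. - int n \<le> i \<and> i < 0 \<longrightarrow> x i = x' i) \<longrightarrow> (1 - c / sqrt (real n))\<^sup>2 * g a x' \<le> g a x"
  proof eventually_elim
    case (elim n)
    show ?case
    proof (intro allI impI)
      fix x x' :: "int \<Rightarrow> 's" and a assume eq: "\<forall>i. - int n \<le> i \<and> i < 0 \<longrightarrow> x i = x' i"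
      have "\<forall>\<^sub>F N in sequentially. (1 - c / sqrt (real n))\<^sup>2 * kernel N a x' \<le> kernel N a x"
        using elim by eventually_elim (use eq in blast)
      then show "(1 - c / sqrt (real n))\<^sup>2 * g a x' \<le> g a x"
        by (intro tendsto_le[OF _ kernel_tendsto tendsto_mult_left[OF kernel_tendsto]]) auto
    qed
  qed
  then show ?thesis using c by (auto simp: eventually_sequentially)
qed

end

section \<open>Chains with infinite memory\<close>

text \<open>The maximal coupling: the common mass min (P s) (P' s) contributes at most U, and the
  two remainders, of equal mass, at most V, as is seen by comparing both with the maximum of h.
  Since U \<le> V, a lower bound for the common mass suffices.\<close>

lemma coupled_sum_diff_le:
  fixes P P' h h' :: "'i \<Rightarrow> real"
  assumes fin: "finite A" "A \<noteq> {}"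
    and P: "\<And>s. s \<in> A \<Longrightarrow> 0 \<le> P s" "(\<Sum>s\<in>A. P s) = 1"
    and P': "\<And>s. s \<in> A \<Longrightarrow> 0 \<le> P' s" "(\<Sum>s\<in>A. P' s) = 1"
    and q: "q \<le> (\<Sum>s\<in>A. min (P s) (P' s))"
    and U: "\<And>s. s \<in> A \<Longrightarrow> h s - h' s \<le> U"
    and V: "\<And>s t. s \<in> A \<Longrightarrow> t \<in> A \<Longrightarrow> h s - h' t \<le> V" and UV: "U \<le> V"
  shows "(\<Sum>s\<in>A. P s * h s) - (\<Sum>s\<in>A. P' s * h' s) \<le> q * U + (1 - q) * V"
proof -
  define m where "m s = min (P s) (P' s)" for s
  define c where "c = (\<Sum>s\<in>A. m s)"
  define H where "H = Max (h ` A)"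
  have h_le: "h s \<le> H" if "s \<in> A" for s using that fin by (simp add: H_def)
  have "H \<in> h ` A" unfolding H_def using fin by (intro Max_in) auto
  then obtain s0 where s0: "s0 \<in> A" "H = h s0" by blast
  have h'_ge: "H - V \<le> h' t" if "t \<in> A" for t using V[OF s0(1) that] s0(2) by simp
  have "(\<Sum>s\<in>A. P s * h s) - (\<Sum>s\<in>A. P' s * h' s)
     = (\<Sum>s\<in>A. m s * (h s - h' s)) + (\<Sum>s\<in>A. (P s - m s) * h s) - (\<Sum>s\<in>A. (P' s - m s) * h' s)"
    by (simp add: sum.distrib[symmetric] sum_subtractf[symmetric] algebra_simps)
  also have "\<dots> \<le> (\<Sum>s\<in>A. m s * U) + (\<Sum>s\<in>A. (P s - m s) * H) - (\<Sum>s\<in>A. (P' s - m s) * (H - V))"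
    using U h_le h'_ge P(1) P'(1)
    by (intro diff_mono add_mono sum_mono mult_left_mono) (auto simp: m_def)
  also have "\<dots> = c * U + (1 - c) * H - (1 - c) * (H - V)"
    by (simp add: sum_distrib_right[symmetric] sum_subtractf P(2) P'(2) c_def)
  also have "\<dots> = c * U + (1 - c) * V" by (simp add: algebra_simps)
  also have "\<dots> \<le> q * U + (1 - q) * V"
  proof -
    have "0 \<le> (c - q) * (V - U)" using q UV by (intro mult_nonneg_nonneg) (auto simp: c_def m_def)
    then show ?thesis by (simp add: algebra_simps)
  qed
  finally show ?thesis .
qed

text \<open>Factor sqrt (P * P') into the roots of the minimum and the maximum and apply
  Cauchy-Schwarz; the maxima have sum at most 2.\<close>

lemma overlap_ge_hellinger:
  fixes P P' :: "'i \<Rightarrow> real"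
  assumes P: "\<And>s. s \<in> A \<Longrightarrow> 0 \<le> P s" "(\<Sum>s\<in>A. P s) = 1"
    and P': "\<And>s. s \<in> A \<Longrightarrow> 0 \<le> P' s" "(\<Sum>s\<in>A. P' s) = 1"
  shows "(\<Sum>s\<in>A. sqrt (P s * P' s))\<^sup>2 / 2 \<le> (\<Sum>s\<in>A. min (P s) (P' s))"
proof -
  have "(\<Sum>s\<in>A. sqrt (P s * P' s))\<^sup>2 = (\<Sum>s\<in>A. sqrt (min (P s) (P' s)) * sqrt (max (P s) (P' s)))\<^sup>2"
    by (intro arg_cong[where f="\<lambda>z. z\<^sup>2"] sum.cong refl)
      (auto simp: real_sqrt_mult[symmetric] min_def max_def mult.commute)
  also have "\<dots> \<le> (\<Sum>s\<in>A. (sqrt (min (P s) (P' s)))\<^sup>2) * (\<Sum>s\<in>A. (sqrt (max (P s) (P' s)))\<^sup>2)"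
    by (rule Cauchy_Schwarz_ineq_sum)
  also have "\<dots> = (\<Sum>s\<in>A. min (P s) (P' s)) * (\<Sum>s\<in>A. max (P s) (P' s))"
    using P(1) P'(1) by (intro arg_cong2[where f="(*)"] sum.cong refl) (auto simp: le_max_iff_disj)
  also have "\<dots> \<le> (\<Sum>s\<in>A. min (P s) (P' s)) * (\<Sum>s\<in>A. P s + P' s)"
    using P(1) P'(1) by (intro mult_left_mono sum_mono sum_nonneg) auto
  finally show ?thesis by (simp add: sum.distrib P(2) P'(2))
qed

section \<open>Trajectories of the chain\<close>

definition agree :: "nat \<Rightarrow> (int \<Rightarrow> 's) \<Rightarrow> (int \<Rightarrow> 's) \<Rightarrow> bool" where
  "agree n x y \<longleftrightarrow> (\<forall>i. - int n \<le> i \<and> i < 0 \<longrightarrow> x i = y i)"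

text \<open>The new symbol ends up at site -1, so that the past always occupies the negative sites;
  the other sites merely travel along.\<close>

definition push :: "'s \<Rightarrow> (int \<Rightarrow> 's) \<Rightarrow> (int \<Rightarrow> 's)" where
  "push a x = shift (x(0 := a))"

lemma agree_push: "agree n x y \<Longrightarrow> agree (Suc n) (push a x) (push a y)"
  by (auto simp: agree_def push_def shift_def)

lemma agree_0: "agree 0 x y"
  by (auto simp: agree_def)

lemma agree_mono: "agree n x y \<Longrightarrow> m \<le> n \<Longrightarrow> agree m x y"
  by (auto simp: agree_def)

lemma agree_sym: "agree n x y \<Longrightarrow> agree n y x"
  by (auto simp: agree_def)

primrec path_end :: "'s list \<Rightarrow> (int \<Rightarrow> 's) \<Rightarrow> (int \<Rightarrow> 's)" where
  "path_end [] x = x"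
| "path_end (a # s) x = path_end s (push a x)"

lemma agree_path_end: "agree n x y \<Longrightarrow> agree (n + length s) (path_end s x) (path_end s y)"
proof (induction s arbitrary: n x y)
  case (Cons a s)
  then show ?case using Cons.IH[OF agree_push[OF Cons.prems]] by simp
qed simp

abbreviation words :: "nat \<Rightarrow> 's list set" where
  "words m \<equiv> {s. length s = m}"

lemma finite_words: "finite (words m :: 's::finite list set)"
  using finite_lists_length_eq[of "UNIV :: 's set" m] by simp

lemma words_nonempty: "words m \<noteq> {}"
  using Ex_list_of_length by auto

lemma sum_words_Suc:
  fixes h :: "'s::finite list \<Rightarrow> real"
  shows "(\<Sum>s\<in>words (Suc m). h s) = (\<Sum>a\<in>UNIV. \<Sum>s\<in>words m. h (a # s))"
proof -
  have "(\<Sum>a\<in>UNIV. \<Sum>s\<in>words m. h (a # s)) = (\<Sum>(a, s)\<in>UNIV \<times> words m. h (a # s))"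
    by (rule sum.cartesian_product)
  also have "\<dots> = (\<Sum>s\<in>words (Suc m). h s)"
    by (rule sum.reindex_bij_witness[of _ "\<lambda>s. (hd s, tl s)" "\<lambda>(a, s). a # s"])
      (auto simp: length_Suc_conv)
  finally show ?thesis by simp
qed

text \<open>\<open>g a x\<close> is the probability that the next symbol is \<open>a\<close>, given the past \<open>x\<close>.\<close>

locale past_chain =
  fixes g :: "'s::finite \<Rightarrow> (int \<Rightarrow> 's) \<Rightarrow> real" and c \<delta> :: real and n0 :: nat
  assumes g_sum: "\<And>x. (\<Sum>a\<in>UNIV. g a x) = 1"
    and \<delta>: "0 < \<delta>" and g_ge: "\<And>a x. \<delta> \<le> g a x"
    and c: "0 < c" "c < 1"
    and g_ratio: "\<And>n x y a. n0 \<le> n \<Longrightarrow> agree n x y \<Longrightarrow> (1 - c / sqrt (real n))\<^sup>2 * g a y \<le> g a x"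
begin

lemma g_pos: "0 < g a x" using \<delta> g_ge by (rule less_le_trans)

primrec path_prob :: "'s list \<Rightarrow> (int \<Rightarrow> 's) \<Rightarrow> real" where
  "path_prob [] x = 1"
| "path_prob (a # s) x = g a x * path_prob s (push a x)"

lemma path_prob_pos: "0 < path_prob s x"
  by (induction s arbitrary: x) (auto intro: mult_pos_pos g_pos)

lemma path_prob_sum: "(\<Sum>s\<in>words m. path_prob s x) = 1"
proof (induction m arbitrary: x)
  case (Suc m)
  then show ?case by (simp add: sum_words_Suc sum_distrib_left[symmetric] g_sum)
qed simp

lemma path_prob_ge: "\<delta> ^ length s \<le> path_prob s x"
  using \<delta> by (induction s arbitrary: x) (auto intro!: mult_mono g_ge less_imp_le[OF path_prob_pos] less_imp_le[OF g_pos])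

definition step :: "((int \<Rightarrow> 's) \<Rightarrow> real) \<Rightarrow> (int \<Rightarrow> 's) \<Rightarrow> real" where
  "step F x = (\<Sum>a\<in>UNIV. g a x * F (push a x))"

text \<open>The expected sum of F over the first T states of the chain, the starting point x
  included.\<close>

primrec total :: "nat \<Rightarrow> ((int \<Rightarrow> 's) \<Rightarrow> real) \<Rightarrow> (int \<Rightarrow> 's) \<Rightarrow> real" where
  "total 0 F = (\<lambda>x. 0)"
| "total (Suc T) F = (\<lambda>x. F x + step (total T F) x)"

text \<open>The end state of the path is left out, so that \<open>total_split\<close> counts each
  state once.\<close>

primrec run :: "((int \<Rightarrow> 's) \<Rightarrow> real) \<Rightarrow> 's list \<Rightarrow> (int \<Rightarrow> 's) \<Rightarrow> real" where
  "run F [] x = 0"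
| "run F (a # s) x = F x + run F s (push a x)"

text \<open>The Markov property at time m.\<close>

lemma total_split:
  "total (m + T) F x = (\<Sum>s\<in>words m. path_prob s x * (run F s x + total T F (path_end s x)))"
proof (induction m arbitrary: x)
  case (Suc m)
  have "total (Suc m + T) F x = F x + (\<Sum>a\<in>UNIV. g a x * total (m + T) F (push a x))"
    by (simp add: step_def)
  also have "\<dots> = (\<Sum>a\<in>UNIV. g a x * (F x + total (m + T) F (push a x)))"
    by (simp add: distrib_left sum.distrib sum_distrib_right[symmetric] g_sum)
  also have "\<dots> = (\<Sum>a\<in>UNIV. g a x * (\<Sum>s\<in>words m. path_prob s (push a x) *
      (F x + (run F s (push a x) + total T F (path_end s (push a x))))))"
    by (simp add: Suc.IH distrib_left sum.distrib sum_distrib_right[symmetric] path_prob_sum)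
  also have "\<dots> = (\<Sum>s\<in>words (Suc m). path_prob s x * (run F s x + total T F (path_end s x)))"
    by (simp add: sum_words_Suc sum_distrib_left mult.assoc add.assoc)
  finally show ?case .
qed simp

lemma step_diff_le:
  assumes "\<And>u w. F u - F w \<le> D"
  shows "step F x - step F y \<le> D"
proof -
  have "D \<ge> 0" using assms[of undefined undefined] by simp
  have "0 \<le> (\<Sum>a\<in>UNIV. min (g a x) (g a y))"
    by (intro sum_nonneg) (simp add: g_pos less_imp_le)
  then have "(\<Sum>a\<in>UNIV. g a x * F (push a x)) - (\<Sum>a\<in>UNIV. g a y * F (push a y)) \<le> 0 * D + (1 - 0) * D"
    by (intro coupled_sum_diff_le) (auto simp: g_sum g_pos less_imp_le assms)
  then show ?thesis by (simp add: step_def)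
qed

lemma total_diff_le:
  assumes "\<And>u w. F u - F w \<le> D"
  shows "total T F x - total T F y \<le> real T * D"
proof (induction T arbitrary: x y)
  case (Suc T)
  have "step (total T F) x - step (total T F) y \<le> real T * D" by (rule step_diff_le) (rule Suc.IH)
  then show ?case using assms[of x y] by (simp add: algebra_simps)
qed simp

lemma run_diff_le:
  assumes "\<And>u w. F u - F w \<le> D" "length s = length t"
  shows "run F s x - run F t y \<le> real (length s) * D"
  using assms(2)
proof (induction s t arbitrary: x y rule: list_induct2)
  case (Cons a s b t)
  then show ?case using Cons.IH[of "push a x" "push b y"] assms(1)[of x y] by (simp add: algebra_simps)
qed simp

lemma run_agree_diff_le:
  assumes "\<And>u w. agree L u w \<Longrightarrow> F u - F w \<le> \<eta>" "agree n x y" "L \<le> n"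
  shows "run F s x - run F s y \<le> real (length s) * \<eta>"
  using assms(2,3)
proof (induction s arbitrary: n x y)
  case (Cons a s)
  have "F x - F y \<le> \<eta>" using Cons.prems agree_mono assms(1) by blast
  moreover have "run F s (push a x) - run F s (push a y) \<le> real (length s) * \<eta>"
    using Cons.prems by (intro Cons.IH[OF agree_push]) auto
  ultimately show ?case by (simp add: algebra_simps)
qed simp

section \<open>Hellinger affinity of two trajectories\<close>

definition affinity :: "nat \<Rightarrow> (int \<Rightarrow> 's) \<Rightarrow> (int \<Rightarrow> 's) \<Rightarrow> real" where
  "affinity m x y = (\<Sum>s\<in>words m. sqrt (path_prob s x * path_prob s y))"

lemma affinity_Suc:
  "affinity (Suc m) x y = (\<Sum>a\<in>UNIV. sqrt (g a x * g a y) * affinity m (push a x) (push a y))"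
  unfolding affinity_def sum_words_Suc sum_distrib_left
  by (simp add: real_sqrt_mult mult_ac)

text \<open>The ratio bounds in both directions give |sqrt (g a x) - sqrt (g a y)| \<le> (1 - r) / r
  * sqrt (g a y). The squares of the left-hand side sum to twice 1 minus the affinity, so the defect
  is quadratic in c / sqrt n.\<close>

lemma one_step_affinity:
  assumes n: "n0 \<le> n" "agree n x y" and r: "r = 1 - c / sqrt (real n)" "0 < r"
  shows "1 - ((1 - r) / r)\<^sup>2 / 2 \<le> (\<Sum>a\<in>UNIV. sqrt (g a x * g a y))"
proof -
  have r1: "r \<le> 1" using r c by simp
  have "(sqrt (g a x) - sqrt (g a y))\<^sup>2 \<le> ((1 - r) / r)\<^sup>2 * g a y" for a
  proof -
    have "sqrt (r\<^sup>2 * g a y) \<le> sqrt (g a x)" "sqrt (r\<^sup>2 * g a x) \<le> sqrt (g a y)"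
      using g_ratio[OF n(1) n(2), of a] g_ratio[OF n(1) agree_sym[OF n(2)], of a] r(1) by auto
    then have b: "r * sqrt (g a y) \<le> sqrt (g a x)" "r * sqrt (g a x) \<le> sqrt (g a y)"
      using r by (simp_all add: real_sqrt_mult)
    have s: "0 \<le> sqrt (g a y)" using g_pos[of a y] by simp
    have "sqrt (g a x) - sqrt (g a y) \<le> (1 - r) / r * sqrt (g a y)"
      using b(2) r(2) by (simp add: field_simps)
    moreover have "(1 - r) * sqrt (g a y) \<le> (1 - r) / r * sqrt (g a y)"
    proof (rule mult_right_mono[OF _ s])
      show "1 - r \<le> (1 - r) / r" using r(2) r1 mult_left_mono[of r 1 "1 - r"] by (simp add: le_divide_eq)
    qed
    then have "sqrt (g a y) - sqrt (g a x) \<le> (1 - r) / r * sqrt (g a y)"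
      using b(1) by (simp add: algebra_simps)
    ultimately have "\<bar>sqrt (g a x) - sqrt (g a y)\<bar> \<le> (1 - r) / r * sqrt (g a y)" by simp
    then have "\<bar>sqrt (g a x) - sqrt (g a y)\<bar>\<^sup>2 \<le> ((1 - r) / r * sqrt (g a y))\<^sup>2"
      by (rule power_mono) simp
    then show ?thesis
      unfolding power2_abs power_mult_distrib real_sqrt_pow2[OF less_imp_le[OF g_pos]] .
  qed
  then have "(\<Sum>a\<in>UNIV. (sqrt (g a x) - sqrt (g a y))\<^sup>2) \<le> (\<Sum>a\<in>UNIV. ((1 - r) / r)\<^sup>2 * g a y)"
    by (rule sum_mono)
  also have "\<dots> = ((1 - r) / r)\<^sup>2" by (simp add: sum_distrib_left[symmetric] g_sum)
  also have "(\<Sum>a\<in>UNIV. (sqrt (g a x) - sqrt (g a y))\<^sup>2)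
      = (\<Sum>a\<in>UNIV. g a x + g a y - 2 * sqrt (g a x * g a y))"
    by (intro sum.cong refl) (simp add: power2_diff g_pos less_imp_le real_sqrt_mult)
  also have "\<dots> = 2 - 2 * (\<Sum>a\<in>UNIV. sqrt (g a x * g a y))"
    by (simp add: sum_subtractf sum.distrib g_sum sum_distrib_left)
  finally show ?thesis by simp
qed

text \<open>A common symbol raises the agreement from n to n + 1, so the affinity is bounded below
  by a product of terms 1 - c' / (2 * n) with increasing n. Bounding each term below by ((n - 1) /
  n) powr (c' / 2) makes the product telescope.\<close>

lemma affinity_lower_bound:
  obtains c' n1 where "0 < c'" "c' < 1" "2 \<le> n1"
    "\<And>n m x y. n1 \<le> n \<Longrightarrow> agree n x y \<Longrightarrow>
      ((real n - 1) / (real n + real m - 1)) powr (c' / 2) \<le> affinity m x y"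
proof -
  have "c\<^sup>2 < 1" using c by (simp add: abs_square_less_1)
  then obtain c' where c': "c\<^sup>2 < c'" "c' < 1" using dense by blast
  have c'_pos: "0 < c'" using c' zero_le_power2[of c] by linarith
  have lim: "(\<lambda>n. (c / (1 - c / sqrt (real n)))\<^sup>2) \<longlonglongrightarrow> (c / (1 - 0))\<^sup>2"
    by (intro tendsto_intros real_tendsto_divide_at_top[where c=c]
        filterlim_compose[OF sqrt_at_top filterlim_real_sequentially]) auto
  have lim0: "(\<lambda>n. 1 - c / sqrt (real n)) \<longlonglongrightarrow> 1 - 0"
    by (intro tendsto_intros real_tendsto_divide_at_top[where c=c]
        filterlim_compose[OF sqrt_at_top filterlim_real_sequentially])
  have "\<forall>\<^sub>F n in sequentially. (c / (1 - c / sqrt (real n)))\<^sup>2 < c'"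
    using lim c'(1) by (intro order_tendstoD) auto
  moreover have "\<forall>\<^sub>F n in sequentially. 0 < 1 - c / sqrt (real n)"
    using lim0 by (intro order_tendstoD) auto
  ultimately have "\<forall>\<^sub>F n in sequentially. (c / (1 - c / sqrt (real n)))\<^sup>2 < c' \<and> 0 < 1 - c / sqrt (real n)"
    by (rule eventually_conj)
  then obtain n2 where n2: "\<And>n. n2 \<le> n \<Longrightarrow> (c / (1 - c / sqrt (real n)))\<^sup>2 < c' \<and> 0 < 1 - c / sqrt (real n)"
    by (auto simp: eventually_sequentially)
  define n1 where "n1 = max (max n0 n2) 2"
  have bound: "((real n - 1) / (real n + real m - 1)) powr (c' / 2) \<le> affinity m x y"
    if "n1 \<le> n" "agree n x y" for n m x y
    using that
  proof (induction m arbitrary: n x y)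
    case 0
    then show ?case by (simp add: affinity_def n1_def)
  next
    case (Suc m)
    have n: "n0 \<le> n" "n2 \<le> n" "2 \<le> n" using Suc.prems by (auto simp: n1_def)
    define r where "r = 1 - c / sqrt (real n)"
    have r: "0 < r" "(c / r)\<^sup>2 < c'" using n2[OF n(2)] by (auto simp: r_def)
    have "((1 - r) / r)\<^sup>2 = (c / r)\<^sup>2 / real n"
      using n by (simp add: r_def power_divide power_mult_distrib)
    also have "\<dots> \<le> c' / real n" using r n by (intro divide_right_mono) auto
    finally have "1 - c' / 2 * (1 / real n) \<le> 1 - ((1 - r) / r)\<^sup>2 / 2" by simp
    also have "\<dots> \<le> (\<Sum>a\<in>UNIV. sqrt (g a x * g a y))"
      by (rule one_step_affinity[OF n(1) Suc.prems(2) r_def r(1)])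
    finally have one: "1 - c' / 2 * (1 / real n) \<le> (\<Sum>a\<in>UNIV. sqrt (g a x * g a y))" .
    \<comment> \<open>Bernoulli's inequality, written as a weighted mean inequality with second
      entry 1.\<close>
    have "(1 - 1 / real n) powr (c' / 2) * 1 powr (1 - c' / 2) \<le> c' / 2 * (1 - 1 / real n) + (1 - c' / 2) * 1"
      using c' c'_pos n by (intro Youngs_inequality_0) auto
    then have "(1 - 1 / real n) powr (c' / 2) \<le> (\<Sum>a\<in>UNIV. sqrt (g a x * g a y))"
      using one by (simp add: algebra_simps)
    then have first: "((real n - 1) / real n) powr (c' / 2) \<le> (\<Sum>a\<in>UNIV. sqrt (g a x * g a y))"
      using n by (simp add: diff_divide_distrib)
    have rest: "(real n / (real n + real m)) powr (c' / 2) \<le> affinity m (push a x) (push a y)" for a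
      using Suc.IH[of "Suc n", OF _ agree_push[OF Suc.prems(2)]] Suc.prems(1) by (simp add: add_ac)
    have "((real n - 1) / (real n + real (Suc m) - 1)) powr (c' / 2)
        = ((real n - 1) / real n) powr (c' / 2) * (real n / (real n + real m)) powr (c' / 2)"
      using n by (subst powr_mult[symmetric]) auto
    also have "\<dots> \<le> (\<Sum>a\<in>UNIV. sqrt (g a x * g a y)) * (real n / (real n + real m)) powr (c' / 2)"
      using first by (rule mult_right_mono) simp
    also have "\<dots> \<le> affinity (Suc m) x y"
      unfolding affinity_Suc sum_distrib_right
      by (intro sum_mono mult_left_mono rest) (simp add: g_pos less_imp_le)
    finally show ?case .
  qed
  show thesis by (rule that[of c' n1, OF c'_pos c'(2) _ bound]) (simp_all add: n1_def)
qed

text \<open>For m = (b - 1) * n the square of the affinity is at least a constant times b powr (-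
  c'). As c' < 1, b times this exceeds any bound for large b.\<close>

lemma block_overlap:
  obtains b n1 :: nat and q :: real where "2 \<le> b" "1 \<le> n1" "0 < q" "q < 1" "1 \<le> q * real b"
    "\<And>n x y. n1 \<le> n \<Longrightarrow> agree n x y \<Longrightarrow>
      q \<le> (\<Sum>s\<in>words ((b - 1) * n). min (path_prob s x) (path_prob s y))"
proof -
  obtain c' n1 where c': "0 < c'" "c' < 1" and n1: "2 \<le> n1" and aff:
    "\<And>n m x y. n1 \<le> n \<Longrightarrow> agree n x y \<Longrightarrow>
      ((real n - 1) / (real n + real m - 1)) powr (c' / 2) \<le> affinity m x y"
    by (rule affinity_lower_bound) blast
  have "1 - c' > 0" using c' by simp
  then have "filterlim (\<lambda>b. real b powr (1 - c')) at_top sequentially"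
    by real_asymp
  then have "\<forall>\<^sub>F b in sequentially. 2 * 2 powr c' \<le> real b powr (1 - c')"
    by (simp add: filterlim_at_top)
  with eventually_ge_at_top[of 2] have "\<forall>\<^sub>F b in sequentially. 2 \<le> b \<and> 2 * 2 powr c' \<le> real b powr (1 - c')"
    by (rule eventually_conj)
  then obtain b where b: "2 \<le> b" "2 * 2 powr c' \<le> real b powr (1 - c')"
    by (auto simp: eventually_sequentially)
  \<comment> \<open>The number 1 / (2 * b) bounds (n - 1) / (b * n - 1) below for n \<ge> 2; the
    last division by 2 is the loss in \<open>overlap_ge_hellinger\<close>.\<close>
  define q where "q = (1 / (2 * real b)) powr c' / 2"
  have q_eq: "q = 1 / (2 * (2 powr c' * real b powr c'))"
    using b by (simp add: q_def powr_divide powr_mult)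
  have "0 < q" unfolding q_def using b by simp
  moreover have "q < 1"
  proof -
    have "(1 / (2 * real b)) powr c' \<le> 1" using b c' by (intro powr_le1) auto
    then show ?thesis by (simp add: q_def)
  qed
  moreover have "1 \<le> q * real b"
  proof -
    have "real b = real b powr (1 - c') * real b powr c'" using b by (simp add: powr_add[symmetric])
    then have "2 * 2 powr c' * real b powr c' \<le> real b"
      using mult_right_mono[OF b(2), of "real b powr c'"] by simp
    then show ?thesis using b by (simp add: q_eq le_divide_eq)
  qed
  moreover have "q \<le> (\<Sum>s\<in>words ((b - 1) * n). min (path_prob s x) (path_prob s y))"
    if n: "n1 \<le> n" and ag: "agree n x y" for n x y
  proof -
    define m where "m = (b - 1) * n"
    have nm: "real n + real m = real b * real n"
      using b by (simp add: m_def of_nat_diff algebra_simps)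
    have n2: "2 \<le> n" using n n1 by simp
    have bn: "0 < real b * real n - 1"
    proof -
      have "1 * 2 \<le> real b * real n" using b n2 by (intro mult_mono) auto
      then show ?thesis by simp
    qed
    have b2n: "real b * 2 \<le> real b * real n" using n2 by (intro mult_left_mono) auto
    have "(real n - 1) * (2 * real b) = 2 * (real b * real n) - 2 * real b"
      by (simp add: algebra_simps)
    then have "real b * real n - 1 \<le> (real n - 1) * (2 * real b)"
      using b2n b by linarith
    then have "(real b * real n - 1) / (2 * real b) \<le> real n - 1"
      using b by (subst pos_divide_le_eq) auto
    then have "1 / (2 * real b) \<le> (real n - 1) / (real b * real n - 1)"
      using bn by (subst pos_le_divide_eq) auto
    then have "(1 / (2 * real b)) powr (c' / 2) \<le> ((real n - 1) / (real n + real m - 1)) powr (c' / 2)"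
      unfolding nm using c' b by (intro powr_mono2) auto
    also have "\<dots> \<le> affinity m x y" by (rule aff[OF n ag])
    finally have "((1 / (2 * real b)) powr (c' / 2))\<^sup>2 \<le> (affinity m x y)\<^sup>2"
      by (rule power_mono) simp
    then have "q \<le> (affinity m x y)\<^sup>2 / 2"
      by (simp add: q_def power2_eq_square powr_add[symmetric])
    also have "\<dots> \<le> (\<Sum>s\<in>words m. min (path_prob s x) (path_prob s y))"
      unfolding affinity_def by (rule overlap_ge_hellinger) (auto simp: path_prob_sum path_prob_pos less_imp_le)
    finally show ?thesis by (simp add: m_def)
  qed
  ultimately show thesis using that[of b n1 q] b n1 by simp
qed

text \<open>The coupling inequality for the words of the first m steps; distinct words are compared
  through oscillations only.\<close>

lemma block_diff_le:
  assumes q: "q \<le> (\<Sum>s\<in>words m. min (path_prob s x) (path_prob s y))"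
    and U: "\<And>s. length s = m \<Longrightarrow> run F s x + total T F (path_end s x)
        - (run F s y + total T F (path_end s y)) \<le> U"
    and F: "\<And>u w. F u - F w \<le> D" and V: "\<And>u w. total T F u - total T F w \<le> V"
    and UV: "U \<le> real m * D + V"
  shows "total (m + T) F x - total (m + T) F y \<le> q * U + (1 - q) * (real m * D + V)"
  unfolding total_split
proof (rule coupled_sum_diff_le[OF finite_words words_nonempty _ _ _ _ q])
  fix s t :: "'s list" assume "s \<in> words m" "t \<in> words m"
  then have "run F s x - run F t y \<le> real m * D" using run_diff_le[of F D s t x y] F by simp
  then show "run F s x + total T F (path_end s x) - (run F t y + total T F (path_end t y)) \<le> real m * D + V"
    using V[of "path_end s x" "path_end t y"] by simp
qed (use U UV in \<open>auto simp: path_prob_sum path_prob_pos less_imp_le\<close>)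

text \<open>Two trajectories that agree on their last \<open>n\<close> symbols stay together for the next
  \<open>(b - 1) * n\<close> steps with probability \<open>q\<close>. As \<open>q * b \<ge> 1\<close>, the expected time gained at each of
  the scales \<open>n = B * b ^ i\<close>, \<open>i < J\<close>, is bounded below, so that a large \<open>J\<close> compensates the
  cost of the first meeting.\<close>

lemma contraction:
  obtains \<kappa> where "0 \<le> \<kappa>" "\<kappa> < 1"
    "\<And>F D. 0 < D \<Longrightarrow> (\<And>u w. F u - F w \<le> D) \<Longrightarrow>
      (\<And>\<eta>. 0 < \<eta> \<Longrightarrow> \<exists>L. \<forall>u w. agree L u w \<longrightarrow> F u - F w \<le> \<eta>) \<Longrightarrow>
      \<exists>T\<ge>1. \<forall>x y. total T F x - total T F y \<le> \<kappa> * D * real T"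
proof -
  obtain b n1 :: nat and q :: real where b: "2 \<le> b" and n1: "1 \<le> n1" and q: "0 < q" "q < 1" "1 \<le> q * real b"
    and overlap: "\<And>n x y. n1 \<le> n \<Longrightarrow> agree n x y \<Longrightarrow>
      q \<le> (\<Sum>s\<in>words ((b - 1) * n). min (path_prob s x) (path_prob s y))"
    by (rule block_overlap) blast
  have "\<exists>T\<ge>1. \<forall>x y. total T F x - total T F y \<le> (1 - q / 4) * D * real T"
    if D: "0 < D" and F: "\<And>u w. F u - F w \<le> D"
      and ql: "\<And>\<eta>. 0 < \<eta> \<Longrightarrow> \<exists>L. \<forall>u w. agree L u w \<longrightarrow> F u - F w \<le> \<eta>" for F D
  proof -
    obtain L where L: "\<And>u w. agree L u w \<Longrightarrow> F u - F w \<le> D / 4"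
      using ql[of "D / 4"] D by auto
    define B where "B = max L n1"
    have B: "1 \<le> B" "L \<le> B" "n1 \<le> B" using n1 by (auto simp: B_def)
    \<comment> \<open>With no agreement at all, a fixed word of length B still has probability at
      least q0 from every past. This provides the first meeting.\<close>
    define q0 where "q0 = \<delta> ^ B"
    have q0: "0 < q0" using \<delta> by (simp add: q0_def)
    have overlap0: "q0 \<le> (\<Sum>s\<in>words B. min (path_prob s x) (path_prob s y))" for x y
    proof -
      obtain s :: "'s list" where s: "length s = B" using Ex_list_of_length by blast
      have "q0 \<le> min (path_prob s x) (path_prob s y)"
        using path_prob_ge[of s x] path_prob_ge[of s y] s by (simp add: q0_def)
      also have "\<dots> \<le> (\<Sum>s\<in>words B. min (path_prob s x) (path_prob s y))"
        using s finite_words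
        by (intro member_le_sum[where f="\<lambda>s. min (path_prob s x) (path_prob s y)"])
          (auto simp: path_prob_pos less_imp_le)
      finally show ?thesis .
    qed
    \<comment> \<open>This J makes the expected gain q0 * e 0 at least B * D, the cost of the B
      steps up to the first meeting.\<close>
    obtain J :: nat where J: "4 / (q * q0) \<le> real J" using real_arch_simple by blast
    \<comment> \<open>A coupled step costs at most D / 4 and an uncoupled one D; the mean D * (1 - 3
      * q / 4) lies below \<open>\<theta>\<close> by q * D / 4.\<close>
    define \<theta> where "\<theta> = D * (1 - q / 2)"
    define T0 where "T0 = B * b ^ J"
    define C where "C = D * real T0"
    \<comment> \<open>The gain to be expected from scale i upwards. Each of the J - i remaining
      scales is credited with the gain of the current block: the next block is longer by the factor
      b, which outweighs the probability q of reaching it.\<close>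
    define e where "e i = q * D / 4 * (real B * real (b - 1) * real b ^ i) * real (J - i)" for i
    have \<theta>0: "0 \<le> \<theta>" using D q by (simp add: \<theta>_def)
    have e_nonneg: "0 \<le> e i" for i using D q by (simp add: e_def)
    \<comment> \<open>Strong induction on the time: whenever a coupling fails, the bound for the
      shorter remaining time is used for arbitrary pasts.\<close>
    have main: "total T F x - total T F y \<le> \<theta> * real T + C" for T x y
    proof (induction T arbitrary: x y rule: less_induct)
      case (less T)
      show ?case
      proof (cases "T < T0")
        case True
        have "total T F x - total T F y \<le> real T * D" by (rule total_diff_le) (rule F)
        also have "\<dots> \<le> C" using True D by (simp add: C_def)
        finally show ?thesis using \<theta>0 by (simp add: add_increasing)
      next
        case False
        \<comment> \<open>The blocks of the scales i, ..., J - 1 have total length B * b ^ J - B * b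
          ^ i, so the last condition says that the remaining time suffices for all of them.\<close>
        have level: "total T' F u - total T' F w \<le> \<theta> * real T' + C - e i"
          if "i \<le> J" "agree (B * b ^ i) u w" "T' < T" "B * b ^ J \<le> T' + B * b ^ i" for i T' u w
          using that
        proof (induction i arbitrary: T' u w rule: inc_induct)
          case base
          then show ?case using less.IH[of T' u w] by (simp add: e_def)
        next
          case (step i)
          define n where "n = B * b ^ i"
          define m where "m = (b - 1) * n"
          have nm: "n + m = B * b ^ Suc i"
          proof -
            have "n + (b - 1) * n = b * n" using b by (cases b) auto
            then show ?thesis by (simp add: m_def n_def)
          qed
          have "b ^ Suc i \<le> b ^ J" using step.hyps b by (intro power_increasing) auto
          then have "B * b ^ Suc i \<le> B * b ^ J" by simp
          then have m_le: "m \<le> T'" using step.prems(3) nm unfolding n_def by linarith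
          define T'' where "T'' = T' - m"
          have T': "T' = m + T''" using m_le by (simp add: T''_def)
          have "1 \<le> b ^ i" using b by simp
          then have "B \<le> n" by (simp add: n_def)
          have "1 \<le> m" using b \<open>B \<le> n\<close> B(1) by (simp add: m_def)
          have "total (m + T'') F u - total (m + T'') F w
             \<le> q * (real m * (D / 4) + (\<theta> * real T'' + C - e (Suc i))) + (1 - q) * (real m * D + (\<theta> * real T'' + C))"
          proof (rule block_diff_le)
            show "q \<le> (\<Sum>s\<in>words m. min (path_prob s u) (path_prob s w))"
              unfolding m_def by (intro overlap order_trans[OF B(3) \<open>B \<le> n\<close>] step.prems(1)[folded n_def])
            fix s :: "'s list" assume s: "length s = m"
            have "run F s u - run F s w \<le> real (length s) * (D / 4)"
              by (rule run_agree_diff_le[OF L step.prems(1)[folded n_def] order_trans[OF B(2) \<open>B \<le> n\<close>]])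
            moreover have "total T'' F (path_end s u) - total T'' F (path_end s w)
                \<le> \<theta> * real T'' + C - e (Suc i)"
            proof (rule step.IH)
              show "agree (B * b ^ Suc i) (path_end s u) (path_end s w)"
                using agree_path_end[OF step.prems(1), of s] nm s by (simp add: n_def)
              show "T'' < T" using T' step.prems(2) by simp
              show "B * b ^ J \<le> T'' + B * b ^ Suc i" using step.prems(3) nm T' unfolding n_def by linarith
            qed
            ultimately show "run F s u + total T'' F (path_end s u) - (run F s w + total T'' F (path_end s w))
              \<le> real m * (D / 4) + (\<theta> * real T'' + C - e (Suc i))" using s by simp
          next
            show "total T'' F u' - total T'' F w' \<le> \<theta> * real T'' + C" for u' w'
              using T' step.prems(2) \<open>1 \<le> m\<close> by (intro less.IH) simp
            have "real m * (D / 4) \<le> real m * D" using D by (intro mult_left_mono) auto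
            then show "real m * (D / 4) + (\<theta> * real T'' + C - e (Suc i)) \<le> real m * D + (\<theta> * real T'' + C)"
              using e_nonneg[of "Suc i"] by linarith
          qed (rule F)
          also have "\<dots> = \<theta> * real T' + C - (q * D / 4 * real m + q * e (Suc i))"
            unfolding T' \<theta>_def by (simp add: field_simps)
          also have "\<dots> \<le> \<theta> * real T' + C - e i"
          proof -
            have Ji: "real (J - i) = 1 + real (J - Suc i)" using step.hyps by simp
            have "1 * (q * D / 4 * (real B * real (b - 1) * real b ^ i) * real (J - Suc i))
              \<le> (q * real b) * (q * D / 4 * (real B * real (b - 1) * real b ^ i) * real (J - Suc i))"
              using q D by (intro mult_right_mono) auto
            also have "\<dots> = q * e (Suc i)" by (simp add: e_def mult_ac)
            finally have "e i \<le> q * D / 4 * (real B * real (b - 1) * real b ^ i) + q * e (Suc i)"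
              unfolding e_def Ji by (simp add: distrib_left)
            then show ?thesis by (simp add: m_def n_def mult_ac)
          qed
          finally show ?case unfolding T' .
        qed
        define T'' where "T'' = T - B"
        have "B \<le> T0" using b by (simp add: T0_def)
        then have T: "T = B + T''" and T''_lt: "T'' < T" using False B(1) by (auto simp: T''_def)
        have "total (B + T'') F x - total (B + T'') F y
           \<le> q0 * (real B * D + (\<theta> * real T'' + C - e 0)) + (1 - q0) * (real B * D + (\<theta> * real T'' + C))"
        proof (rule block_diff_le[OF overlap0])
          fix s :: "'s list" assume s: "length s = B"
          have "run F s x - run F s y \<le> real (length s) * D" by (rule run_diff_le) (rule F, simp)
          moreover have "total T'' F (path_end s x) - total T'' F (path_end s y) \<le> \<theta> * real T'' + C - e 0"
          proof (rule level)
            show "agree (B * b ^ 0) (path_end s x) (path_end s y)"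
              using agree_path_end[OF agree_0, of s x y] s by simp
            show "B * b ^ J \<le> T'' + B * b ^ 0" using False T by (simp add: T0_def)
          qed (use T''_lt in auto)
          ultimately show "run F s x + total T'' F (path_end s x) - (run F s y + total T'' F (path_end s y))
             \<le> real B * D + (\<theta> * real T'' + C - e 0)" using s by simp
        next
          show "total T'' F u - total T'' F w \<le> \<theta> * real T'' + C" for u w
            using T''_lt by (rule less.IH)
          show "real B * D + (\<theta> * real T'' + C - e 0) \<le> real B * D + (\<theta> * real T'' + C)"
            using e_nonneg[of 0] by simp
        qed (rule F)
        also have "\<dots> = \<theta> * real T'' + C + (real B * D - q0 * e 0)" by (simp add: algebra_simps)
        also have "\<dots> \<le> \<theta> * real T'' + C"
        proof -
          have "4 \<le> q * q0 * real J" using J q q0 by (simp add: pos_divide_le_eq mult.commute)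
          also have "\<dots> \<le> q * q0 * real J * real (b - 1)"
            using b q q0 mult_left_mono[of 1 "real (b - 1)" "q * q0 * real J"] by simp
          finally have "real B * D / 4 * 4 \<le> real B * D / 4 * (q * q0 * real J * real (b - 1))"
            by (rule mult_left_mono) (use D in simp)
          then show ?thesis by (simp add: e_def mult_ac)
        qed
        also have "\<dots> \<le> \<theta> * real T + C" using \<theta>0 T by (simp add: mult_left_mono)
        finally show ?thesis unfolding T .
      qed
    qed
    \<comment> \<open>Half of the saving q / 2 contained in \<open>\<theta>\<close> is given up to
      absorb the constant C.\<close>
    obtain T :: nat where T: "4 * C / (q * D) + 1 \<le> real T" using real_arch_simple by blast
    have "0 \<le> 4 * C / (q * D)" using D q by (simp add: C_def)
    then have T1: "1 \<le> T" using T by linarith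
    have "4 * C / (q * D) \<le> real T" using T by simp
    then have "C \<le> q / 4 * D * real T" using D q by (simp add: pos_divide_le_eq mult_ac)
    then have "\<theta> * real T + C \<le> (1 - q / 4) * D * real T"
      by (simp add: \<theta>_def algebra_simps)
    then show ?thesis using main T1 by (meson order_trans)
  qed
  then show thesis using that[of "1 - q / 4"] q by simp
qed

end

section \<open>Gibbs states as measures\<close>

lemma open_coord_vimage:
  fixes A :: "'s::{finite, discrete_topology} set"
  shows "open ((\<lambda>x :: int \<Rightarrow> 's. x i) -` A)"
  by (rule open_vimage[OF discrete_topology_class.open_discrete continuous_on_product_coordinates])

lemma open_cyl:
  fixes x :: "int \<Rightarrow> 's::{finite, discrete_topology}"
  assumes "finite \<Lambda>" shows "open (cyl \<Lambda> x)"
proof -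
  have "cyl \<Lambda> x = (\<Inter>i\<in>\<Lambda>. (\<lambda>y. y i) -` {x i})" by (auto simp: cyl_iff)
  then show ?thesis using assms by (simp add: open_coord_vimage open_INT)
qed

lemma closed_cyl:
  fixes x :: "int \<Rightarrow> 's::{finite, discrete_topology}"
  shows "closed (cyl \<Lambda> x)"
proof -
  have "- cyl \<Lambda> x = (\<Union>i\<in>\<Lambda>. (\<lambda>y. y i) -` (- {x i}))" by (auto simp: cyl_iff)
  then show ?thesis unfolding closed_def by (auto intro!: open_coord_vimage simp del: vimage_Compl)
qed

definition window :: "nat \<Rightarrow> int set" where "window n = {- int n..int n}"

lemma finite_window: "finite (window n)" by (simp add: window_def)

lemma open_contains_cyl:
  fixes U :: "(int \<Rightarrow> 's::{finite, discrete_topology}) set"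
  assumes "open U" "x \<in> U"
  shows "\<exists>n. cyl (window n) x \<subseteq> U"
proof -
  have "openin (product_topology (\<lambda>_. euclidean) UNIV) U" using assms by (simp add: open_fun_def)
  from product_topology_open_contains_basis[OF this assms(2)]
  obtain X where X: "x \<in> (\<Pi>\<^sub>E i\<in>UNIV. X i)" "finite {i. X i \<noteq> UNIV}" "(\<Pi>\<^sub>E i\<in>UNIV. X i) \<subseteq> U"
    by auto
  have "\<exists>n. {i. X i \<noteq> UNIV} \<subseteq> window n"
  proof -
    define n where "n = Max (insert 0 ((\<lambda>i. nat \<bar>i\<bar>) ` {i. X i \<noteq> UNIV}))"
    have "nat \<bar>i\<bar> \<le> n" if "i \<in> {i. X i \<noteq> UNIV}" for i
      unfolding n_def using X(2) that by (intro Max_ge) auto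
    then have "{i. X i \<noteq> UNIV} \<subseteq> window n" by (force simp: window_def)
    then show ?thesis ..
  qed
  then obtain n where n: "{i. X i \<noteq> UNIV} \<subseteq> window n" ..
  have "cyl (window n) x \<subseteq> (\<Pi>\<^sub>E i\<in>UNIV. X i)"
  proof
    fix y assume y: "y \<in> cyl (window n) x"
    have "y i \<in> X i" for i
    proof (cases "X i = UNIV")
      case False
      then have "y i = x i" using y n by (auto simp: cyl_iff)
      then show ?thesis using X(1) by auto
    qed simp
    then show "y \<in> (\<Pi>\<^sub>E i\<in>UNIV. X i)" by auto
  qed
  then show ?thesis using X(3) by blast
qed

definition windows :: "(int \<Rightarrow> 's) set set" where
  "windows = (\<Union>n. range (cyl (window n)))"

lemma countable_windows: "countable (windows :: (int \<Rightarrow> 's::finite) set set)"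
proof -
  have fin: "finite (range (cyl \<Lambda> :: (int \<Rightarrow> 's) \<Rightarrow> _))" if "finite \<Lambda>" for \<Lambda>
  proof (rule finite_subset)
    show "range (cyl \<Lambda> :: (int \<Rightarrow> 's) \<Rightarrow> _) \<subseteq> (\<lambda>r. {y. restrict y \<Lambda> = r}) ` (\<Pi>\<^sub>E i\<in>\<Lambda>. UNIV)"
      by (auto simp: cyl_def intro!: image_eqI)
    show "finite ((\<lambda>r. {y. restrict y \<Lambda> = r}) ` (\<Pi>\<^sub>E i\<in>\<Lambda>. (UNIV :: 's set)))"
      using that by (intro finite_imageI finite_PiE) auto
  qed
  show ?thesis
    unfolding windows_def by (intro countable_UN[OF countableI_type] countable_finite fin finite_window)
qed

lemma sets_borel_windows:
  "sets (borel :: (int \<Rightarrow> 's::{finite, discrete_topology}) measure) = sigma_sets UNIV (insert UNIV (insert {} windows))"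
proof -
  have "sets (borel :: (int \<Rightarrow> 's) measure) = sigma_sets UNIV {S. open S}"
    by (simp add: borel_def)
  also have "\<dots> = sigma_sets UNIV (insert UNIV (insert {} windows))"
  proof (rule sigma_sets_eqI)
    fix U :: "(int \<Rightarrow> 's) set" assume "U \<in> {S. open S}"
    then have U: "open U" by simp
    have "U = \<Union>{w \<in> windows. w \<subseteq> U}"
    proof (intro set_eqI iffI)
      fix x assume "x \<in> U"
      then obtain n where "cyl (window n) x \<subseteq> U" using open_contains_cyl[OF U] by blast
      moreover have "x \<in> cyl (window n) x" by (simp add: cyl_iff)
      ultimately show "x \<in> \<Union>{w \<in> windows. w \<subseteq> U}" by (auto simp: windows_def)
    qed auto
    moreover have "\<Union>{w \<in> windows. w \<subseteq> U} \<in> sigma_sets UNIV (insert UNIV (insert {} windows))"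
      by (rule sigma_sets_UNION) (auto intro: countable_subset[OF _ countable_windows] sigma_sets.Basic)
    ultimately show "U \<in> sigma_sets UNIV (insert UNIV (insert {} windows))" by simp
  next
    fix w :: "(int \<Rightarrow> 's) set" assume "w \<in> insert UNIV (insert {} windows)"
    then have "open w" by (auto simp: windows_def intro!: open_cyl finite_window)
    then show "w \<in> sigma_sets UNIV {S. open S}" by (auto intro: sigma_sets.Basic)
  qed
  finally show ?thesis .
qed

lemma Int_stable_windows: "Int_stable (insert UNIV (insert {} windows))"
proof -
  have cyl: "cyl (window n) x \<inter> cyl (window m) y \<in> insert {} windows" for n m and x y :: "int \<Rightarrow> 'a"
  proof (cases "cyl (window n) x \<inter> cyl (window m) y = {}")
    case False
    then obtain z where z: "z \<in> cyl (window n) x" "z \<in> cyl (window m) y" by auto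
    have "cyl (window n) x \<inter> cyl (window m) y = cyl (window (max n m)) z"
    proof -
      have "window (max n m) = window n \<union> window m" by (auto simp: window_def)
      then show ?thesis using z by (auto simp: cyl_iff ball_Un)
    qed
    then show ?thesis by (auto simp: windows_def)
  qed simp
  have key: "A \<inter> B \<in> insert {} windows" if A: "A \<in> windows" and B: "B \<in> windows" for A B :: "(int \<Rightarrow> 'a) set"
  proof -
    obtain n x where "A = cyl (window n) x" using A unfolding windows_def by blast
    moreover obtain m y where "B = cyl (window m) y" using B unfolding windows_def by blast
    ultimately show ?thesis using cyl by simp
  qed
  show ?thesis
  proof (rule Int_stableI)
    fix A B :: "(int \<Rightarrow> 'a) set"
    assume "A \<in> insert UNIV (insert {} windows)" "B \<in> insert UNIV (insert {} windows)"
    then consider "A = UNIV" | "B = UNIV" | "A = {}" | "B = {}" | "A \<in> windows" "B \<in> windows"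
      by (auto simp only: insert_iff)
    then show "A \<inter> B \<in> insert UNIV (insert {} windows)"
    proof cases
      case 5
      from key[OF this] show ?thesis by simp
    qed (use \<open>A \<in> _\<close> \<open>B \<in> _\<close> in simp_all)
  qed
qed

lemma prob_eq_if_windows_eq:
  fixes \<mu> \<nu> :: "(int \<Rightarrow> 's::{finite, discrete_topology}) measure"
  assumes "prob_space \<mu>" "prob_space \<nu>" "sets \<mu> = sets borel" "sets \<nu> = sets borel"
    and eq: "\<And>n x. measure \<mu> (cyl (window n) x) = measure \<nu> (cyl (window n) x)"
  shows "\<mu> = \<nu>"
proof (rule measure_eqI_generator_eq[OF Int_stable_windows])
  interpret \<mu>: prob_space \<mu> by fact
  interpret \<nu>: prob_space \<nu> by fact
  have space: "space \<mu> = UNIV" "space \<nu> = UNIV"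
    using sets_eq_imp_space_eq[OF assms(3)] sets_eq_imp_space_eq[OF assms(4)] by simp_all
  show "insert UNIV (insert {} windows) \<subseteq> Pow UNIV" by simp
  show "emeasure \<mu> X = emeasure \<nu> X" if "X \<in> insert UNIV (insert {} windows)" for X
    using that eq \<mu>.emeasure_space_1 \<nu>.emeasure_space_1
    by (auto simp: windows_def space \<mu>.emeasure_eq_measure \<nu>.emeasure_eq_measure)
  show "range (\<lambda>_::nat. UNIV) \<subseteq> insert UNIV (insert {} windows)" by simp
  show "emeasure \<mu> UNIV \<noteq> \<infinity>" by simp
  show "sets \<mu> = sigma_sets UNIV (insert UNIV (insert {} windows))"
    "sets \<nu> = sigma_sets UNIV (insert UNIV (insert {} windows))"
    unfolding assms(3,4) by (rule sets_borel_windows)+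
qed simp

section \<open>Conditioning on the outside of a finite set\<close>

definition patch :: "int set \<Rightarrow> (int \<Rightarrow> 's) \<Rightarrow> (int \<Rightarrow> 's) \<Rightarrow> (int \<Rightarrow> 's)" where
  "patch \<Lambda> \<xi> x = (\<lambda>i. if i \<in> \<Lambda> then \<xi> i else x i)"

lemma space_coord_algebra: "space (coord_algebra \<Lambda>) = UNIV"
  by (simp add: coord_algebra_def)

lemma coord_vimage_in_coord_algebra: "i \<in> \<Lambda> \<Longrightarrow> (\<lambda>x. x i) -` A \<in> sets (coord_algebra \<Lambda>)"
  unfolding coord_algebra_def by (auto intro!: sigma_sets.Basic)

lemma patch_measurable:
  "patch \<Lambda> \<xi> \<in> measurable (coord_algebra (- \<Lambda>)) (borel :: (int \<Rightarrow> 's::{finite, discrete_topology}) measure)"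
proof (rule measurable_sigma_sets[OF sets_borel_windows])
  fix w :: "(int \<Rightarrow> 's) set" assume "w \<in> insert UNIV (insert {} windows)"
  then consider "w = UNIV" | "w = {}" | n z where "w = cyl (window n) z" by (auto simp: windows_def)
  then show "patch \<Lambda> \<xi> -` w \<inter> space (coord_algebra (- \<Lambda>)) \<in> sets (coord_algebra (- \<Lambda>))"
  proof cases
    case (3 n z)
    show ?thesis
    proof (cases "\<forall>i\<in>window n \<inter> \<Lambda>. \<xi> i = z i")
      case True
      have "patch \<Lambda> \<xi> -` w \<inter> space (coord_algebra (- \<Lambda>))
          = (\<Inter>i\<in>window n - \<Lambda>. (\<lambda>x. x i) -` {z i}) \<inter> space (coord_algebra (- \<Lambda>))"
        using True by (auto simp: 3 patch_def cyl_iff space_coord_algebra split: if_splits)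
      also have "\<dots> \<in> sets (coord_algebra (- \<Lambda>))"
      proof (cases "window n - \<Lambda> = {}")
        case False
        then show ?thesis using finite_window
          by (intro sets.Int sets.finite_INT coord_vimage_in_coord_algebra sets.top) auto
      next
        case True
        then show ?thesis by (simp only: True INT_empty Int_UNIV_left sets.top)
      qed
      finally show ?thesis .
    next
      case False
      then have "patch \<Lambda> \<xi> -` w = {}" by (force simp: 3 patch_def cyl_iff)
      then show ?thesis by simp
    qed
  qed (auto simp: sets.top)
qed auto

lemma subalgebra_coord_algebra:
  assumes "sets \<mu> = sets (borel :: (int \<Rightarrow> 's::{finite, discrete_topology}) measure)"
  shows "subalgebra \<mu> (coord_algebra \<Lambda>)"
proof -
  have "sets (coord_algebra \<Lambda> :: (int \<Rightarrow> 's) measure) \<subseteq> sets borel"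
    unfolding coord_algebra_def
    by (auto simp: sets_measure_of intro!: sets.sigma_sets_subset[of _ borel, simplified] borel_open open_coord_vimage)
  then show ?thesis using assms sets_eq_imp_space_eq[OF assms]
    by (simp add: subalgebra_def space_coord_algebra)
qed

lemma patch_borel:
  "patch \<Lambda> \<xi> \<in> measurable borel (borel :: (int \<Rightarrow> 's::{finite, discrete_topology}) measure)"
  by (rule measurable_from_subalg[OF subalgebra_coord_algebra patch_measurable]) simp

text \<open>The index set no longer depends on x, so that measurability in x reduces to that of
  \<open>patch\<close>.\<close>

lemma spec_avg_patch:
  assumes "finite \<Lambda>"
  shows "spec_avg \<phi> \<Lambda> F x = (\<Sum>\<xi>\<in>cyl (- \<Lambda>) x0. \<phi> \<Lambda> (patch \<Lambda> \<xi> x) * F (patch \<Lambda> \<xi> x))"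
  unfolding spec_avg_def
  by (rule sum.reindex_bij_witness[of _ "\<lambda>\<xi>. patch \<Lambda> \<xi> x" "\<lambda>y. patch \<Lambda> y x0"])
    (auto simp: patch_def cyl_iff fun_eq_iff intro!: arg_cong2[where f="(*)"] arg_cong[where f="\<phi> \<Lambda>"] arg_cong[where f=F])

text \<open>Each term is a function of the outside coordinates times the indicator of a cylinder,
  the form on which the conditional probabilities of cylinders can be used.\<close>

lemma patch_decomposition:
  fixes F :: "(int \<Rightarrow> 's::finite) \<Rightarrow> real"
  assumes "finite \<Lambda>"
  shows "F x = (\<Sum>\<xi>\<in>cyl (- \<Lambda>) x0. F (patch \<Lambda> \<xi> x) * indicator (cyl \<Lambda> \<xi>) x)"
proof -
  have "F (patch \<Lambda> \<xi> x) * indicator (cyl \<Lambda> \<xi>) x = (if \<xi> = patch \<Lambda> x x0 then F x else 0)"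
    if \<xi>: "\<xi> \<in> cyl (- \<Lambda>) x0" for \<xi>
  proof -
    have "x \<in> cyl \<Lambda> \<xi> \<longleftrightarrow> \<xi> = patch \<Lambda> x x0"
      using \<xi> by (auto simp: cyl_iff patch_def fun_eq_iff)
    moreover have "patch \<Lambda> \<xi> x = x" if "x \<in> cyl \<Lambda> \<xi>"
      using that by (auto simp: cyl_iff patch_def)
    ultimately show ?thesis by (simp add: indicator_def)
  qed
  then have "(\<Sum>\<xi>\<in>cyl (- \<Lambda>) x0. F (patch \<Lambda> \<xi> x) * indicator (cyl \<Lambda> \<xi>) x)
      = (\<Sum>\<xi>\<in>cyl (- \<Lambda>) x0. if \<xi> = patch \<Lambda> x x0 then F x else 0)"
    by (rule sum.cong[OF refl])
  also have "\<dots> = F x"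
  proof -
    have "patch \<Lambda> x x0 \<in> cyl (- \<Lambda>) x0" by (auto simp: cyl_iff patch_def)
    then show ?thesis using finite_cyl[OF assms, of x0] by (simp add: sum.delta)
  qed
  finally show ?thesis by simp
qed

lemma spec_avg_measurable:
  assumes "is_specification \<phi>" "finite \<Lambda>" "\<Lambda> \<noteq> {}" and [measurable]: "F \<in> borel_measurable borel"
  shows "spec_avg \<phi> \<Lambda> F \<in> borel_measurable borel"
proof -
  have [measurable]: "\<phi> \<Lambda> \<in> borel_measurable borel" using assms by (simp add: is_specification_def)
  note patch_borel[measurable]
  have eq: "spec_avg \<phi> \<Lambda> F
      = (\<lambda>x. \<Sum>\<xi>\<in>cyl (- \<Lambda>) undefined. \<phi> \<Lambda> (patch \<Lambda> \<xi> x) * F (patch \<Lambda> \<xi> x))"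
    by (rule ext) (rule spec_avg_patch[OF assms(2)])
  show ?thesis unfolding eq by measurable
qed

text \<open>The Gibbs property describes the conditional probability of a cylinder only at points of
  that cylinder. Elsewhere an upper bound can be derived, which suffices for an inequality.\<close>

lemma gibbs_integral_le:
  fixes \<phi> :: "int set \<Rightarrow> (int \<Rightarrow> 's::{finite, discrete_topology}) \<Rightarrow> real"
  assumes spec: "is_specification \<phi>" and gibbs: "gibbs_state \<phi> \<mu>"
    and \<Lambda>: "finite \<Lambda>" "\<Lambda> \<noteq> {}"
    and F: "F \<in> borel_measurable borel" "\<And>x. 0 \<le> F x" "\<And>x. F x \<le> M"
  shows "(\<integral>x. F x \<partial>\<mu>) \<le> (\<integral>x. spec_avg \<phi> \<Lambda> F x \<partial>\<mu>)"
proof -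
  define \<F> where "\<F> = (coord_algebra (- \<Lambda>) :: (int \<Rightarrow> 's) measure)"
  have sets: "sets \<mu> = sets borel" and "prob_space \<mu>" using gibbs by (auto simp: gibbs_state_def)
  interpret prob_space \<mu> by fact
  have sub: "subalgebra \<mu> \<F>" unfolding \<F>_def by (rule subalgebra_coord_algebra[OF sets])
  interpret finite_measure_subalgebra \<mu> \<F> by unfold_locales (rule sub)
  note meas_eq = measurable_cong_sets[OF sets refl]
  have space: "space \<mu> = UNIV" using sets_eq_imp_space_eq[OF sets] by simp
  have \<phi>: "\<phi> \<Lambda> \<in> borel_measurable borel" "\<And>x. 0 \<le> \<phi> \<Lambda> x"
    using spec \<Lambda> by (auto simp: is_specification_def)
  have \<phi>_le: "\<phi> \<Lambda> x \<le> 1" for x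
  proof -
    have "\<phi> \<Lambda> x \<le> (\<Sum>y\<in>cyl (- \<Lambda>) x. \<phi> \<Lambda> y)"
      using \<phi> finite_cyl[OF \<Lambda>(1)] by (intro member_le_sum) (auto simp: cyl_iff)
    then show ?thesis using spec \<Lambda> by (simp add: is_specification_def)
  qed
  have comp: "(\<lambda>x. G (patch \<Lambda> \<xi> x)) \<in> borel_measurable \<F>" if "G \<in> borel_measurable borel" for G \<xi> and dummy :: real
    unfolding \<F>_def using that patch_measurable by (rule measurable_compose_rev)
  have comp_\<mu>: "(\<lambda>x. G (patch \<Lambda> \<xi> x)) \<in> borel_measurable \<mu>" if "G \<in> borel_measurable borel" for G :: "(int \<Rightarrow> 's) \<Rightarrow> real" and \<xi>
    unfolding meas_eq using that patch_borel by (rule measurable_compose_rev)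
  have cyl_meas: "cyl \<Lambda> \<xi> \<in> sets \<mu>" for \<xi>
    unfolding sets using open_cyl[OF \<Lambda>(1)] by (rule borel_open)
  define E where "E \<xi> = real_cond_exp \<mu> \<F> (indicator (cyl \<Lambda> \<xi>))" for \<xi>
  have ind_int: "integrable \<mu> (indicator (cyl \<Lambda> \<xi>) :: _ \<Rightarrow> real)" for \<xi>
    using cyl_meas by (intro integrable_real_indicator) (auto simp: less_top[symmetric])
  have E_meas: "E \<xi> \<in> borel_measurable \<F>" for \<xi> unfolding E_def by simp
  have E_le: "AE x in \<mu>. E \<xi> x \<le> \<phi> \<Lambda> (patch \<Lambda> \<xi> x)" for \<xi>
  proof -
    \<comment> \<open>\<open>Bad\<close> is an event of the outside coordinates that meets the
      cylinder in a null set, so the integral of E \<xi> over it vanishes. But E \<xi> is positive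
      there, hence \<open>Bad\<close> is null.\<close>
    define Bad where "Bad = {x \<in> space \<F>. \<phi> \<Lambda> (patch \<Lambda> \<xi> x) < E \<xi> x}"
    have Bad: "Bad \<in> sets \<F>" unfolding Bad_def using comp[OF \<phi>(1)] E_meas by measurable
    have Bad\<mu>: "Bad \<in> sets \<mu>" using Bad sub by (auto simp: subalgebra_def)
    have "AE x in \<mu>. indicator Bad x * (indicator (cyl \<Lambda> \<xi>) x :: real) = 0"
    proof -
      have "AE x in \<mu>. real_cond_exp \<mu> (coord_algebra (- \<Lambda>)) (indicator (cyl \<Lambda> x)) x = \<phi> \<Lambda> x"
        using gibbs \<Lambda> by (simp add: gibbs_state_def)
      then show ?thesis
      proof eventually_elim
        case (elim x)
        show ?case
        proof (cases "x \<in> cyl \<Lambda> \<xi>")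
          case True
          have "cyl \<Lambda> x = cyl \<Lambda> \<xi>" "patch \<Lambda> \<xi> x = x"
            using True by (auto simp: cyl_iff patch_def)
          then have "E \<xi> x = \<phi> \<Lambda> (patch \<Lambda> \<xi> x)" using elim by (simp add: E_def \<F>_def)
          then show ?thesis by (simp add: Bad_def)
        qed simp
      qed
    qed
    then have "(\<integral>x. indicator Bad x * (indicator (cyl \<Lambda> \<xi>) x :: real) \<partial>\<mu>) = 0"
      by (subst integral_cong_AE[where g="\<lambda>_. 0"]) (use Bad\<mu> cyl_meas in auto)
    moreover have int: "integrable \<mu> (\<lambda>x. indicator Bad x * (indicator (cyl \<Lambda> \<xi>) x :: real))"
      using integrable_real_mult_indicator[OF Bad\<mu> ind_int] by (simp add: mult.commute)
    note intg = real_cond_exp_intg[OF int borel_measurable_indicator[OF Bad] borel_measurable_indicator[OF cyl_meas]]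
    ultimately have zero: "(\<integral>x. indicator Bad x * E \<xi> x \<partial>\<mu>) = 0"
      using intg(2) by (simp add: E_def)
    have nonneg: "0 \<le> indicator Bad x * E \<xi> x" for x
      using \<phi>(2)[of "patch \<Lambda> \<xi> x"] by (auto simp: Bad_def indicator_def)
    have "AE x in \<mu>. indicator Bad x * E \<xi> x = 0"
      using integral_nonneg_eq_0_iff_AE[OF intg(1)] nonneg zero by (simp add: E_def)
    then show ?thesis
    proof eventually_elim
      case (elim x)
      show ?case
      proof (rule ccontr)
        assume "\<not> E \<xi> x \<le> \<phi> \<Lambda> (patch \<Lambda> \<xi> x)"
        then have "x \<in> Bad" by (simp add: Bad_def \<F>_def space_coord_algebra)
        then have "E \<xi> x = 0" "\<phi> \<Lambda> (patch \<Lambda> \<xi> x) < E \<xi> x" using elim by (auto simp: Bad_def)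
        then show False using \<phi>(2)[of "patch \<Lambda> \<xi> x"] by simp
      qed
    qed
  qed
  define x0 where "x0 = (undefined :: int \<Rightarrow> 's)"
  have F_int: "integrable \<mu> (\<lambda>x. F (patch \<Lambda> \<xi> x) * indicator (cyl \<Lambda> \<xi>) x)" for \<xi>
    using comp_\<mu>[OF F(1), of \<xi>] cyl_meas[of \<xi>] F(2,3) order_trans[OF F(2) F(3)]
    by (intro integrable_const_bound[of _ M] AE_I2) (auto simp: indicator_def)
  have F\<phi>_int: "integrable \<mu> (\<lambda>x. F (patch \<Lambda> \<xi> x) * \<phi> \<Lambda> (patch \<Lambda> \<xi> x))" for \<xi>
  proof (rule integrable_const_bound[of _ "M * 1"])
    show "AE x in \<mu>. norm (F (patch \<Lambda> \<xi> x) * \<phi> \<Lambda> (patch \<Lambda> \<xi> x)) \<le> M * 1"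
    proof (rule AE_I2)
      fix x
      have "F (patch \<Lambda> \<xi> x) * \<phi> \<Lambda> (patch \<Lambda> \<xi> x) \<le> M * 1"
        using F(2,3) \<phi>(2) \<phi>_le order_trans[OF F(2) F(3)] by (intro mult_mono) auto
      then show "norm (F (patch \<Lambda> \<xi> x) * \<phi> \<Lambda> (patch \<Lambda> \<xi> x)) \<le> M * 1"
        using F(2) \<phi>(2) by simp
    qed
    show "(\<lambda>x. F (patch \<Lambda> \<xi> x) * \<phi> \<Lambda> (patch \<Lambda> \<xi> x)) \<in> borel_measurable \<mu>"
      using comp_\<mu>[OF F(1)] comp_\<mu>[OF \<phi>(1)] by measurable
  qed
  have "(\<integral>x. F x \<partial>\<mu>) = (\<integral>x. (\<Sum>\<xi>\<in>cyl (- \<Lambda>) x0. F (patch \<Lambda> \<xi> x) * indicator (cyl \<Lambda> \<xi>) x) \<partial>\<mu>)"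
    by (rule Bochner_Integration.integral_cong[OF refl]) (rule patch_decomposition[OF \<Lambda>(1)])
  also have "\<dots> = (\<Sum>\<xi>\<in>cyl (- \<Lambda>) x0. \<integral>x. F (patch \<Lambda> \<xi> x) * indicator (cyl \<Lambda> \<xi>) x \<partial>\<mu>)"
    by (rule Bochner_Integration.integral_sum) (rule F_int)
  also have "\<dots> \<le> (\<Sum>\<xi>\<in>cyl (- \<Lambda>) x0. \<integral>x. F (patch \<Lambda> \<xi> x) * \<phi> \<Lambda> (patch \<Lambda> \<xi> x) \<partial>\<mu>)"
  proof (rule sum_mono)
    fix \<xi>
    note intg = real_cond_exp_intg[OF F_int comp[OF F(1)] borel_measurable_indicator[OF cyl_meas], of \<xi>]
    have "(\<integral>x. F (patch \<Lambda> \<xi> x) * indicator (cyl \<Lambda> \<xi>) x \<partial>\<mu>) = (\<integral>x. F (patch \<Lambda> \<xi> x) * E \<xi> x \<partial>\<mu>)"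
      using intg(2) by (simp add: E_def)
    also have "\<dots> \<le> (\<integral>x. F (patch \<Lambda> \<xi> x) * \<phi> \<Lambda> (patch \<Lambda> \<xi> x) \<partial>\<mu>)"
    proof (rule integral_mono_AE[OF _ F\<phi>_int])
      show "integrable \<mu> (\<lambda>x. F (patch \<Lambda> \<xi> x) * E \<xi> x)" using intg(1) by (simp add: E_def)
      show "AE x in \<mu>. F (patch \<Lambda> \<xi> x) * E \<xi> x \<le> F (patch \<Lambda> \<xi> x) * \<phi> \<Lambda> (patch \<Lambda> \<xi> x)"
        using E_le[of \<xi>] by eventually_elim (simp add: mult_left_mono F(2))
    qed
    finally show "(\<integral>x. F (patch \<Lambda> \<xi> x) * indicator (cyl \<Lambda> \<xi>) x \<partial>\<mu>)
      \<le> (\<integral>x. F (patch \<Lambda> \<xi> x) * \<phi> \<Lambda> (patch \<Lambda> \<xi> x) \<partial>\<mu>)" .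
  qed
  also have "\<dots> = (\<integral>x. (\<Sum>\<xi>\<in>cyl (- \<Lambda>) x0. F (patch \<Lambda> \<xi> x) * \<phi> \<Lambda> (patch \<Lambda> \<xi> x)) \<partial>\<mu>)"
    by (rule Bochner_Integration.integral_sum[symmetric]) (rule F\<phi>_int)
  also have "\<dots> = (\<integral>x. spec_avg \<phi> \<Lambda> F x \<partial>\<mu>)"
  proof (rule Bochner_Integration.integral_cong[OF refl])
    fix x
    have "spec_avg \<phi> \<Lambda> F x = (\<Sum>\<xi>\<in>cyl (- \<Lambda>) x0. \<phi> \<Lambda> (patch \<Lambda> \<xi> x) * F (patch \<Lambda> \<xi> x))"
      by (rule spec_avg_patch[OF \<Lambda>(1)])
    then show "(\<Sum>\<xi>\<in>cyl (- \<Lambda>) x0. F (patch \<Lambda> \<xi> x) * \<phi> \<Lambda> (patch \<Lambda> \<xi> x)) = spec_avg \<phi> \<Lambda> F x"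
      by (simp only: mult.commute)
  qed
  finally show ?thesis .
qed

text \<open>Averages preserve constants, so the inequality for the nonnegative functions M + F and M
  - F gives both directions.\<close>

lemma gibbs_integral:
  fixes \<phi> :: "int set \<Rightarrow> (int \<Rightarrow> 's::{finite, discrete_topology}) \<Rightarrow> real"
  assumes spec: "is_specification \<phi>" and gibbs: "gibbs_state \<phi> \<mu>"
    and \<Lambda>: "finite \<Lambda>" "\<Lambda> \<noteq> {}"
    and F: "F \<in> borel_measurable borel" "\<And>x. \<bar>F x\<bar> \<le> M"
  shows "(\<integral>x. F x \<partial>\<mu>) = (\<integral>x. spec_avg \<phi> \<Lambda> F x \<partial>\<mu>)"
proof -
  have sets: "sets \<mu> = sets borel" and "prob_space \<mu>" using gibbs by (auto simp: gibbs_state_def)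
  interpret prob_space \<mu> by fact
  note meas_eq = measurable_cong_sets[OF sets refl]
  have bnd: "\<bar>spec_avg \<phi> \<Lambda> F x\<bar> \<le> M" for x
    using spec_avg_bounds[OF spec \<Lambda>, of x "- M" F M] F(2) by (simp add: abs_le_iff) (metis minus_le_iff)
  have int: "integrable \<mu> F" "integrable \<mu> (spec_avg \<phi> \<Lambda> F)"
    using F bnd spec_avg_measurable[OF spec \<Lambda> F(1)]
    by (auto intro!: integrable_const_bound[of _ M] simp: meas_eq)
  have shiftF: "spec_avg \<phi> \<Lambda> (\<lambda>y. M + s * F y) x = M + s * spec_avg \<phi> \<Lambda> F x" for s x
    using spec_avg_const[OF spec \<Lambda>, of M x]
    by (simp add: spec_avg_def distrib_left sum.distrib sum_distrib_left mult_ac)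
  have lin: "(\<integral>x. M + s * G x \<partial>\<mu>) = M + s * (\<integral>x. G x \<partial>\<mu>)" if "integrable \<mu> G" for G s
    using that by (simp add: prob_space)
  have "(\<integral>x. M + s * F x \<partial>\<mu>) \<le> (\<integral>x. M + s * spec_avg \<phi> \<Lambda> F x \<partial>\<mu>)" if "s \<in> {-1, 1}" for s
    unfolding shiftF[symmetric]
  proof (rule gibbs_integral_le[OF spec gibbs \<Lambda>, where M="2 * M"])
    show "(\<lambda>x. M + s * F x) \<in> borel_measurable borel" using F(1) by measurable
    show "0 \<le> M + s * F x" "M + s * F x \<le> 2 * M" for x using that F(2)[of x] by (auto simp: abs_le_iff)
  qed
  from this[of 1] this[of "-1"] show ?thesis
    unfolding lin[OF int(1)] lin[OF int(2)] by simp
qed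

section \<open>Uniqueness\<close>

lemma continuous_shift: "continuous_on UNIV (shift :: (int \<Rightarrow> 's::topological_space) \<Rightarrow> _)"
  unfolding shift_def
  by (rule continuous_on_coordinatewise_then_product) (rule continuous_on_product_coordinates)

lemma continuous_push: "continuous_on UNIV (push a :: (int \<Rightarrow> 's::topological_space) \<Rightarrow> _)"
proof (rule continuous_on_coordinatewise_then_product)
  fix i
  show "continuous_on UNIV (\<lambda>x. push a x i)"
    by (cases "i = -1") (simp_all add: push_def shift_def continuous_on_product_coordinates)
qed

lemmas shift_measurable = borel_measurable_continuous_onI[OF continuous_shift]
lemmas push_measurable = borel_measurable_continuous_onI[OF continuous_push]

text \<open>Functions of finitely many past sites would not do: \<open>step\<close> brings in
  \<open>g\<close>, which depends on the whole past. This larger class is stable under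
  \<open>step\<close>.\<close>

definition quasi_local :: "((int \<Rightarrow> 's::topological_space) \<Rightarrow> real) \<Rightarrow> bool" where
  "quasi_local F \<longleftrightarrow> F \<in> borel_measurable borel \<and> (\<exists>M. \<forall>x. \<bar>F x\<bar> \<le> M) \<and>
     (\<forall>\<eta>>0. \<exists>L. \<forall>u w. agree L u w \<longrightarrow> F u - F w \<le> \<eta>)"

lemma quasi_local_past:
  assumes "quasi_local F" "\<And>i. i < 0 \<Longrightarrow> u i = w i"
  shows "F u = F w"
proof -
  have ag: "agree L u w" "agree L w u" for L using assms(2) by (auto simp: agree_def)
  have "F u - F w \<le> 0 + \<eta>" "F w - F u \<le> 0 + \<eta>" if \<eta>: "0 < \<eta>" for \<eta>
  proof -
    obtain L where "\<forall>u w. agree L u w \<longrightarrow> F u - F w \<le> \<eta>"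
      using assms(1) \<eta> unfolding quasi_local_def by blast
    then show "F u - F w \<le> 0 + \<eta>" "F w - F u \<le> 0 + \<eta>" using ag[of L] by auto
  qed
  then have "F u - F w \<le> 0" "F w - F u \<le> 0" by (blast intro: field_le_epsilon)+
  then show ?thesis by simp
qed

text \<open>The operator is a parameter because the transition operator depends on the
  chain.\<close>

definition stationary :: "(((int \<Rightarrow> 's::topological_space) \<Rightarrow> real) \<Rightarrow> (int \<Rightarrow> 's) \<Rightarrow> real) \<Rightarrow> (int \<Rightarrow> 's) measure \<Rightarrow> bool" where
  "stationary S \<mu> \<longleftrightarrow> prob_space \<mu> \<and> sets \<mu> = sets borel \<and>
     (\<forall>F. quasi_local F \<longrightarrow> (\<integral>x. S F x \<partial>\<mu>) = (\<integral>x. F x \<partial>\<mu>))"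

lemma quasi_local_integrable:
  assumes "quasi_local F" "prob_space \<mu>" "sets \<mu> = sets borel"
  shows "integrable \<mu> F"
proof -
  interpret prob_space \<mu> by fact
  obtain M where "\<And>x. \<bar>F x\<bar> \<le> M" using assms(1) unfolding quasi_local_def by blast
  moreover have "F \<in> borel_measurable \<mu>"
    using assms(1) unfolding quasi_local_def measurable_cong_sets[OF assms(3) refl] by blast
  ultimately show ?thesis by (intro integrable_const_bound[of _ M]) auto
qed

lemma quasi_local_add:
  assumes "quasi_local F" "quasi_local G"
  shows "quasi_local (\<lambda>x. F x + G x)"
  unfolding quasi_local_def
proof (intro conjI allI impI)
  show "(\<lambda>x. F x + G x) \<in> borel_measurable borel"
    using assms by (auto simp: quasi_local_def)
  obtain M M' where M: "\<And>x. \<bar>F x\<bar> \<le> M" "\<And>x. \<bar>G x\<bar> \<le> M'"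
    using assms unfolding quasi_local_def by blast
  have "\<bar>F x + G x\<bar> \<le> M + M'" for x using M(1)[of x] M(2)[of x] by linarith
  then show "\<exists>M. \<forall>x. \<bar>F x + G x\<bar> \<le> M" by blast
  fix \<eta> :: real assume "0 < \<eta>"
  then have "0 < \<eta> / 2" by simp
  then obtain L L' where L: "\<And>u w. agree L u w \<Longrightarrow> F u - F w \<le> \<eta> / 2"
    "\<And>u w. agree L' u w \<Longrightarrow> G u - G w \<le> \<eta> / 2"
    using assms unfolding quasi_local_def by blast
  have "F u + G u - (F w + G w) \<le> \<eta>" if "agree (max L L') u w" for u w
    using L(1)[OF agree_mono[OF that]] L(2)[OF agree_mono[OF that]] by force
  then show "\<exists>L. \<forall>u w. agree L u w \<longrightarrow> F u + G u - (F w + G w) \<le> \<eta>" by blast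
qed

lemma quasi_local_cmult:
  assumes "quasi_local F" "0 < r"
  shows "quasi_local (\<lambda>x. r * F x)"
  unfolding quasi_local_def
proof (intro conjI allI impI)
  show "(\<lambda>x. r * F x) \<in> borel_measurable borel"
    using assms by (auto simp: quasi_local_def)
  obtain M where M: "\<And>x. \<bar>F x\<bar> \<le> M" using assms unfolding quasi_local_def by blast
  have "\<bar>r * F x\<bar> \<le> r * M" for x using M[of x] assms(2) by (simp add: abs_mult)
  then show "\<exists>M. \<forall>x. \<bar>r * F x\<bar> \<le> M" by blast
  fix \<eta> :: real assume "0 < \<eta>"
  then have "0 < \<eta> / r" using assms(2) by simp
  then obtain L where L: "\<And>u w. agree L u w \<Longrightarrow> F u - F w \<le> \<eta> / r"
    using assms(1) unfolding quasi_local_def by blast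
  have "r * F u - r * F w \<le> \<eta>" if "agree L u w" for u w
    using mult_left_mono[OF L[OF that], of r] assms(2) by (simp add: right_diff_distrib)
  then show "\<exists>L. \<forall>u w. agree L u w \<longrightarrow> r * F u - r * F w \<le> \<eta>" by blast
qed

locale measurable_past_chain = past_chain g c \<delta> n0
  for g :: "'s::{finite, discrete_topology} \<Rightarrow> (int \<Rightarrow> 's) \<Rightarrow> real" and c \<delta> n0 +
  assumes g_measurable: "\<And>a. g a \<in> borel_measurable borel"
begin

lemma g_le_1: "g a x \<le> 1"
proof -
  have "g a x \<le> (\<Sum>b\<in>UNIV. g b x)" by (intro member_le_sum) (simp_all add: g_pos less_imp_le)
  then show ?thesis by (simp add: g_sum)
qed

lemma g_uniformly_local:
  assumes "0 < \<eta>"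
  shows "\<exists>L. \<forall>u w a. agree L u w \<longrightarrow> g a u - g a w \<le> \<eta>"
proof -
  have "(\<lambda>n. 1 - (1 - c / sqrt (real n))\<^sup>2) \<longlonglongrightarrow> 1 - (1 - 0)\<^sup>2"
    by (intro tendsto_intros real_tendsto_divide_at_top[where c=c]
        filterlim_compose[OF sqrt_at_top filterlim_real_sequentially])
  then have "\<forall>\<^sub>F n in sequentially. 1 - (1 - c / sqrt (real n))\<^sup>2 < \<eta>"
    using assms by (intro order_tendstoD) auto
  then have "\<forall>\<^sub>F n in sequentially. n0 \<le> n \<and> 1 - (1 - c / sqrt (real n))\<^sup>2 < \<eta>"
    by (intro eventually_conj eventually_ge_at_top)
  then obtain n where n: "n0 \<le> n" "1 - (1 - c / sqrt (real n))\<^sup>2 < \<eta>"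
    using eventually_happens'[OF sequentially_bot] by blast
  have "g a u - g a w \<le> \<eta>" if "agree n u w" for u w a
  proof -
    define r where "r = (1 - c / sqrt (real n))\<^sup>2"
    have "r * g a u \<le> g a w" unfolding r_def by (rule g_ratio[OF n(1) agree_sym[OF that]])
    then have "g a u - g a w \<le> (1 - r) * g a u" by (simp add: algebra_simps)
    also have "\<dots> \<le> max 0 (1 - r) * 1"
      using g_le_1[of a u] g_pos[of a u] by (intro mult_mono) auto
    also have "\<dots> \<le> \<eta>" using n(2) assms by (simp add: r_def)
    finally show ?thesis .
  qed
  then show ?thesis by blast
qed

lemma quasi_local_step:
  assumes F: "quasi_local F"
  shows "quasi_local (step F)"
proof -
  obtain M where M: "\<And>x. \<bar>F x\<bar> \<le> M" using F unfolding quasi_local_def by blast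
  then have M0: "0 \<le> M" using abs_ge_zero order_trans by blast
  have meas: "step F \<in> borel_measurable borel"
  proof -
    have "F \<in> borel_measurable borel" using F by (simp add: quasi_local_def)
    then have "(\<lambda>x. F (push a x)) \<in> borel_measurable borel" for a
      by (rule measurable_compose[OF push_measurable])
    then show ?thesis unfolding step_def[abs_def] using g_measurable by measurable
  qed
  have bounded: "\<bar>step F x\<bar> \<le> M" for x
  proof -
    have "\<bar>step F x\<bar> \<le> (\<Sum>a\<in>UNIV. \<bar>g a x * F (push a x)\<bar>)" unfolding step_def by (rule sum_abs)
    also have "\<dots> \<le> (\<Sum>a\<in>UNIV. g a x * M)"
      using M by (intro sum_mono) (simp add: abs_mult less_imp_le g_pos mult_left_mono)
    also have "\<dots> = M" by (simp add: sum_distrib_right[symmetric] g_sum)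
    finally show ?thesis .
  qed
  have "\<exists>L. \<forall>u w. agree L u w \<longrightarrow> step F u - step F w \<le> \<eta>" if \<eta>: "0 < \<eta>" for \<eta>
  proof -
    define k where "k = real CARD('s)"
    have k: "0 < k" by (simp add: k_def)
    define \<eta>' where "\<eta>' = \<eta> / (2 * k * (M + 1))"
    have \<eta>': "0 < \<eta>'" using \<eta> k M0 by (simp add: \<eta>'_def)
    obtain L where L: "\<And>u w a. agree L u w \<Longrightarrow> g a u - g a w \<le> \<eta>'"
      using g_uniformly_local[OF \<eta>'] by blast
    have "0 < \<eta> / 2" using \<eta> by simp
    then obtain L' where L': "\<And>u w. agree L' u w \<Longrightarrow> F u - F w \<le> \<eta> / 2"
      using F unfolding quasi_local_def by blast
    have "step F u - step F w \<le> \<eta>" if ag: "agree (max L L') u w" for u w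
    proof -
      have agL: "agree L u w" "agree L w u" using agree_mono[OF ag] agree_mono[OF agree_sym[OF ag]] by auto
      have agL': "agree L' (push a u) (push a w)" for a
        by (rule agree_mono[OF agree_push[OF ag]]) simp
      have "step F u - step F w
        = (\<Sum>a\<in>UNIV. (g a u - g a w) * F (push a u) + g a w * (F (push a u) - F (push a w)))"
        unfolding step_def sum_subtractf[symmetric] by (intro sum.cong refl) (simp add: algebra_simps)
      also have "\<dots> \<le> (\<Sum>a\<in>UNIV. \<eta>' * (M + 1) + g a w * (\<eta> / 2))"
      proof (intro sum_mono add_mono)
        fix a
        have "\<bar>g a u - g a w\<bar> \<le> \<eta>'" using L[OF agL(1), of a] L[OF agL(2), of a] by (simp add: abs_le_iff)
        then have "\<bar>g a u - g a w\<bar> * \<bar>F (push a u)\<bar> \<le> \<eta>' * (M + 1)"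
          using M[of "push a u"] \<eta>' by (intro mult_mono) auto
        then show "(g a u - g a w) * F (push a u) \<le> \<eta>' * (M + 1)"
          by (metis abs_le_D1 abs_mult)
        show "g a w * (F (push a u) - F (push a w)) \<le> g a w * (\<eta> / 2)"
          using L'[OF agL'] g_pos by (intro mult_left_mono) (auto simp: less_imp_le)
      qed
      also have "\<dots> = k * (\<eta>' * (M + 1)) + \<eta> / 2"
        by (simp only: sum.distrib sum_distrib_right[symmetric] g_sum) (simp add: k_def)
      also have "k * (\<eta>' * (M + 1)) = \<eta> / 2"
      proof -
        have "k \<noteq> 0" "M + 1 \<noteq> 0" using k M0 by auto
        then show ?thesis by (simp add: \<eta>'_def)
      qed
      finally show ?thesis by simp
    qed
    then show ?thesis by blast
  qed
  then show ?thesis using meas bounded unfolding quasi_local_def by blast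
qed

lemma quasi_local_total: "quasi_local F \<Longrightarrow> quasi_local (total T F)"
proof (induction T)
  case 0
  then show ?case by (auto simp: quasi_local_def intro: less_imp_le)
next
  case (Suc T)
  then show ?case by (simp add: quasi_local_add quasi_local_step)
qed

lemma integral_total:
  assumes \<mu>: "stationary step \<mu>" and F: "quasi_local F"
  shows "(\<integral>x. total T F x \<partial>\<mu>) = real T * (\<integral>x. F x \<partial>\<mu>)"
proof (induction T)
  case (Suc T)
  have "prob_space \<mu>" "sets \<mu> = sets borel" using \<mu> by (auto simp: stationary_def)
  note int = quasi_local_integrable[OF _ this]
  have "(\<integral>x. total (Suc T) F x \<partial>\<mu>) = (\<integral>x. F x \<partial>\<mu>) + (\<integral>x. step (total T F) x \<partial>\<mu>)"
    using int[OF F] int[OF quasi_local_step[OF quasi_local_total[OF F]]] by simp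
  also have "(\<integral>x. step (total T F) x \<partial>\<mu>) = real T * (\<integral>x. F x \<partial>\<mu>)"
    using \<mu> quasi_local_total[OF F] Suc by (simp add: stationary_def)
  finally show ?case by (simp add: algebra_simps)
qed simp

text \<open>Time averages of F have the same integrals as F, while \<open>contraction\<close>
  reduces their oscillation. Iteration replaces F by functions that are nearly constant, so the two
  integrals are arbitrarily close.\<close>

theorem stationary_integral_unique:
  assumes \<mu>: "stationary step \<mu>" and \<nu>: "stationary step \<nu>" and F: "quasi_local F"
  shows "(\<integral>x. F x \<partial>\<mu>) = (\<integral>x. F x \<partial>\<nu>)"
proof -
  obtain \<kappa>0 where \<kappa>0: "\<kappa>0 < 1" and contr: "\<And>F D. 0 < D \<Longrightarrow> (\<And>u w. F u - F w \<le> D) \<Longrightarrow>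
      (\<And>\<eta>. 0 < \<eta> \<Longrightarrow> \<exists>L. \<forall>u w. agree L u w \<longrightarrow> F u - F w \<le> \<eta>) \<Longrightarrow>
      \<exists>T\<ge>1. \<forall>x y. total T F x - total T F y \<le> \<kappa>0 * D * real T"
    by (rule contraction) blast
  \<comment> \<open>The factor is kept positive because \<open>contraction\<close> is applied with
    the positive bound \<open>\<kappa>\<close> ^ j * D.\<close>
  define \<kappa> where "\<kappa> = max \<kappa>0 (1 / 2)"
  have \<kappa>: "0 < \<kappa>" "\<kappa> < 1" "\<kappa>0 \<le> \<kappa>" using \<kappa>0 by (auto simp: \<kappa>_def)
  obtain M where M: "\<And>x. \<bar>F x\<bar> \<le> M" using F unfolding quasi_local_def by blast
  then have M0: "0 \<le> M" using abs_ge_zero order_trans by blast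
  define D where "D = 2 * M + 1"
  have D: "0 < D" using M0 by (simp add: D_def)
  have "\<exists>G. quasi_local G \<and> (\<forall>u w. G u - G w \<le> \<kappa> ^ j * D) \<and>
     (\<integral>x. G x \<partial>\<mu>) = (\<integral>x. F x \<partial>\<mu>) \<and> (\<integral>x. G x \<partial>\<nu>) = (\<integral>x. F x \<partial>\<nu>)" for j
  proof (induction j)
    case 0
    have "F u - F w \<le> D" for u w using M[of u] M[of w] by (simp add: D_def abs_le_iff)
    then show ?case using F by (intro exI[of _ F]) simp
  next
    case (Suc j)
    then obtain G where G: "quasi_local G" "\<And>u w. G u - G w \<le> \<kappa> ^ j * D"
      "(\<integral>x. G x \<partial>\<mu>) = (\<integral>x. F x \<partial>\<mu>)" "(\<integral>x. G x \<partial>\<nu>) = (\<integral>x. F x \<partial>\<nu>)" by blast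
    have "0 < \<kappa> ^ j * D" using \<kappa> D by simp
    then obtain T where T: "1 \<le> T" "\<And>x y. total T G x - total T G y \<le> \<kappa>0 * (\<kappa> ^ j * D) * real T"
      using contr[of "\<kappa> ^ j * D" G] G(1,2) unfolding quasi_local_def by blast
    define G' where "G' x = 1 / real T * total T G x" for x
    have "quasi_local G'"
      unfolding G'_def[abs_def] using T(1) by (intro quasi_local_cmult quasi_local_total G(1)) simp
    moreover have "G' u - G' w \<le> \<kappa> ^ Suc j * D" for u w
    proof -
      have "G' u - G' w = (total T G u - total T G w) / real T"
        by (simp add: G'_def diff_divide_distrib)
      also have "\<dots> \<le> (\<kappa>0 * (\<kappa> ^ j * D) * real T) / real T"
        using T by (intro divide_right_mono) auto
      also have "\<dots> = \<kappa>0 * (\<kappa> ^ j * D)" using T(1) by simp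
      also have "\<dots> \<le> \<kappa> * (\<kappa> ^ j * D)" using \<kappa> D by (intro mult_right_mono) auto
      finally show ?thesis by (simp add: mult.assoc)
    qed
    moreover have "(\<integral>x. G' x \<partial>\<mu>) = (\<integral>x. F x \<partial>\<mu>)" "(\<integral>x. G' x \<partial>\<nu>) = (\<integral>x. F x \<partial>\<nu>)"
      unfolding G'_def using T(1) G(3,4) integral_total[OF \<mu> G(1)] integral_total[OF \<nu> G(1)] by simp_all
    ultimately show ?case by blast
  qed
  note approx = this
  have \<mu>p: "prob_space \<mu>" "sets \<mu> = sets borel" and \<nu>p: "prob_space \<nu>" "sets \<nu> = sets borel"
    using \<mu> \<nu> by (auto simp: stationary_def)
  have "\<bar>(\<integral>x. F x \<partial>\<mu>) - (\<integral>x. F x \<partial>\<nu>)\<bar> \<le> \<kappa> ^ j * D" for j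
  proof -
    obtain G where G: "quasi_local G" "\<And>u w. G u - G w \<le> \<kappa> ^ j * D"
      "(\<integral>x. G x \<partial>\<mu>) = (\<integral>x. F x \<partial>\<mu>)" "(\<integral>x. G x \<partial>\<nu>) = (\<integral>x. F x \<partial>\<nu>)" using approx by blast
    interpret \<mu>: prob_space \<mu> by fact
    interpret \<nu>: prob_space \<nu> by fact
    have int: "integrable \<mu> G" "integrable \<nu> G"
      using quasi_local_integrable[OF G(1)] \<mu>p \<nu>p by auto
    have up: "(\<integral>x. G x \<partial>\<mu>) \<le> G w + \<kappa> ^ j * D" and lo: "G w - \<kappa> ^ j * D \<le> (\<integral>x. G x \<partial>\<mu>)" for w
    proof -
      show "(\<integral>x. G x \<partial>\<mu>) \<le> G w + \<kappa> ^ j * D"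
        by (rule \<mu>.integral_le_const[OF int(1)]) (use G(2)[of _ w] in \<open>simp add: algebra_simps\<close>)
      show "G w - \<kappa> ^ j * D \<le> (\<integral>x. G x \<partial>\<mu>)"
        by (rule \<mu>.integral_ge_const[OF int(1)]) (use G(2)[of w] in \<open>simp add: algebra_simps\<close>)
    qed
    have "(\<integral>x. G x \<partial>\<mu>) - \<kappa> ^ j * D \<le> (\<integral>x. G x \<partial>\<nu>)"
      by (rule \<nu>.integral_ge_const[OF int(2)]) (use up in \<open>simp add: algebra_simps\<close>)
    moreover have "(\<integral>x. G x \<partial>\<nu>) \<le> (\<integral>x. G x \<partial>\<mu>) + \<kappa> ^ j * D"
      by (rule \<nu>.integral_le_const[OF int(2)]) (use lo in \<open>simp add: algebra_simps\<close>)
    ultimately show ?thesis using G(3,4) by (simp add: abs_le_iff)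
  qed
  moreover have "(\<lambda>j. \<kappa> ^ j * D) \<longlonglongrightarrow> 0 * D"
    using \<kappa> by (intro tendsto_intros LIMSEQ_power_zero) simp
  ultimately have "\<bar>(\<integral>x. F x \<partial>\<mu>) - (\<integral>x. F x \<partial>\<nu>)\<bar> \<le> 0 * D"
    by (intro LIMSEQ_le_const) auto
  then show ?thesis by simp
qed

end

section \<open>Reduction of shift-invariant measures to the past\<close>

lemma integral_shift_invariant:
  fixes \<mu> :: "(int \<Rightarrow> 's::{finite, discrete_topology}) measure" and F :: "(int \<Rightarrow> 's) \<Rightarrow> real"
  assumes "shift_invariant_measure \<mu>" "sets \<mu> = sets borel" "F \<in> borel_measurable borel"
  shows "(\<integral>x. F ((shift ^^ n) x) \<partial>\<mu>) = (\<integral>x. F x \<partial>\<mu>)"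
proof -
  have pow: "(shift ^^ n) \<in> measurable borel (borel :: (int \<Rightarrow> 's) measure)" for n
  proof (induction n)
    case (Suc n)
    then show ?case using measurable_comp[OF Suc shift_measurable] by (simp only: funpow.simps)
  qed (simp add: id_def)
  show ?thesis
  proof (induction n)
    case (Suc n)
    have "(\<integral>x. F ((shift ^^ Suc n) x) \<partial>\<mu>) = (\<integral>x. F ((shift ^^ n) (shift x)) \<partial>\<mu>)"
      by (simp add: funpow_swap1)
    also have "\<dots> = (\<integral>x. F ((shift ^^ n) x) \<partial>distr \<mu> borel shift)"
      using shift_measurable assms(2) measurable_compose[OF pow assms(3)]
      by (subst integral_distr) (simp_all add: measurable_cong_sets[OF assms(2) refl])
    also have "\<dots> = (\<integral>x. F x \<partial>\<mu>)" using assms(1) Suc by (simp add: shift_invariant_measure_def)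
    finally show ?case .
  qed simp
qed

text \<open>A shift by n + 1 carries the window [-n, n] to [-2n - 1, -1], which makes every cylinder
  an observable of the past.\<close>

lemma shift_invariant_eqI:
  fixes \<mu> \<nu> :: "(int \<Rightarrow> 's::{finite, discrete_topology}) measure"
  assumes \<mu>: "prob_space \<mu>" "sets \<mu> = sets borel" "shift_invariant_measure \<mu>"
    and \<nu>: "prob_space \<nu>" "sets \<nu> = sets borel" "shift_invariant_measure \<nu>"
    and eq: "\<And>F. quasi_local F \<Longrightarrow> (\<integral>x. F x \<partial>\<mu>) = (\<integral>x. F x \<partial>\<nu>)"
  shows "\<mu> = \<nu>"
proof (rule prob_eq_if_windows_eq[OF \<mu>(1) \<nu>(1) \<mu>(2) \<nu>(2)])
  fix n and x :: "int \<Rightarrow> 's"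
  define P where "P = cyl {- (2 * int n + 1)..-1} (shift_pow (int n + 1) x)"
  define F where "F = (indicator P :: _ \<Rightarrow> real)"
  have F_meas: "F \<in> borel_measurable borel"
    unfolding F_def P_def by (intro borel_measurable_indicator borel_open open_cyl) simp
  have "quasi_local F"
    unfolding quasi_local_def
  proof (intro conjI allI impI F_meas)
    show "\<exists>M. \<forall>x. \<bar>F x\<bar> \<le> M" by (intro exI[of _ 1]) (simp add: F_def indicator_def)
    fix \<eta> :: real assume "0 < \<eta>"
    have "F u - F w \<le> \<eta>" if "agree (2 * n + 1) u w" for u w
    proof -
      have "u i = w i" if "i \<in> {- (2 * int n + 1)..-1}" for i
        using \<open>agree (2 * n + 1) u w\<close> that by (simp add: agree_def)
      then have "u \<in> P \<longleftrightarrow> w \<in> P" unfolding P_def cyl_iff by auto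
      then show ?thesis using \<open>0 < \<eta>\<close> by (simp add: F_def indicator_def)
    qed
    then show "\<exists>L. \<forall>u w. agree L u w \<longrightarrow> F u - F w \<le> \<eta>" by blast
  qed
  have ind: "indicator (cyl (window n) x) y = F ((shift ^^ (n + 1)) y)" for y
  proof -
    have "(shift ^^ (n + 1)) y \<in> P \<longleftrightarrow> (\<forall>i\<in>{- (2 * int n + 1)..-1}. y (i + (int n + 1)) = x (i + (int n + 1)))"
      unfolding shift_pow_of_nat[symmetric] P_def cyl_iff by (simp add: shift_pow_def add_ac)
    also have "\<dots> \<longleftrightarrow> y \<in> cyl (window n) x"
    proof
      assume H: "\<forall>i\<in>{- (2 * int n + 1)..-1}. y (i + (int n + 1)) = x (i + (int n + 1))"
      show "y \<in> cyl (window n) x" unfolding cyl_iff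
      proof
        fix j assume "j \<in> window n"
        then show "y j = x j" using bspec[OF H, of "j - (int n + 1)"] by (simp add: window_def)
      qed
    next
      assume "y \<in> cyl (window n) x"
      then show "\<forall>i\<in>{- (2 * int n + 1)..-1}. y (i + (int n + 1)) = x (i + (int n + 1))"
        unfolding cyl_iff by (auto simp: window_def)
    qed
    finally show ?thesis by (simp add: F_def indicator_def)
  qed
  have meas: "measure \<rho> (cyl (window n) x) = (\<integral>y. F y \<partial>\<rho>)"
    if "prob_space \<rho>" "sets \<rho> = sets borel" "shift_invariant_measure \<rho>" for \<rho>
  proof -
    have "space \<rho> = UNIV" using sets_eq_imp_space_eq[OF that(2)] by simp
    then have "measure \<rho> (cyl (window n) x) = (\<integral>y. indicator (cyl (window n) x) y \<partial>\<rho>)"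
      by simp
    also have "\<dots> = (\<integral>y. F y \<partial>\<rho>)"
      unfolding ind by (rule integral_shift_invariant[OF that(3,2) F_meas])
    finally show ?thesis .
  qed
  show "measure \<mu> (cyl (window n) x) = measure \<nu> (cyl (window n) x)"
    unfolding meas[OF \<mu>] meas[OF \<nu>] by (rule eq) fact
qed

context decaying_specification
begin

lemma kernel_measurable: "kernel N a \<in> borel_measurable borel"
proof -
  have "(\<lambda>y :: int \<Rightarrow> 's. if y 0 = a then 1 else 0 :: real) = indicator ((\<lambda>y. y 0) -` {a})"
    by (auto simp: indicator_def fun_eq_iff)
  then have "(\<lambda>y :: int \<Rightarrow> 's. if y 0 = a then 1 else 0 :: real) \<in> borel_measurable borel"
    by (simp add: borel_measurable_indicator borel_open open_coord_vimage)
  from spec_avg_measurable[OF spec _ _ this, of "{0..int N}"] show ?thesis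
    unfolding kernel_eq_spec_avg[abs_def] by simp
qed

lemma g_chain: "\<exists>c \<delta> n0. measurable_past_chain g c \<delta> n0"
proof -
  obtain c n0 where c: "0 < c" "c < 1" and ratio: "\<And>n x x' a. n0 \<le> n \<Longrightarrow>
     (\<forall>i. - int n \<le> i \<and> i < 0 \<longrightarrow> x i = x' i) \<Longrightarrow> (1 - c / sqrt (real n))\<^sup>2 * g a x' \<le> g a x"
    using g_ratio by blast
  obtain \<delta> where \<delta>: "0 < \<delta>" "\<And>a x. \<delta> \<le> g a x" using g_lower_bound by blast
  have "g a \<in> borel_measurable borel" for a
    by (rule borel_measurable_LIMSEQ_real[OF kernel_tendsto kernel_measurable])
  then have "measurable_past_chain g c \<delta> n0"
    using c \<delta> g_sum ratio by unfold_locales (auto simp: agree_def)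
  then show ?thesis by blast
qed

text \<open>By invariance F may be replaced by F after a shift, a function of the sites up to 0.
  Averaging it over [0, N] resamples only the symbol at 0, with law \<open>kernel N\<close>;
  dominated convergence then replaces the kernel by \<open>g\<close>.\<close>

lemma gibbs_stationary:
  assumes chain: "measurable_past_chain g c \<delta> n0"
    and gibbs: "gibbs_state \<phi> \<mu>" and T_inv: "shift_invariant_measure \<mu>"
  shows "stationary (past_chain.step g) \<mu>"
proof -
  interpret ch: measurable_past_chain g c \<delta> n0 by fact
  have sets: "sets \<mu> = sets borel" and "prob_space \<mu>" using gibbs by (auto simp: gibbs_state_def)
  interpret prob_space \<mu> by fact
  have "(\<integral>x. ch.step F x \<partial>\<mu>) = (\<integral>x. F x \<partial>\<mu>)" if F: "quasi_local F" for F
  proof -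
    obtain M where M: "\<And>x. \<bar>F x\<bar> \<le> M" using F unfolding quasi_local_def by blast
    have F_meas: "F \<in> borel_measurable borel" using F by (simp add: quasi_local_def)
    have Fs: "(\<lambda>x. F (shift x)) \<in> borel_measurable borel"
      using shift_measurable F_meas by (rule measurable_compose)
    have past: "F (shift y) = F (shift y')" if "\<And>i. i \<le> 0 \<Longrightarrow> y i = y' i" for y y'
      using that by (intro quasi_local_past[OF F]) (simp add: shift_def)
    define h where "h N x = (\<Sum>a\<in>UNIV. kernel N a x * F (push a x))" for N x
    have h_eq: "(\<integral>x. h N x \<partial>\<mu>) = (\<integral>x. F x \<partial>\<mu>)" for N
    proof -
      have "(\<integral>x. F x \<partial>\<mu>) = (\<integral>x. F (shift x) \<partial>\<mu>)"
        using integral_shift_invariant[OF T_inv sets F_meas, of 1] by simp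
      also have "\<dots> = (\<integral>x. spec_avg \<phi> {0..int N} (\<lambda>x. F (shift x)) x \<partial>\<mu>)"
        by (rule gibbs_integral[OF spec gibbs _ _ Fs M]) auto
      also have "\<dots> = (\<integral>x. h N x \<partial>\<mu>)"
        by (simp add: spec_avg_past[OF past] h_def push_def)
      finally show ?thesis by simp
    qed
    have "(\<lambda>N. \<integral>x. h N x \<partial>\<mu>) \<longlonglongrightarrow> (\<integral>x. ch.step F x \<partial>\<mu>)"
    proof (rule integral_dominated_convergence[where w="\<lambda>_. M"])
      show "ch.step F \<in> borel_measurable \<mu>"
        using ch.quasi_local_step[OF F] unfolding quasi_local_def measurable_cong_sets[OF sets refl] by blast
      have Fp: "(\<lambda>x. F (push a x)) \<in> borel_measurable borel" for a
        using push_measurable F_meas by (rule measurable_compose)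
      show "h N \<in> borel_measurable \<mu>" for N
        unfolding h_def[abs_def] measurable_cong_sets[OF sets refl]
        using kernel_measurable Fp by measurable
      show "AE x in \<mu>. (\<lambda>N. h N x) \<longlonglongrightarrow> ch.step F x"
        unfolding h_def ch.step_def by (intro AE_I2 tendsto_sum tendsto_mult kernel_tendsto tendsto_const)
      show "AE x in \<mu>. norm (h N x) \<le> M" for N
      proof (rule AE_I2)
        fix x
        have "\<bar>h N x\<bar> \<le> (\<Sum>a\<in>UNIV. \<bar>kernel N a x * F (push a x)\<bar>)" unfolding h_def by (rule sum_abs)
        also have "\<dots> \<le> (\<Sum>a\<in>UNIV. kernel N a x * M)"
          using M kernel_bounds(1) by (intro sum_mono) (simp add: abs_mult mult_left_mono)
        also have "\<dots> = M" by (simp add: sum_distrib_right[symmetric] kernel_sum)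
        finally show "norm (h N x) \<le> M" by simp
      qed
    qed simp
    then show ?thesis unfolding h_eq by (simp add: LIMSEQ_const_iff)
  qed
  then show ?thesis using sets \<open>prob_space \<mu>\<close> by (simp add: stationary_def)
qed

theorem invariant_gibbs_unique:
  assumes "gibbs_state \<phi> \<mu>" "shift_invariant_measure \<mu>" "gibbs_state \<phi> \<nu>" "shift_invariant_measure \<nu>"
  shows "\<mu> = \<nu>"
proof -
  obtain c \<delta> n0 where chain: "measurable_past_chain g c \<delta> n0" using g_chain by blast
  interpret ch: measurable_past_chain g c \<delta> n0 by fact
  show ?thesis
  proof (rule shift_invariant_eqI)
    show "(\<integral>x. F x \<partial>\<mu>) = (\<integral>x. F x \<partial>\<nu>)" if "quasi_local F" for F
      using assms that by (intro ch.stationary_integral_unique gibbs_stationary[OF chain])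
  qed (use assms in \<open>auto simp: gibbs_state_def\<close>)
qed

end

section \<open>Existence\<close>

text \<open>Tychonoff's theorem in a product of compact intervals. The index will range over all
  real functions of a configuration, so instead of a diagonal subsequence one gets a filter finer
  than \<open>sequentially\<close>.\<close>

lemma cluster_filter:
  fixes J :: "nat \<Rightarrow> 'i \<Rightarrow> real"
  assumes bdd: "\<And>i. \<exists>b. \<forall>N. \<bar>J N i\<bar> \<le> b"
  obtains \<F> I where "\<F> \<noteq> bot" "\<F> \<le> sequentially" "\<And>i. ((\<lambda>N. J N i) \<longlongrightarrow> I i) \<F>"
proof -
  obtain B where B: "\<And>i N. \<bar>J N i\<bar> \<le> B i" using bdd by metis
  define K where "K = (\<Pi>\<^sub>E i\<in>UNIV. {- B i..B i})"
  have "compactin (product_topology (\<lambda>_. euclidean) UNIV) K"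
    unfolding K_def compactin_PiE by (simp add: compactin_euclidean_iff)
  then have K: "compact K" by (simp add: euclidean_product_topology compactin_euclidean_iff)
  have "J N \<in> K" for N
    using B[of N] by (auto simp: K_def abs_le_iff minus_le_iff)
  then have "\<forall>\<^sub>F y in filtermap J sequentially. y \<in> K" by (simp add: eventually_filtermap)
  moreover have "filtermap J sequentially \<noteq> bot" by (simp add: filtermap_bot_iff)
  ultimately obtain x where x: "inf (nhds x) (filtermap J sequentially) \<noteq> bot"
    using K unfolding compact_filter by blast
  define \<F> where "\<F> = inf sequentially (filtercomap J (nhds x))"
  have "\<F> \<noteq> bot"
  proof
    assume "\<F> = bot"
    then have "eventually (\<lambda>_. False) \<F>" by simp
    then obtain Q R where QR: "eventually Q sequentially" "eventually R (filtercomap J (nhds x))"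
      "\<And>N. Q N \<Longrightarrow> R N \<Longrightarrow> False" unfolding \<F>_def eventually_inf by blast
    from QR(2) obtain S where S: "eventually S (nhds x)" "\<And>N. S (J N) \<Longrightarrow> R N"
      unfolding eventually_filtercomap by blast
    have "eventually (\<lambda>y. \<not> S y) (filtermap J sequentially)"
      unfolding eventually_filtermap using QR(1) by eventually_elim (use QR(3) S(2) in blast)
    then have "eventually (\<lambda>_. False) (inf (nhds x) (filtermap J sequentially))"
      unfolding eventually_inf using S(1) by blast
    then show False using x by (simp add: trivial_limit_def)
  qed
  moreover have "\<F> \<le> sequentially" by (simp add: \<F>_def)
  moreover have "((\<lambda>N. J N i) \<longlongrightarrow> x i) \<F>" for i
  proof -
    have J: "filterlim J (nhds x) \<F>"
      unfolding filterlim_iff_le_filtercomap \<F>_def by simp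
    show ?thesis
    proof (rule topological_tendstoI)
      fix S assume "open S" "x i \<in> S"
      then have "eventually (\<lambda>y. y \<in> (\<lambda>y. y i) -` S) (nhds x)"
        by (intro eventually_nhds_in_open open_vimage continuous_on_product_coordinates) auto
      from eventually_compose_filterlim[OF this J] show "\<forall>\<^sub>F N in \<F>. J N i \<in> S" by simp
    qed
  qed
  ultimately show thesis by (rule that)
qed

lemma uniform_window:
  fixes F :: "(int \<Rightarrow> 's::{finite, discrete_topology}) \<Rightarrow> real"
  assumes cont: "continuous_on UNIV F" and e: "0 < e"
  shows "\<exists>n. \<forall>x y. (\<forall>i\<in>window n. x i = y i) \<longrightarrow> \<bar>F x - F y\<bar> \<le> e"
proof -
  have "\<exists>n. cyl (window n) x \<subseteq> {y. \<bar>F y - F x\<bar> < e / 2}" for x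
  proof (rule open_contains_cyl)
    have "{y. \<bar>F y - F x\<bar> < e / 2} = F -` {F x - e / 2<..<F x + e / 2}"
      by (auto simp only: vimage_def greaterThanLessThan_iff abs_diff_less_iff mem_Collect_eq)
    then show "open {y. \<bar>F y - F x\<bar> < e / 2}"
      using open_vimage[OF open_greaterThanLessThan cont] by simp
  qed (use e in simp)
  then obtain m where m: "\<And>x. cyl (window (m x)) x \<subseteq> {y. \<bar>F y - F x\<bar> < e / 2}" by metis
  have self: "x \<in> cyl \<Lambda> x" for x and \<Lambda> by (simp add: cyl_iff)
  have cover: "UNIV \<subseteq> (\<Union>x\<in>UNIV. cyl (window (m x)) x)" using self by blast
  obtain D where "D \<subseteq> UNIV" and D: "finite D" "UNIV \<subseteq> (\<Union>x\<in>D. cyl (window (m x)) x)"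
    by (rule compactE_image[OF compact_configurations open_cyl[OF finite_window] cover])
  define n where "n = Max (insert 0 (m ` D))"
  have "\<bar>F x - F y\<bar> \<le> e" if eq: "\<forall>i\<in>window n. x i = y i" for x y
  proof -
    obtain z where z: "z \<in> D" "x \<in> cyl (window (m z)) z" using D(2) by blast
    have "m z \<le> n" unfolding n_def using D(1) z(1) by (intro Max_ge) auto
    then have "window (m z) \<subseteq> window n" by (auto simp: window_def)
    then have "y \<in> cyl (window (m z)) z" using z(2) eq unfolding cyl_iff by (metis subsetD)
    then have "\<bar>F y - F z\<bar> < e / 2" "\<bar>F x - F z\<bar> < e / 2" using m[of z] z(2) by auto
    then show ?thesis by linarith
  qed
  then show ?thesis by blast
qed

lemma continuous_indicator_clopen:
  assumes "open A" "closed A"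
  shows "continuous_on UNIV (indicator A :: 'a::topological_space \<Rightarrow> real)"
proof -
  have "open ((indicator A :: 'a \<Rightarrow> real) -` B)" for B :: "real set"
  proof -
    have "(indicator A :: 'a \<Rightarrow> real) -` B
        = (if 1 \<in> B then A else {}) \<union> (if 0 \<in> B then - A else {})"
      by (auto simp: indicator_def of_bool_def split: if_splits)
    then show ?thesis using assms by (auto simp: open_Un)
  qed
  then show ?thesis by (simp add: continuous_on_open_vimage)
qed

lemma continuous_patch:
  "continuous_on UNIV (patch \<Lambda> \<xi> :: (int \<Rightarrow> 's::topological_space) \<Rightarrow> _)"
proof (rule continuous_on_coordinatewise_then_product)
  fix i
  show "continuous_on UNIV (\<lambda>x. patch \<Lambda> \<xi> x i)"
    by (cases "i \<in> \<Lambda>") (simp_all add: patch_def continuous_on_product_coordinates)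
qed

section \<open>An invariant mean compatible with the specification\<close>

definition bdd_fun :: "('a \<Rightarrow> real) \<Rightarrow> bool" where
  "bdd_fun F \<longleftrightarrow> (\<exists>M. \<forall>x. \<bar>F x\<bar> \<le> M)"

lemma bdd_fun_add: "bdd_fun F \<Longrightarrow> bdd_fun G \<Longrightarrow> bdd_fun (\<lambda>x. F x + G x)"
  unfolding bdd_fun_def by (meson abs_triangle_ineq add_mono order_trans)

lemma bdd_fun_cmult: "bdd_fun F \<Longrightarrow> bdd_fun (\<lambda>x. c * F x)"
  unfolding bdd_fun_def abs_mult by (meson abs_ge_zero mult_left_mono)

lemma bdd_fun_const: "bdd_fun (\<lambda>_. c)"
  unfolding bdd_fun_def by blast

lemma bdd_fun_indicator: "bdd_fun (indicator A)"
  unfolding bdd_fun_def by (rule exI[of _ 1]) (simp add: indicator_def)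

lemma bdd_fun_compose: "bdd_fun F \<Longrightarrow> bdd_fun (\<lambda>x. F (h x))"
  unfolding bdd_fun_def by blast

locale invariant_specification =
  fixes \<phi> :: "int set \<Rightarrow> (int \<Rightarrow> 's::{finite, discrete_topology}) \<Rightarrow> real"
  assumes spec: "is_specification \<phi>" and cont: "continuous_spec \<phi>" and inv: "shift_invariant_spec \<phi>"
begin

lemma spec_avg_shift:
  assumes "finite \<Lambda>" "\<Lambda> \<noteq> {}"
  shows "spec_avg \<phi> \<Lambda> F ((shift ^^ n) x) = spec_avg \<phi> ((+) (int n) ` \<Lambda>) (\<lambda>y. F ((shift ^^ n) y)) x"
proof -
  have \<phi>: "\<phi> ((+) (int n) ` \<Lambda>) y = \<phi> \<Lambda> (shift_pow (int n) y)" for y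
    using inv assms by (simp add: shift_invariant_spec_def)
  show ?thesis
    unfolding spec_avg_def \<phi> shift_pow_of_nat[symmetric]
  proof (rule sum.reindex_bij_witness[of _ "shift_pow (int n)" "shift_pow (- int n)"])
    fix y assume "y \<in> cyl (- \<Lambda>) (shift_pow (int n) x)"
    then have y: "y j = x (j + int n)" if "j \<notin> \<Lambda>" for j using that by (simp add: cyl_iff shift_pow_def)
    show "shift_pow (int n) (shift_pow (- int n) y) = y" by (simp add: shift_pow_def)
    show "shift_pow (- int n) y \<in> cyl (- (+) (int n) ` \<Lambda>) x"
      unfolding cyl_iff
    proof
      fix i assume "i \<in> - (+) (int n) ` \<Lambda>"
      then have "i - int n \<notin> \<Lambda>" by force
      then show "shift_pow (- int n) y i = x i" using y[of "i - int n"] by (simp add: shift_pow_def)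
    qed
    show "\<phi> \<Lambda> (shift_pow (int n) (shift_pow (- int n) y)) * F (shift_pow (int n) (shift_pow (- int n) y))
        = \<phi> \<Lambda> y * F y" by (simp add: shift_pow_def)
  next
    fix y assume "y \<in> cyl (- (+) (int n) ` \<Lambda>) x"
    then have y: "y i = x i" if "i \<notin> (+) (int n) ` \<Lambda>" for i using that by (simp add: cyl_iff)
    show "shift_pow (- int n) (shift_pow (int n) y) = y" by (simp add: shift_pow_def)
    show "shift_pow (int n) y \<in> cyl (- \<Lambda>) (shift_pow (int n) x)"
      unfolding cyl_iff
    proof
      fix j assume "j \<in> - \<Lambda>"
      then have "j + int n \<notin> (+) (int n) ` \<Lambda>" by auto
      then show "shift_pow (int n) y j = shift_pow (int n) x j" using y by (simp add: shift_pow_def)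
    qed
  qed
qed

text \<open>The boundary condition is arbitrary. Radius 2 * N leaves room for all translates i +
  \<Lambda>, i < N, of a set \<Lambda> within [-N, N], so that \<open>cesaro_spec_avg\<close> is an
  exact identity for large N.\<close>

definition cesaro :: "nat \<Rightarrow> ((int \<Rightarrow> 's) \<Rightarrow> real) \<Rightarrow> real" where
  "cesaro N F = (\<Sum>i<N. spec_avg \<phi> (window (2 * N)) (\<lambda>x. F ((shift ^^ i) x)) undefined) / real N"

lemma window_nonempty: "window n \<noteq> {}" by (simp add: window_def)

lemma cesaro_bounds:
  assumes "\<And>x. l \<le> F x \<and> F x \<le> u" "0 < N"
  shows "l \<le> cesaro N F \<and> cesaro N F \<le> u"
proof -
  have b: "l \<le> spec_avg \<phi> (window (2 * N)) (\<lambda>x. F ((shift ^^ i) x)) undefined \<and>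
      spec_avg \<phi> (window (2 * N)) (\<lambda>x. F ((shift ^^ i) x)) undefined \<le> u" for i
    using assms(1) by (intro spec_avg_bounds[OF spec finite_window window_nonempty])
  have "(\<Sum>i<N. l) \<le> (\<Sum>i<N. spec_avg \<phi> (window (2 * N)) (\<lambda>x. F ((shift ^^ i) x)) undefined)"
    "(\<Sum>i<N. spec_avg \<phi> (window (2 * N)) (\<lambda>x. F ((shift ^^ i) x)) undefined) \<le> (\<Sum>i<N. u)"
    using b by (intro sum_mono; blast)+
  then show ?thesis using assms(2) by (simp add: cesaro_def field_simps)
qed

lemma cesaro_add: "cesaro N (\<lambda>x. F x + G x) = cesaro N F + cesaro N G"
  by (simp add: cesaro_def spec_avg_def distrib_left sum.distrib add_divide_distrib)

lemma cesaro_cmult: "cesaro N (\<lambda>x. r * F x) = r * cesaro N F"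
  unfolding cesaro_def spec_avg_cmult by (simp add: sum_distrib_left)

lemma cesaro_shift:
  assumes "\<And>x. \<bar>F x\<bar> \<le> M"
  shows "\<bar>cesaro N (\<lambda>x. F (shift x)) - cesaro N F\<bar> \<le> 2 * M / real N"
proof -
  define a where "a i = spec_avg \<phi> (window (2 * N)) (\<lambda>x. F ((shift ^^ i) x)) undefined" for i
  have a: "\<bar>a i\<bar> \<le> M" for i
    using spec_avg_bounds[OF spec finite_window window_nonempty, where l="- M" and u=M
        and F="\<lambda>x. F ((shift ^^ i) x)"] assms
    unfolding a_def by (simp add: abs_le_iff minus_le_iff)
  have "\<bar>a N - a 0\<bar> \<le> 2 * M" using a[of N] a[of 0] by linarith
  moreover have "cesaro N (\<lambda>x. F (shift x)) - cesaro N F = (a N - a 0) / real N"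
  proof -
    have "spec_avg \<phi> (window (2 * N)) (\<lambda>x. F (shift ((shift ^^ i) x))) undefined = a (Suc i)" for i
      by (simp add: a_def)
    then have "cesaro N (\<lambda>x. F (shift x)) = (\<Sum>i<N. a (Suc i)) / real N" by (simp add: cesaro_def)
    moreover have "cesaro N F = (\<Sum>i<N. a i) / real N" by (simp add: cesaro_def a_def)
    ultimately show ?thesis
      by (simp only: diff_divide_distrib[symmetric] sum_subtractf[symmetric] sum_lessThan_telescope)
  qed
  ultimately show ?thesis by (simp add: divide_right_mono)
qed

lemma cesaro_spec_avg:
  assumes "finite \<Lambda>" "\<Lambda> \<noteq> {}"
  shows "\<forall>\<^sub>F N in sequentially. cesaro N (spec_avg \<phi> \<Lambda> F) = cesaro N F"
proof -
  define n where "n = Max ((\<lambda>i. nat \<bar>i\<bar>) ` \<Lambda>)"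
  have n: "nat \<bar>i\<bar> \<le> n" if "i \<in> \<Lambda>" for i unfolding n_def using assms that by (intro Max_ge) auto
  show ?thesis
    using eventually_ge_at_top[of n]
  proof eventually_elim
    case (elim N)
    have "spec_avg \<phi> (window (2 * N)) (\<lambda>x. spec_avg \<phi> \<Lambda> F ((shift ^^ i) x)) undefined
        = spec_avg \<phi> (window (2 * N)) (\<lambda>x. F ((shift ^^ i) x)) undefined" if "i < N" for i
      unfolding spec_avg_shift[OF assms]
    proof (rule spec_avg_tower[OF spec finite_window])
      show "(+) (int i) ` \<Lambda> \<subseteq> window (2 * N)"
        using n that elim by (force simp: window_def)
    qed (use assms in simp)
    then show ?case unfolding cesaro_def by simp
  qed
qed

lemma invariant_mean:
  obtains I where
    "\<And>F G. bdd_fun F \<Longrightarrow> bdd_fun G \<Longrightarrow> I (\<lambda>x. F x + G x) = I F + I G"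
    "\<And>F r. bdd_fun F \<Longrightarrow> I (\<lambda>x. r * F x) = r * I F"
    "\<And>F l u. (\<And>x. l \<le> F x \<and> F x \<le> u) \<Longrightarrow> l \<le> I F \<and> I F \<le> u"
    "\<And>F. bdd_fun F \<Longrightarrow> I (\<lambda>x. F (shift x)) = I F"
    "\<And>F \<Lambda>. bdd_fun F \<Longrightarrow> finite \<Lambda> \<Longrightarrow> \<Lambda> \<noteq> {} \<Longrightarrow> I (spec_avg \<phi> \<Lambda> F) = I F"
proof -
  \<comment> \<open>The dummy value 0 makes J bounded at every F, and \<open>Suc N\<close> avoids an
    empty average.\<close>
  define J where "J N F = (if bdd_fun F then cesaro (Suc N) F else 0)" for N F
  have "\<exists>b. \<forall>N. \<bar>J N F\<bar> \<le> b" for F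
  proof (cases "bdd_fun F")
    case True
    then obtain M where M: "\<And>x. \<bar>F x\<bar> \<le> M" by (auto simp: bdd_fun_def)
    have "- M \<le> F x \<and> F x \<le> M" for x using M[of x] by linarith
    then have "\<bar>J N F\<bar> \<le> M" for N
      using cesaro_bounds[of "- M" F M "Suc N"] True by (simp add: J_def abs_le_iff minus_le_iff)
    then show ?thesis by blast
  qed (auto simp: J_def)
  then obtain \<F> I where \<F>: "\<F> \<noteq> bot" "\<F> \<le> sequentially" and lim: "\<And>F. ((\<lambda>N. J N F) \<longlongrightarrow> I F) \<F>"
    by (rule cluster_filter[where J=J]) blast
  have lim': "((\<lambda>N. cesaro (Suc N) F) \<longlongrightarrow> I F) \<F>" if "bdd_fun F" for F
    using lim[of F] that by (simp add: J_def)
  note uniq = tendsto_unique[OF \<F>(1)]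
  show thesis
  proof (rule that)
    fix F G :: "(int \<Rightarrow> 's) \<Rightarrow> real" assume FG: "bdd_fun F" "bdd_fun G"
    show "I (\<lambda>x. F x + G x) = I F + I G"
      using uniq[OF lim'[OF bdd_fun_add[OF FG]]] tendsto_add[OF lim'[OF FG(1)] lim'[OF FG(2)]]
      by (simp add: cesaro_add)
  next
    fix F :: "(int \<Rightarrow> 's) \<Rightarrow> real" and r assume F: "bdd_fun F"
    show "I (\<lambda>x. r * F x) = r * I F"
      using uniq[OF lim'[OF bdd_fun_cmult[OF F]]] tendsto_mult_left[OF lim'[OF F], of r]
      by (simp add: cesaro_cmult)
  next
    fix F :: "(int \<Rightarrow> 's) \<Rightarrow> real" and l u assume b: "\<And>x. l \<le> F x \<and> F x \<le> u"
    have "\<bar>F x\<bar> \<le> max \<bar>l\<bar> \<bar>u\<bar>" for x using b[of x] by (auto simp: abs_le_iff le_max_iff_disj)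
    then have "bdd_fun F" by (auto simp: bdd_fun_def)
    note L = lim'[OF this]
    have "\<forall>\<^sub>F N in \<F>. l \<le> cesaro (Suc N) F" "\<forall>\<^sub>F N in \<F>. cesaro (Suc N) F \<le> u"
      using cesaro_bounds[OF b] by (auto intro!: always_eventually)
    then show "l \<le> I F \<and> I F \<le> u"
      using tendsto_lowerbound[OF L _ \<F>(1)] tendsto_upperbound[OF L _ \<F>(1)] by blast
  next
    fix F :: "(int \<Rightarrow> 's) \<Rightarrow> real" assume F: "bdd_fun F"
    then obtain M where M: "\<And>x. \<bar>F x\<bar> \<le> M" by (auto simp: bdd_fun_def)
    have "(\<lambda>N. 2 * M / real (Suc N)) \<longlonglongrightarrow> 0"
      using LIMSEQ_Suc[OF lim_const_over_n] by simp
    then have "(\<lambda>N. cesaro (Suc N) (\<lambda>x. F (shift x)) - cesaro (Suc N) F) \<longlonglongrightarrow> 0"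
    proof (rule Lim_null_comparison[rotated])
      show "\<forall>\<^sub>F N in sequentially. norm (cesaro (Suc N) (\<lambda>x. F (shift x)) - cesaro (Suc N) F)
          \<le> 2 * M / real (Suc N)"
        using cesaro_shift[OF M] by (intro always_eventually allI) (simp only: real_norm_def)
    qed
    then have "((\<lambda>N. cesaro (Suc N) (\<lambda>x. F (shift x)) - cesaro (Suc N) F) \<longlongrightarrow> 0) \<F>"
      by (rule tendsto_mono[OF \<F>(2)])
    from uniq[OF tendsto_diff[OF lim'[OF bdd_fun_compose[OF F, of shift]] lim'[OF F]] this]
    show "I (\<lambda>x. F (shift x)) = I F" by simp
  next
    fix F :: "(int \<Rightarrow> 's) \<Rightarrow> real" and \<Lambda> :: "int set" assume F: "bdd_fun F" and \<Lambda>: "finite \<Lambda>" "\<Lambda> \<noteq> {}"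
    then obtain M where M: "\<And>x. \<bar>F x\<bar> \<le> M" by (auto simp: bdd_fun_def)
    have "- M \<le> F y \<and> F y \<le> M" for y using M[of y] by linarith
    then have "\<bar>spec_avg \<phi> \<Lambda> F x\<bar> \<le> M" for x
      using spec_avg_bounds[OF spec \<Lambda>, of x "- M" F M] by (simp add: abs_le_iff minus_le_iff)
    then have b: "bdd_fun (spec_avg \<phi> \<Lambda> F)" by (auto simp: bdd_fun_def)
    have "\<forall>\<^sub>F N in sequentially. cesaro (Suc N) (spec_avg \<phi> \<Lambda> F) = cesaro (Suc N) F"
      using cesaro_spec_avg[OF \<Lambda>, of F] by (rule eventually_compose_filterlim[OF _ filterlim_Suc])
    then have "\<forall>\<^sub>F N in \<F>. cesaro (Suc N) (spec_avg \<phi> \<Lambda> F) = cesaro (Suc N) F"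
      using \<F>(2) by (rule filter_leD[rotated])
    then have "((\<lambda>N. cesaro (Suc N) F) \<longlongrightarrow> I (spec_avg \<phi> \<Lambda> F)) \<F>"
      using lim'[OF b] tendsto_cong by fast
    then show "I (spec_avg \<phi> \<Lambda> F) = I F" by (rule uniq[OF _ lim'[OF F]])
  qed
qed

end

section \<open>From the mean to a measure\<close>

lemma sigma_sets_clopen:
  "sigma_sets UNIV {A. open A \<and> closed A} = sets (borel :: (int \<Rightarrow> 's::{finite, discrete_topology}) measure)"
proof
  show "sigma_sets UNIV {A. open A \<and> closed A} \<subseteq> sets (borel :: (int \<Rightarrow> 's) measure)"
    by (auto intro!: sets.sigma_sets_subset[of _ borel, simplified] borel_open)
  show "sets (borel :: (int \<Rightarrow> 's) measure) \<subseteq> sigma_sets UNIV {A. open A \<and> closed A}"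
    unfolding sets_borel_windows
    by (rule sigma_sets_mono') (auto simp: windows_def open_cyl finite_window closed_cyl)
qed

text \<open>By compactness, a finitely additive probability on the clopen sets is countably additive there.\<close>

lemma mean_representation:
  fixes I :: "((int \<Rightarrow> 's::{finite, discrete_topology}) \<Rightarrow> real) \<Rightarrow> real"
  assumes add: "\<And>F G. bdd_fun F \<Longrightarrow> bdd_fun G \<Longrightarrow> I (\<lambda>x. F x + G x) = I F + I G"
    and cmult: "\<And>F r. bdd_fun F \<Longrightarrow> I (\<lambda>x. r * F x) = r * I F"
    and bounds: "\<And>F l u. (\<And>x. l \<le> F x \<and> F x \<le> u) \<Longrightarrow> l \<le> I F \<and> I F \<le> u"
  shows "\<exists>\<mu>. prob_space \<mu> \<and> sets \<mu> = sets borel \<and>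
    (\<forall>F. continuous_on UNIV F \<longrightarrow> (\<integral>x. F x \<partial>\<mu>) = I F)"
proof -
  define M where "M = {A :: (int \<Rightarrow> 's) set. open A \<and> closed A}"
  interpret M: algebra UNIV M
    by (auto simp: algebra_iff_Un M_def open_Compl closed_Compl simp flip: Compl_eq_Diff_UNIV)
  define f where "f A = ennreal (I (indicator A))" for A
  have I_nonneg: "0 \<le> I (indicator A)" for A
    using bounds[of 0 "indicator A" 1] by (simp add: indicator_def)
  have I_const: "I (\<lambda>_. r) = r" for r using bounds[of r "\<lambda>_. r" r] by simp
  have "indicator {} = (\<lambda>_ :: int \<Rightarrow> 's. 0 :: real)" "indicator UNIV = (\<lambda>_ :: int \<Rightarrow> 's. 1 :: real)"
    by (auto simp: fun_eq_iff)
  then have I_ind: "I (indicator {}) = 0" "I (indicator UNIV) = 1" using I_const by simp_all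
  have f_empty: "f {} = 0" using I_ind by (simp add: f_def)
  have "\<exists>\<mu>0 :: (int \<Rightarrow> 's) set \<Rightarrow> ennreal. (\<forall>s\<in>M. \<mu>0 s = f s) \<and> measure_space UNIV (sigma_sets UNIV M) \<mu>0"
  proof (rule M.caratheodory_empty_continuous)
    show "positive M f" using f_empty by (simp add: positive_def)
    show "additive M f"
      unfolding additive_def
    proof (intro ballI impI)
      fix A B :: "(int \<Rightarrow> 's) set" assume "A \<inter> B = {}"
      then have "indicator (A \<union> B) = (\<lambda>x. indicator A x + indicator B x :: real)"
        by (auto simp: indicator_def fun_eq_iff)
      then show "f (A \<union> B) = f A + f B"
        by (simp add: f_def add bdd_fun_indicator ennreal_plus I_nonneg)
    qed
    show "f A \<noteq> \<infinity>" for A by (simp add: f_def)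
  next
    fix A :: "nat \<Rightarrow> (int \<Rightarrow> 's) set" assume A: "range A \<subseteq> M" "decseq A" "(\<Inter>i. A i) = {}"
    have "\<exists>n. A n = {}"
    proof (rule ccontr)
      assume ne: "\<nexists>n. A n = {}"
      have "UNIV \<inter> \<Inter>(range A) \<noteq> {}"
      proof (rule compact_imp_fip[OF compact_configurations])
        show "closed T" if "T \<in> range A" for T using that A(1) by (auto simp: M_def)
        fix \<T> assume "finite \<T>" "\<T> \<subseteq> range A"
        then obtain S where S: "finite S" "\<T> = A ` S" by (meson finite_subset_image)
        have "A (Max (insert 0 S)) \<subseteq> A i" if "i \<in> S" for i
          using A(2) S(1) that by (simp add: decseq_def)
        then have "A (Max (insert 0 S)) \<subseteq> \<Inter>\<T>" unfolding S(2) by blast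
        then show "UNIV \<inter> \<Inter>\<T> \<noteq> {}" using ne by auto
      qed
      then show False using A(3) by simp
    qed
    then obtain n where "A n = {}" ..
    then have "A m = {}" if "n \<le> m" for m using A(2) that by (auto simp: decseq_def)
    then have "\<forall>\<^sub>F m in sequentially. f (A m) = 0"
      using f_empty unfolding eventually_sequentially by (intro exI[of _ n]) simp
    then show "(\<lambda>i. f (A i)) \<longlonglongrightarrow> 0" by (rule tendsto_eventually)
  qed
  then obtain \<mu>0 where \<mu>0: "\<And>A. A \<in> M \<Longrightarrow> \<mu>0 A = f A" "measure_space UNIV (sigma_sets UNIV M) \<mu>0" by blast
  define \<mu> where "\<mu> = measure_of UNIV M \<mu>0"
  have sets: "sets \<mu> = sets borel"
    unfolding \<mu>_def using sigma_sets_clopen by (simp add: M_def)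
  have space: "space \<mu> = UNIV" by (simp add: \<mu>_def space_measure_of_conv)
  have em: "emeasure \<mu> A = ennreal (I (indicator A))" if "A \<in> M" for A
  proof -
    have "sets \<mu> = sigma_sets UNIV M" by (simp add: \<mu>_def)
    then show ?thesis
      using \<mu>0 that by (subst emeasure_measure_of[OF \<mu>_def]) (auto simp: measure_space_def f_def)
  qed
  have "UNIV \<in> M" by (simp add: M_def)
  then have "emeasure \<mu> UNIV = 1" using em[of UNIV] I_ind by simp
  then have prob: "prob_space \<mu>" by (intro prob_spaceI) (simp add: space)
  interpret prob_space \<mu> by fact
  have local: "(\<integral>x. (\<Sum>\<xi>\<in>C. r \<xi> * indicator (cyl (window n) \<xi>) x) \<partial>\<mu>)
      = I (\<lambda>x. \<Sum>\<xi>\<in>C. r \<xi> * indicator (cyl (window n) \<xi>) x)" if "finite C" for C :: "(int \<Rightarrow> 's) set" and r n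
  proof -
    have meas: "cyl (window n) \<xi> \<in> sets \<mu>" for \<xi>
      unfolding sets by (intro borel_open open_cyl finite_window)
    have m: "measure \<mu> (cyl (window n) \<xi>) = I (indicator (cyl (window n) \<xi>))" for \<xi>
      using em[of "cyl (window n) \<xi>"] I_nonneg
      by (simp add: M_def open_cyl closed_cyl finite_window measure_def)
    have "(\<integral>x. (\<Sum>\<xi>\<in>C. r \<xi> * indicator (cyl (window n) \<xi>) x) \<partial>\<mu>)
        = (\<Sum>\<xi>\<in>C. r \<xi> * I (indicator (cyl (window n) \<xi>)))"
      using meas by (subst Bochner_Integration.integral_sum) (auto simp: m space less_top[symmetric])
    also have "\<dots> = I (\<lambda>x. \<Sum>\<xi>\<in>C. r \<xi> * indicator (cyl (window n) \<xi>) x) \<and>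
        bdd_fun (\<lambda>x. \<Sum>\<xi>\<in>C. r \<xi> * indicator (cyl (window n) \<xi>) x :: real)"
      using that
    proof induction
      case (insert \<xi> C)
      have eq: "(\<lambda>x. \<Sum>\<xi>\<in>insert \<xi> C. r \<xi> * indicator (cyl (window n) \<xi>) x)
          = (\<lambda>x. r \<xi> * indicator (cyl (window n) \<xi>) x + (\<Sum>\<xi>\<in>C. r \<xi> * indicator (cyl (window n) \<xi>) x))"
        by (rule ext) (rule sum.insert[OF insert(1,2)])
      have ind: "bdd_fun (\<lambda>x. r \<xi> * indicator (cyl (window n) \<xi>) x)"
        by (rule bdd_fun_cmult[OF bdd_fun_indicator])
      have IH: "I (\<lambda>x. \<Sum>\<xi>\<in>C. r \<xi> * indicator (cyl (window n) \<xi>) x)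
          = (\<Sum>\<xi>\<in>C. r \<xi> * I (indicator (cyl (window n) \<xi>)))"
        and bdd: "bdd_fun (\<lambda>x. \<Sum>\<xi>\<in>C. r \<xi> * indicator (cyl (window n) \<xi>) x :: real)"
        using insert(3) by simp_all
      show ?case
        unfolding eq add[OF ind bdd] IH cmult[OF bdd_fun_indicator] sum.insert[OF insert(1,2)]
        using bdd_fun_add[OF ind bdd] by blast
    qed (simp add: I_const bdd_fun_const)
    finally show ?thesis by blast
  qed
  have "(\<integral>x. F x \<partial>\<mu>) = I F" if F: "continuous_on UNIV F" for F
  proof -
    have "compact (range F)" using compact_continuous_image[OF F compact_configurations] .
    then obtain b where b: "\<And>x. \<bar>F x\<bar> \<le> b"
      using compact_imp_bounded bounded_iff by (metis rangeI real_norm_def)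
    have F_bdd: "bdd_fun F" using b by (auto simp: bdd_fun_def)
    have F_int: "integrable \<mu> F"
      using b borel_measurable_continuous_onI[OF F] measurable_cong_sets[OF sets refl]
      by (intro integrable_const_bound[of _ b]) auto
    have "\<bar>(\<integral>x. F x \<partial>\<mu>) - I F\<bar> \<le> 0 + e" if e: "0 < e" for e
    proof -
      obtain n where n: "\<And>x y. (\<forall>i\<in>window n. x i = y i) \<Longrightarrow> \<bar>F x - F y\<bar> \<le> e / 2"
        using uniform_window[OF F, of "e / 2"] e by auto
      define x0 where "x0 = (undefined :: int \<Rightarrow> 's)"
      define C where "C = cyl (- window n) x0"
      have C: "finite C" unfolding C_def by (rule finite_cyl[OF finite_window])
      \<comment> \<open>G depends on the window only and is within e / 2 of F; as a combination of
        cylinder indicators it has integral I G.\<close>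
      define G where "G x = F (patch (window n) x x0)" for x
      have G_eq: "G = (\<lambda>x. \<Sum>\<xi>\<in>C. F \<xi> * indicator (cyl (window n) \<xi>) x)"
      proof
        fix x
        have "G x = (\<Sum>\<xi>\<in>C. G (patch (window n) \<xi> x) * indicator (cyl (window n) \<xi>) x)"
          unfolding C_def by (rule patch_decomposition[OF finite_window])
        also have "\<dots> = (\<Sum>\<xi>\<in>C. F \<xi> * indicator (cyl (window n) \<xi>) x)"
        proof (rule sum.cong[OF refl])
          fix \<xi> assume "\<xi> \<in> C"
          then have "patch (window n) (patch (window n) \<xi> x) x0 = \<xi>"
            by (auto simp: C_def cyl_iff patch_def)
          then show "G (patch (window n) \<xi> x) * indicator (cyl (window n) \<xi>) x
            = F \<xi> * indicator (cyl (window n) \<xi>) x" by (simp add: G_def)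
        qed
        finally show "G x = (\<Sum>\<xi>\<in>C. F \<xi> * indicator (cyl (window n) \<xi>) x)" .
      qed
      have IG: "(\<integral>x. G x \<partial>\<mu>) = I G" unfolding G_eq by (rule local[OF C])
      have FG: "\<bar>F x - G x\<bar> \<le> e / 2" for x
        unfolding G_def by (rule n) (simp add: patch_def)
      have G_bdd: "bdd_fun G" unfolding G_def using b by (auto simp: bdd_fun_def)
      have G_int: "integrable \<mu> G"
      proof -
        have "cyl (window n) \<xi> \<in> sets \<mu>" for \<xi>
          unfolding sets by (intro borel_open open_cyl finite_window)
        then show ?thesis unfolding G_eq
          by (intro Bochner_Integration.integrable_sum integrable_mult_right integrable_real_indicator)
            (auto simp: less_top[symmetric])
      qed
      have "I (\<lambda>x. F x + (-1) * G x) = I F + (-1) * I G"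
        by (simp only: add[OF F_bdd bdd_fun_cmult[OF G_bdd]] cmult[OF G_bdd])
      moreover have "- (e / 2) \<le> I (\<lambda>x. F x + (-1) * G x) \<and> I (\<lambda>x. F x + (-1) * G x) \<le> e / 2"
      proof (rule bounds)
        show "- (e / 2) \<le> F x + (-1) * G x \<and> F x + (-1) * G x \<le> e / 2" for x
          using FG[of x] by linarith
      qed
      ultimately have 1: "\<bar>I F - I G\<bar> \<le> e / 2" by linarith
      have "(\<integral>x. F x \<partial>\<mu>) - (\<integral>x. G x \<partial>\<mu>) = (\<integral>x. F x - G x \<partial>\<mu>)"
        using F_int G_int by simp
      moreover have "(\<integral>x. F x - G x \<partial>\<mu>) \<le> e / 2" "- (e / 2) \<le> (\<integral>x. F x - G x \<partial>\<mu>)"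
      proof -
        have "- (e / 2) \<le> F x - G x" "F x - G x \<le> e / 2" for x using FG[of x] by linarith+
        then have ae: "AE x in \<mu>. - (e / 2) \<le> F x - G x" "AE x in \<mu>. F x - G x \<le> e / 2"
          by (intro AE_I2; blast)+
        have "integrable \<mu> (\<lambda>x. F x - G x)" using F_int G_int by simp
        then show "(\<integral>x. F x - G x \<partial>\<mu>) \<le> e / 2" "- (e / 2) \<le> (\<integral>x. F x - G x \<partial>\<mu>)"
          by (rule integral_le_const[OF _ ae(2)], rule integral_ge_const[OF _ ae(1)])
      qed
      ultimately have "\<bar>(\<integral>x. F x \<partial>\<mu>) - (\<integral>x. G x \<partial>\<mu>)\<bar> \<le> e / 2" by linarith
      then show ?thesis using 1 IG by linarith
    qed
    then have "\<bar>(\<integral>x. F x \<partial>\<mu>) - I F\<bar> \<le> 0" by (rule field_le_epsilon)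
    then show ?thesis by simp
  qed
  then show ?thesis using prob sets by blast
qed

context invariant_specification
begin

text \<open>The mean is known to be an integral only on continuous functions, so its invariance
  under averages is first used for clopen sets and then extended to Borel sets by uniqueness of
  finite measures.\<close>

theorem invariant_gibbs_exists: "\<exists>\<mu>. gibbs_state \<phi> \<mu> \<and> shift_invariant_measure \<mu>"
proof -
  obtain I where add: "\<And>F G. bdd_fun F \<Longrightarrow> bdd_fun G \<Longrightarrow> I (\<lambda>x. F x + G x) = I F + I G"
    and cmult: "\<And>F r. bdd_fun F \<Longrightarrow> I (\<lambda>x. r * F x) = r * I F"
    and bounds: "\<And>F l u. (\<And>x. l \<le> F x \<and> F x \<le> u) \<Longrightarrow> l \<le> I F \<and> I F \<le> u"
    and I_shift: "\<And>F. bdd_fun F \<Longrightarrow> I (\<lambda>x. F (shift x)) = I F"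
    and I_avg: "\<And>F \<Lambda>. bdd_fun F \<Longrightarrow> finite \<Lambda> \<Longrightarrow> \<Lambda> \<noteq> {} \<Longrightarrow> I (spec_avg \<phi> \<Lambda> F) = I F"
    by (rule invariant_mean) blast
  obtain \<mu> where prob: "prob_space \<mu>" and sets: "sets \<mu> = sets borel"
    and rep: "\<And>F. continuous_on UNIV F \<Longrightarrow> (\<integral>x. F x \<partial>\<mu>) = I F"
    using mean_representation[where I=I, OF add cmult bounds] by blast
  interpret prob_space \<mu> by (rule prob)
  have space: "space \<mu> = UNIV" using sets_eq_imp_space_eq[OF sets] by simp
  note meas_eq = measurable_cong_sets[OF sets refl]
  have clopen: "measure \<mu> A = I (indicator A)" if "open A" "closed A" for A
    using rep[OF continuous_indicator_clopen[OF that]] by (simp add: space)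
  have "gibbs_state \<phi> \<mu>"
    unfolding gibbs_state_def
  proof (intro conjI allI impI prob sets)
    fix \<Lambda> :: "int set" assume "finite \<Lambda> \<and> \<Lambda> \<noteq> {}"
    then have \<Lambda>: "finite \<Lambda>" "\<Lambda> \<noteq> {}" by auto
    define \<F> where "\<F> = (coord_algebra (- \<Lambda>) :: (int \<Rightarrow> 's) measure)"
    have sub: "subalgebra \<mu> \<F>" unfolding \<F>_def by (rule subalgebra_coord_algebra[OF sets])
    interpret fs: finite_measure_subalgebra \<mu> \<F> by unfold_locales (rule sub)
    have \<phi>_meas: "\<phi> \<Lambda> \<in> borel_measurable borel" and \<phi>_nonneg: "\<And>x. 0 \<le> \<phi> \<Lambda> x"
      using spec \<Lambda> by (auto simp: is_specification_def)
    have \<phi>_cont: "continuous_on UNIV (\<phi> \<Lambda>)" using cont \<Lambda> by (simp add: continuous_spec_def)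
    have \<phi>_le: "\<phi> \<Lambda> x \<le> 1" for x
    proof -
      have "\<phi> \<Lambda> x \<le> (\<Sum>y\<in>cyl (- \<Lambda>) x. \<phi> \<Lambda> y)"
        using \<phi>_nonneg finite_cyl[OF \<Lambda>(1)] by (intro member_le_sum) (auto simp: cyl_iff)
      then show ?thesis using spec \<Lambda> by (simp add: is_specification_def)
    qed
    have cond: "AE x in \<mu>. real_cond_exp \<mu> \<F> (indicator (cyl \<Lambda> \<xi>)) x = \<phi> \<Lambda> (patch \<Lambda> \<xi> x)" for \<xi>
    proof -
      define h where "h x = \<phi> \<Lambda> (patch \<Lambda> \<xi> x)" for x
      have h_cont: "continuous_on UNIV h"
        unfolding h_def using continuous_on_compose2[OF \<phi>_cont continuous_patch] by simp
      have h_meas: "h \<in> borel_measurable borel" by (rule borel_measurable_continuous_onI[OF h_cont])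
      have h_nonneg: "0 \<le> h x" and h_le: "h x \<le> 1" for x using \<phi>_nonneg \<phi>_le by (simp_all add: h_def)
      have C: "cyl \<Lambda> \<xi> \<in> sets \<mu>" unfolding sets by (intro borel_open open_cyl \<Lambda>)
      \<comment> \<open>D' is the restriction of \<open>\<mu>\<close> to the cylinder of \<xi>; D is
        what the specification prescribes for it, namely weighting by h and writing \<xi> into
        \<Lambda>.\<close>
      define D where "D = distr (density \<mu> (\<lambda>x. ennreal (h x))) borel (patch \<Lambda> \<xi>)"
      define D' where "D' = density \<mu> (indicator (cyl \<Lambda> \<xi>))"
      have hp_int: "integrable \<mu> (\<lambda>x. h x * indicator (patch \<Lambda> \<xi> -` A) x)" if "A \<in> sets borel" for A
      proof (rule integrable_const_bound[of _ 1])
        have "patch \<Lambda> \<xi> -` A \<in> sets borel"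
          using measurable_sets[OF patch_borel that, of \<Lambda> \<xi>] by simp
        then show "(\<lambda>x. h x * indicator (patch \<Lambda> \<xi> -` A) x) \<in> borel_measurable \<mu>"
          unfolding meas_eq using h_meas by measurable
      qed (use h_nonneg h_le in \<open>auto simp: indicator_def\<close>)
      have D: "emeasure D A = ennreal (\<integral>x. h x * indicator (patch \<Lambda> \<xi> -` A) x \<partial>\<mu>)" if A: "A \<in> sets borel" for A
      proof -
        have pA: "patch \<Lambda> \<xi> -` A \<in> sets \<mu>"
          using measurable_sets[OF patch_borel A, of \<Lambda> \<xi>] by (simp add: sets)
        have "emeasure D A = emeasure (density \<mu> (\<lambda>x. ennreal (h x))) (patch \<Lambda> \<xi> -` A)"
          unfolding D_def using A patch_borel
          by (subst emeasure_distr) (auto simp: meas_eq space)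
        also have "\<dots> = (\<integral>\<^sup>+x. ennreal (h x) * indicator (patch \<Lambda> \<xi> -` A) x \<partial>\<mu>)"
          using pA h_meas by (subst emeasure_density) (auto simp: meas_eq)
        also have "\<dots> = (\<integral>\<^sup>+x. ennreal (h x * indicator (patch \<Lambda> \<xi> -` A) x) \<partial>\<mu>)"
          by (intro nn_integral_cong) (auto simp: indicator_def)
        also have "\<dots> = ennreal (\<integral>x. h x * indicator (patch \<Lambda> \<xi> -` A) x \<partial>\<mu>)"
          by (rule nn_integral_eq_integral[OF hp_int[OF A]]) (simp add: h_nonneg)
        finally show ?thesis .
      qed
      have D': "emeasure D' A = ennreal (measure \<mu> (A \<inter> cyl \<Lambda> \<xi>))" if A: "A \<in> sets borel" for A
      proof -
        have "emeasure D' A = (\<integral>\<^sup>+x. indicator (cyl \<Lambda> \<xi>) x * indicator A x \<partial>\<mu>)"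
          unfolding D'_def using A
          by (subst emeasure_density[OF borel_measurable_indicator[OF C]]) (simp_all add: sets)
        also have "\<dots> = (\<integral>\<^sup>+x. indicator (A \<inter> cyl \<Lambda> \<xi>) x \<partial>\<mu>)"
          by (intro nn_integral_cong) (auto simp: indicator_def)
        also have "\<dots> = emeasure \<mu> (A \<inter> cyl \<Lambda> \<xi>)"
          using A C by (intro nn_integral_indicator) (auto simp: sets)
        finally show ?thesis by (simp add: emeasure_eq_measure)
      qed
      have "D = D'"
      proof (rule measure_eqI_generator_eq[OF Int_stable_windows])
        show "insert UNIV (insert {} windows) \<subseteq> Pow UNIV" by simp
        show "range (\<lambda>_::nat. UNIV) \<subseteq> insert UNIV (insert {} windows)" by simp
        show "sets D = sigma_sets UNIV (insert UNIV (insert {} windows))"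
          "sets D' = sigma_sets UNIV (insert UNIV (insert {} windows))"
          by (simp_all add: D_def D'_def sets sets_borel_windows[symmetric])
        show "emeasure D UNIV \<noteq> \<infinity>" by (simp add: D)
        fix A :: "(int \<Rightarrow> 's) set" assume "A \<in> insert UNIV (insert {} windows)"
        then have A: "open A" "closed A" by (auto simp: windows_def open_cyl closed_cyl finite_window)
        have Ab: "A \<in> sets borel" using A(1) by (rule borel_open)
        have AC: "open (A \<inter> cyl \<Lambda> \<xi>)" "closed (A \<inter> cyl \<Lambda> \<xi>)"
          using A by (auto intro: open_Int closed_Int open_cyl \<Lambda> closed_cyl)
        define B where "B = patch \<Lambda> \<xi> -` A"
        have B: "open B" "closed B"
          unfolding B_def using A open_vimage[OF _ continuous_patch] closed_vimage[OF _ continuous_patch] by auto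
        have avg: "spec_avg \<phi> \<Lambda> (indicator (A \<inter> cyl \<Lambda> \<xi>)) x = h x * indicator B x" for x
        proof -
          have "spec_avg \<phi> \<Lambda> (indicator (A \<inter> cyl \<Lambda> \<xi>)) x
            = (\<Sum>y\<in>cyl (- \<Lambda>) x. if y = patch \<Lambda> \<xi> x then h x * indicator B x else 0)"
            unfolding spec_avg_def
          proof (rule sum.cong[OF refl])
            fix y assume "y \<in> cyl (- \<Lambda>) x"
            then have "y \<in> cyl \<Lambda> \<xi> \<longleftrightarrow> y = patch \<Lambda> \<xi> x"
              by (auto simp: cyl_iff patch_def fun_eq_iff)
            then show "\<phi> \<Lambda> y * indicator (A \<inter> cyl \<Lambda> \<xi>) y = (if y = patch \<Lambda> \<xi> x then h x * indicator B x else 0)"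
              by (auto simp: h_def B_def indicator_def)
          qed
          also have "\<dots> = h x * indicator B x"
          proof -
            have "patch \<Lambda> \<xi> x \<in> cyl (- \<Lambda>) x" by (auto simp: cyl_iff patch_def)
            then show ?thesis using finite_cyl[OF \<Lambda>(1), of x] by (simp add: sum.delta)
          qed
          finally show ?thesis .
        qed
        have "measure \<mu> (A \<inter> cyl \<Lambda> \<xi>) = I (indicator (A \<inter> cyl \<Lambda> \<xi>))" by (rule clopen[OF AC])
        also have "\<dots> = I (\<lambda>x. h x * indicator B x)"
          using I_avg[OF bdd_fun_indicator \<Lambda>, of "A \<inter> cyl \<Lambda> \<xi>"] unfolding avg[abs_def] by simp
        also have "\<dots> = (\<integral>x. h x * indicator B x \<partial>\<mu>)"
          by (rule rep[symmetric]) (intro continuous_on_mult h_cont continuous_indicator_clopen B)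
        finally show "emeasure D A = emeasure D' A" using D[OF Ab] D'[OF Ab] by (simp add: B_def)
      qed simp
      have "AE x in \<mu>. real_cond_exp \<mu> \<F> (indicator (cyl \<Lambda> \<xi>)) x = h x"
      proof (rule fs.real_cond_exp_charact)
        fix A assume A: "A \<in> sets \<F>"
        then have A\<mu>: "A \<in> sets \<mu>" using sub by (auto simp: subalgebra_def)
        \<comment> \<open>Writing \<xi> into \<Lambda> does not affect events of the outside
          coordinates, so D = D' becomes the characterization of the conditional
          probability.\<close>
        have "indicator A x = (indicator A (patch \<Lambda> \<xi> x) :: real)" for x
        proof (rule coord_algebra_depends[where h="indicator A"])
          show "indicator A \<in> borel_measurable (coord_algebra (- \<Lambda>))"
            using A unfolding \<F>_def by (rule borel_measurable_indicator)
        qed (simp add: patch_def)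
        then have ind: "indicator (patch \<Lambda> \<xi> -` A) x = (indicator A x :: real)" for x
          by (simp add: indicator_def)
        have Ab: "A \<in> sets borel" using A\<mu> sets by simp
        have "ennreal (measure \<mu> (A \<inter> cyl \<Lambda> \<xi>)) = ennreal (\<integral>x. h x * indicator A x \<partial>\<mu>)"
        proof -
          have "emeasure D' A = emeasure D A" using \<open>D = D'\<close> by simp
          then show ?thesis unfolding D[OF Ab] D'[OF Ab] ind .
        qed
        moreover have "0 \<le> (\<integral>x. h x * indicator A x \<partial>\<mu>)"
          by (intro Bochner_Integration.integral_nonneg) (simp add: h_nonneg)
        ultimately have eq: "measure \<mu> (A \<inter> cyl \<Lambda> \<xi>) = (\<integral>x. h x * indicator A x \<partial>\<mu>)" by simp
        have "(\<integral>x\<in>A. indicator (cyl \<Lambda> \<xi>) x \<partial>\<mu>) = (\<integral>x. indicator (A \<inter> cyl \<Lambda> \<xi>) x \<partial>\<mu>)"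
          unfolding set_lebesgue_integral_def
          by (intro Bochner_Integration.integral_cong) (auto simp: indicator_def)
        also have "\<dots> = (\<integral>x. h x * indicator A x \<partial>\<mu>)" unfolding eq[symmetric] by (simp add: space)
        also have "\<dots> = (\<integral>x\<in>A. h x \<partial>\<mu>)"
          unfolding set_lebesgue_integral_def by (simp add: mult.commute)
        finally show "(\<integral>x\<in>A. indicator (cyl \<Lambda> \<xi>) x \<partial>\<mu>) = (\<integral>x\<in>A. h x \<partial>\<mu>)" .
      next
        show "integrable \<mu> (indicator (cyl \<Lambda> \<xi>) :: _ \<Rightarrow> real)"
          using C by (intro integrable_real_indicator) (auto simp: less_top[symmetric])
        show "integrable \<mu> h"
          using h_meas h_nonneg h_le by (intro integrable_const_bound[of _ 1]) (auto simp: meas_eq)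
        show "h \<in> borel_measurable \<F>"
          unfolding h_def \<F>_def using \<phi>_meas patch_measurable by (rule measurable_compose_rev)
      qed
      then show ?thesis by (simp add: h_def)
    qed
    \<comment> \<open>The finitely many patterns on \<Lambda> are represented by the configurations
      equal to x0 elsewhere, so that one null set serves them all.\<close>
    define x0 where "x0 = (undefined :: int \<Rightarrow> 's)"
    have "AE x in \<mu>. \<forall>\<xi>\<in>cyl (- \<Lambda>) x0. real_cond_exp \<mu> \<F> (indicator (cyl \<Lambda> \<xi>)) x = \<phi> \<Lambda> (patch \<Lambda> \<xi> x)"
      using finite_cyl[OF \<Lambda>(1)] cond by (intro AE_finite_allI) auto
    then show "AE x in \<mu>. real_cond_exp \<mu> (coord_algebra (- \<Lambda>)) (indicator (cyl \<Lambda> x)) x = \<phi> \<Lambda> x"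
    proof eventually_elim
      case (elim x)
      have "patch \<Lambda> x x0 \<in> cyl (- \<Lambda>) x0" "cyl \<Lambda> (patch \<Lambda> x x0) = cyl \<Lambda> x" "patch \<Lambda> (patch \<Lambda> x x0) x = x"
        by (auto simp: cyl_iff patch_def)
      then show ?case using elim unfolding \<F>_def by metis
    qed
  qed
  moreover have "shift_invariant_measure \<mu>"
    unfolding shift_invariant_measure_def
  proof (rule prob_eq_if_windows_eq[OF _ prob _ sets])
    have sh: "shift \<in> measurable \<mu> borel" unfolding meas_eq by (rule shift_measurable)
    then show "prob_space (distr \<mu> borel shift)" by (rule prob_space_distr)
    fix n and x :: "int \<Rightarrow> 's"
    define w where "w = cyl (window n) x"
    have w: "open w" "closed w" by (auto simp: w_def open_cyl closed_cyl finite_window)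
    have "measure (distr \<mu> borel shift) w = measure \<mu> (shift -` w)"
      using sh borel_open[OF w(1)] by (simp add: measure_distr space)
    also have "\<dots> = I (indicator (shift -` w))"
      using w by (intro clopen) (auto intro: open_vimage closed_vimage continuous_shift)
    also have "indicator (shift -` w) = (\<lambda>x. indicator w (shift x) :: real)"
      by (simp add: fun_eq_iff indicator_def)
    also have "I \<dots> = I (indicator w)" by (rule I_shift[OF bdd_fun_indicator])
    also have "\<dots> = measure \<mu> w" by (rule clopen[OF w, symmetric])
    finally show "measure (distr \<mu> borel shift) (cyl (window n) x) = measure \<mu> (cyl (window n) x)"
      by (simp add: w_def)
  qed simp
  ultimately show ?thesis by blast
qed

end

theorem theorem6p1:
  fixes \<phi> :: "int set \<Rightarrow> (int \<Rightarrow> 's::{finite, discrete_topology}) \<Rightarrow> real"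
    and f :: "nat \<Rightarrow> (int \<Rightarrow> 's) \<Rightarrow> real"
    and \<alpha> K :: real
  assumes "is_specification \<phi>"
    and "positive_spec \<phi>"
    and "continuous_spec \<phi>"
    and "shift_invariant_spec \<phi>"
    and "specification_sequence_for f \<phi>"
    and "0 < \<alpha>" and "\<alpha> \<le> 1" and "0 < K"
    and "limsup (\<lambda>n. ereal (real n powr (\<alpha> - 1)) *
           (\<Prod>i\<le>n. SUP j. ratio_osc {..int i + int j} (f j))) \<le> ereal K"
    and "limsup (\<lambda>n. ereal (real n powr (1 / 2)) *
           ereal_powr (ereal_ln (SUP j. ratio_osc {- int n..} (f j))) \<alpha>) < ereal (inverse K * Gamma \<alpha>)"
  shows "\<exists>!\<mu>. gibbs_state \<phi> \<mu> \<and> shift_invariant_measure \<mu>"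
proof -
  interpret decaying_specification \<phi> f \<alpha> K by unfold_locales fact+
  interpret invariant_specification \<phi> by unfold_locales fact+
  show ?thesis using invariant_gibbs_exists invariant_gibbs_unique by blast
qed

end
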